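(* Let $R$ be a skew-invertible Hecke symmetry with generic parameter $q$ and let $L(u)$ be the generating matrix of the corresponding braided Yangian $\mathbf Y(R)$. Then the following matrix identities hold: $$(-1)^{k+1}k_q\,L^{\wedge k}(u)=\sum_{p=1}^k(-q)^{k-p}L^p(q^{-2(k-p)}u)\,e_{k-p}(u)\qquad\forall\,k\ge1.$$
   Context: Let $\mathbb K=\mathbb C$ or $\mathbb R$, $V$ a $\mathbb K$-vector space with $\dim V=N$ and basis $\{x_i\}$. A braiding is an operator $R:V^{\otimes 2}\to V^{\otimes 2}$ with $R_{12}R_{23}R_{12}=R_{23}R_{12}R_{23}$ on $V^{\otimes 3}$ (lower indices label the tensor factors on which an operator acts; $R_k:=R_{k\,k+1}$). It is a Hecke symmetry if $(qI-R)(q^{-1}I+R)=0$, $q\in\mathbb K$, $q^2\neq 1$; $q$ is generic, i.e. $q^n\ne 1$ for every nonzero integer $n$. Matrix of $R$: $R(x_i\otimes x_j)=R_{ij}^{kl}x_k\otimes x_l$ (summation over repeated indices; lower index = row, upper index = column). $R$ is skew-invertible if there is $\Psi:V^{\otimes 2}\to V^{\otimes 2}$ with $\mathrm{Tr}_2R_{12}\Psi_{23}=P_{13}$ ($P$ the flip), i.e. $R_{ij}^{kl}\Psi_{lp}^{jq}=\delta_i^q\delta_p^k$. Put $C=\mathrm{Tr}_2\Psi$, i.e. $C_i^j=\Psi_{ik}^{jk}$. The $R$-trace of an $N\times N$ matrix $M$ is $\mathrm{Tr}_RM=\mathrm{Tr}(CM)$, and $\mathrm{Tr}_{R(i_1\dots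 i_k)}X=\mathrm{Tr}_{i_1\dots i_k}(C_{i_1}\cdots C_{i_k}X)$. $k_q=(q^k-q^{-k})/(q-q^{-1})$. Skew-symmetrizers: $\mathcal P_-^{(1)}=I$, $\mathcal P_-^{(k)}=\frac1{k_q}\mathcal P_-^{(k-1)}\big(q^{k-1}I-(k-1)_qR_{k-1}\big)\mathcal P_-^{(k-1)}$, acting in positions $1,\dots,k$. Braided Yangian $\mathbf Y(R)$: let $R(u,v)=R-\frac{(q-q^{-1})u}{u-v}I$. $\mathbf Y(R)$ is the unital associative algebra generated by the entries of the coefficients $L[k]$, $k\ge1$, of $L(u)=\sum_{k\ge0}L[k]u^{-k}$, $L[0]=I$, $L[k]=\|l_i^j[k]\|_{1\le i,j\le N}$, subject to $R(u,v)L_1(u)RL_1(v)-L_1(v)RL_1(u)R(u,v)=0$. Put $L_{\overline1}(u)=L_1(u)$, $L_{\overline k}(u)=R_{k-1}L_{\overline{k-1}}(u)R_{k-1}^{-1}$ for $k\ge2$. Define $L^0(u)=I$, $L^k(u)=L(q^{-2(k-1)}u)L(q^{-2(k-2)}u)\cdots L(u)$; $L^{\wedge1}(u)=L(u)$, $L^{\wedge k}(u)=\mathrm{Tr}_{R(2\dots k)}\big(\mathcal P_-^{(k)}L_{\overline1}(u)L_{\overline2}(q^{-2}u)\cdots L_{\overline k}(q^{-2(k-1)}u)\big)$ for $k\ge2$; $e_0(u)=1$, $e_k(u)=\mathrm{Tr}_RL^{\wedge k}(u)$ for $k\ge1$. *)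

theory Defs
  imports
    "HOL-Analysis.Finite_Cartesian_Product"
    "HOL-Analysis.Determinants"
    "HOL-Library.Poly_Mapping"
    "HOL-Computational_Algebra.Formal_Laurent_Series"
begin

unbundle no Formal_Power_Series.fps_syntax

text \<open>
  The basis of \<open>V\<close> is indexed by a finite type \<open>'n\<close>, so \<open>N = CARD('n)\<close>. An operator on
  \<open>V \<otimes> V\<close> is given by its matrix, lower indices being the row and upper indices the column:
  \<open>R $ (i, j) $ (k, l)\<close> is the coefficient of \<open>x_k \<otimes> x_l\<close> in \<open>R (x_i \<otimes> x_j)\<close>. All products are
  matrix products in this convention.

  Operators on the \<open>m\<close>-fold tensor power are matrices whose rows and columns are multi-indices,
  represented as lists of length \<open>m\<close>; their values on lists of other lengths are irrelevant.
\<close>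

type_synonym ('n, 'r) tens_mat = "'n list \<Rightarrow> 'n list \<Rightarrow> 'r"

definition tid :: "('n, 'r::zero_neq_one) tens_mat" where
  "tid = (\<lambda>a b. if a = b then 1 else 0)"

definition tmult :: "nat \<Rightarrow> ('n::finite, 'r::semiring_1) tens_mat \<Rightarrow> ('n, 'r) tens_mat \<Rightarrow> ('n, 'r) tens_mat"
  where "tmult m A B = (\<lambda>a b. \<Sum>c | length c = m. A a c * B c b)"

definition tprod :: "nat \<Rightarrow> ('n::finite, 'r::semiring_1) tens_mat list \<Rightarrow> ('n, 'r) tens_mat" where
  "tprod m As = foldr (tmult m) As tid"

definition tmap :: "('r \<Rightarrow> 's) \<Rightarrow> ('n, 'r) tens_mat \<Rightarrow> ('n, 's) tens_mat" where
  "tmap f A = (\<lambda>a b. f (A a b))"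

text \<open>Positions are numbered from 1: \<open>at_pos s M\<close> is \<open>M\<^sub>s\<close> and \<open>at_pos2 s M\<close> is \<open>M\<close> acting in
  positions \<open>s, s + 1\<close>.\<close>

definition at_pos :: "nat \<Rightarrow> 'r::zero ^ 'n::finite ^ 'n \<Rightarrow> ('n, 'r) tens_mat" where
  "at_pos s M = (\<lambda>a b.
     if \<forall>t < length a. t \<noteq> s - 1 \<longrightarrow> a ! t = b ! t
     then M $ (a ! (s - 1)) $ (b ! (s - 1)) else 0)"

definition at_pos2 :: "nat \<Rightarrow> 'r::zero ^ ('n::finite \<times> 'n) ^ ('n \<times> 'n) \<Rightarrow> ('n, 'r) tens_mat" where
  "at_pos2 s M = (\<lambda>a b.
     if \<forall>t < length a. t \<noteq> s - 1 \<and> t \<noteq> s \<longrightarrow> a ! t = b ! t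
     then M $ (a ! (s - 1), a ! s) $ (b ! (s - 1), b ! s) else 0)"


section \<open>Hecke symmetries\<close>

text \<open>Equality is only required at multi-indices of length 3.\<close>

definition braiding :: "'k::field ^ ('n::finite \<times> 'n) ^ ('n \<times> 'n) \<Rightarrow> bool" where
  "braiding R \<longleftrightarrow> (\<forall>a b. length a = 3 \<longrightarrow> length b = 3 \<longrightarrow>
     tprod 3 [at_pos2 1 R, at_pos2 2 R, at_pos2 1 R] a b =
     tprod 3 [at_pos2 2 R, at_pos2 1 R, at_pos2 2 R] a b)"

definition hecke_symmetry :: "'k::field \<Rightarrow> 'k ^ ('n::finite \<times> 'n) ^ ('n \<times> 'n) \<Rightarrow> bool" where
  "hecke_symmetry q R \<longleftrightarrow>
     q \<noteq> 0 \<and> q\<^sup>2 \<noteq> 1 \<and> braiding R \<and> (mat q - R) ** (mat (inverse q) + R) = 0"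

definition generic :: "'k::field \<Rightarrow> bool" where
  "generic q \<longleftrightarrow> q \<noteq> 0 \<and> (\<forall>n::int. n \<noteq> 0 \<longrightarrow> q powi n \<noteq> 1)"

text \<open>The operator \<open>\<Psi>\<close> below is unique if it exists, since the condition says that two
  reshuffled \<open>N\<^sup>2 \<times> N\<^sup>2\<close> matrices are inverse to each other up to a permutation matrix.\<close>

definition is_skew_inverse ::
  "'k::field ^ ('n::finite \<times> 'n) ^ ('n \<times> 'n) \<Rightarrow> 'k ^ ('n \<times> 'n) ^ ('n \<times> 'n) \<Rightarrow> bool" where
  "is_skew_inverse R \<Psi> \<longleftrightarrow> (\<forall>i k p r.
     (\<Sum>j\<in>UNIV. \<Sum>l\<in>UNIV. R $ (i, j) $ (k, l) * \<Psi> $ (l, p) $ (j, r)) =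
     (if i = r \<and> p = k then 1 else 0))"

definition C_mat :: "'k::field ^ ('n::finite \<times> 'n) ^ ('n \<times> 'n) \<Rightarrow> 'k ^ 'n ^ 'n" where
  "C_mat \<Psi> = (\<chi> i j. \<Sum>k\<in>UNIV. \<Psi> $ (i, k) $ (j, k))"

definition qnum :: "'k::field \<Rightarrow> nat \<Rightarrow> 'k" where
  "qnum q k = (q ^ k - inverse q ^ k) / (q - inverse q)"

text \<open>\<open>skew_sym m q R k\<close> is \<open>\<P>\<^sub>-\<close> of order \<open>k\<close>, acting in positions \<open>1, \<dots>, k\<close> of the \<open>m\<close>-fold
  tensor power, \<open>1 \<le> k \<le> m\<close>; the value at \<open>k = 0\<close> is a dummy.\<close>

fun skew_sym :: "nat \<Rightarrow> 'k::field \<Rightarrow> 'k ^ ('n::finite \<times> 'n) ^ ('n \<times> 'n) \<Rightarrow> nat \<Rightarrow> ('n, 'k) tens_mat" where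
  "skew_sym m q R 0 = tid"
| "skew_sym m q R (Suc 0) = tid"
| "skew_sym m q R (Suc (Suc k)) =
     (\<lambda>a b. 1 / qnum q (k + 2) *
        tprod m [skew_sym m q R (Suc k),
                 (\<lambda>a b. q ^ (k + 1) * tid a b - qnum q (k + 1) * at_pos2 (k + 1) R a b),
                 skew_sym m q R (Suc k)] a b)"


section \<open>The braided Yangian\<close>

text \<open>Words form the free monoid, so that \<open>('g word, 'k) poly_mapping\<close> with its convolution
  product is the free unital associative algebra over \<open>'k\<close> on the set of generators \<open>'g\<close>.\<close>

datatype 'g word = Word "'g list"

instantiation word :: (type) monoid_add
begin

definition zero_word :: "'a word" where "zero_word = Word []"

fun plus_word :: "'a word \<Rightarrow> 'a word \<Rightarrow> 'a word" where
  "plus_word (Word v) (Word w) = Word (v @ w)"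

instance
proof
  fix a b c :: "'a word"
  show "a + b + c = a + (b + c)" by (cases a; cases b; cases c) simp
  show "0 + a = a" by (cases a) (simp add: zero_word_def)
  show "a + 0 = a" by (cases a) (simp add: zero_word_def)
qed

end

text \<open>The generator with label \<open>(i, j, r)\<close> stands for the entry \<open>l\<^sub>i\<^sup>j[r + 1]\<close>.\<close>

type_synonym ('n, 'k) free_alg = "(('n \<times> 'n \<times> nat) word, 'k) poly_mapping"

definition scal :: "'k::field \<Rightarrow> ('n, 'k) free_alg" where
  "scal c = Poly_Mapping.single 0 c"

definition L_coeff :: "nat \<Rightarrow> 'n \<Rightarrow> 'n \<Rightarrow> ('n, 'k::field) free_alg" where
  "L_coeff r i j =
     (if r = 0 then (if i = j then 1 else 0)
      else Poly_Mapping.single (Word [(i, j, r - 1)]) 1)"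

text \<open>Series in \<open>u\<^sup>-\<^sup>1\<close> are formal power series whose variable stands for \<open>u\<^sup>-\<^sup>1\<close>.\<close>

definition L_gen :: "('n::finite, 'k::field) free_alg fps ^ 'n ^ 'n" where
  "L_gen = (\<chi> i j. Abs_fps (\<lambda>r. L_coeff r i j))"

text \<open>The defining relation involves two spectral parameters. It is read in power series in
  \<open>u\<^sup>-\<^sup>1\<close> whose coefficients are Laurent series in \<open>v\<^sup>-\<^sup>1\<close> (so \<open>fps_X\<close> is \<open>u\<^sup>-\<^sup>1\<close>, \<open>fls_X_inv\<close> is \<open>v\<close>),
  with \<open>u / (u - v) = 1 / (1 - v / u)\<close> expanded in powers of \<open>v / u\<close>. As \<open>1 - v / u\<close> is invertible
  here, this amounts to clearing the denominator, hence is independent of the chosen expansion.\<close>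

definition scal2 :: "'k::field \<Rightarrow> ('n, 'k) free_alg fls fps" where
  "scal2 c = fps_const (fls_const (scal c))"

definition u_over_u_minus_v :: "'a::ring_1 fls fps" where
  "u_over_u_minus_v = Abs_fps (\<lambda>r. fls_X_inv ^ r)"

lemma u_over_u_minus_v:
  "(1 - fps_const fls_X_inv * fps_X) * (u_over_u_minus_v :: 'a::ring_1 fls fps) = 1"
proof (rule fps_ext)
  fix n
  show "fps_nth ((1 - fps_const fls_X_inv * fps_X) * (u_over_u_minus_v :: 'a fls fps)) n = fps_nth 1 n"
    by (cases n) (simp_all add: u_over_u_minus_v_def left_diff_distrib mult.assoc)
qed

definition R_uv ::
  "'k::field \<Rightarrow> 'k ^ ('n::finite \<times> 'n) ^ ('n \<times> 'n) \<Rightarrow> ('n, ('n, 'k) free_alg fls fps) tens_mat" where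
  "R_uv q R = (\<lambda>a b. scal2 (at_pos2 1 R a b) - scal2 (q - inverse q) * u_over_u_minus_v * tid a b)"

definition L1_u :: "('n::finite, ('n, 'k::field) free_alg fls fps) tens_mat" where
  "L1_u = at_pos 1 (\<chi> i j. Abs_fps (\<lambda>r. fls_const (fps_nth (L_gen $ i $ j) r)))"

definition L1_v :: "('n::finite, ('n, 'k::field) free_alg fls fps) tens_mat" where
  "L1_v = at_pos 1 (\<chi> i j. fps_const (fps_to_fls (L_gen $ i $ j)))"

definition yangian_relation ::
  "'k::field \<Rightarrow> 'k ^ ('n::finite \<times> 'n) ^ ('n \<times> 'n) \<Rightarrow> ('n, ('n, 'k) free_alg fls fps) tens_mat" where
  "yangian_relation q R = (\<lambda>a b.
     tprod 2 [R_uv q R, L1_u, tmap scal2 (at_pos2 1 R), L1_v] a b -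
     tprod 2 [L1_v, tmap scal2 (at_pos2 1 R), L1_u, R_uv q R] a b)"

inductive_set two_sided_ideal :: "'a::ring_1 set \<Rightarrow> 'a set" for S where
  zero: "0 \<in> two_sided_ideal S"
| step: "x \<in> two_sided_ideal S \<Longrightarrow> s \<in> S \<Longrightarrow> x + c * s * d \<in> two_sided_ideal S"

definition yangian_ideal ::
  "'k::field \<Rightarrow> 'k ^ ('n::finite \<times> 'n) ^ ('n \<times> 'n) \<Rightarrow> ('n, 'k) free_alg set" where
  "yangian_ideal q R = two_sided_ideal
     {fls_nth (fps_nth (yangian_relation q R a b) r) s | a b (r::nat) (s::int). length a = 2 \<and> length b = 2}"

text \<open>The braided Yangian is the quotient of the free algebra by \<open>yangian_ideal q R\<close>. As the
  quotient depends on \<open>q\<close> and \<open>R\<close>, it is not formed as a type: \<open>yangian_eq\<close> is equality of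
  matrices of series with coefficients in this quotient, given by representatives.\<close>

definition yangian_eq ::
  "'k::field \<Rightarrow> 'k ^ ('n::finite \<times> 'n) ^ ('n \<times> 'n) \<Rightarrow>
   ('n, 'k) free_alg fps ^ 'n ^ 'n \<Rightarrow> ('n, 'k) free_alg fps ^ 'n ^ 'n \<Rightarrow> bool" where
  "yangian_eq q R A B \<longleftrightarrow>
     (\<forall>i j r. fps_nth (A $ i $ j) r - fps_nth (B $ i $ j) r \<in> yangian_ideal q R)"


section \<open>Quantum matrix powers and elementary symmetric elements\<close>

definition fscal :: "'k::field \<Rightarrow> ('n, 'k) free_alg fps" where
  "fscal c = fps_const (scal c)"

text \<open>\<open>rescale c\<close> is the substitution \<open>u \<mapsto> c u\<close> in a matrix of series in \<open>u\<^sup>-\<^sup>1\<close>.\<close>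

definition rescale ::
  "'k::field \<Rightarrow> ('n::finite, 'k) free_alg fps ^ 'n ^ 'n \<Rightarrow> ('n, 'k) free_alg fps ^ 'n ^ 'n" where
  "rescale c A = (\<chi> i j. Abs_fps (\<lambda>r. scal (inverse c ^ r) * fps_nth (A $ i $ j) r))"

primrec L_pow ::
  "'k::field \<Rightarrow> ('n::finite, 'k) free_alg fps ^ 'n ^ 'n \<Rightarrow> nat \<Rightarrow> ('n, 'k) free_alg fps ^ 'n ^ 'n" where
  "L_pow q L 0 = mat 1"
| "L_pow q L (Suc k) = rescale (inverse q ^ (2 * k)) L ** L_pow q L k"

text \<open>\<open>L_bar m R L k\<close> acts in the \<open>m\<close>-fold tensor power, \<open>1 \<le> k \<le> m\<close>; the value at \<open>k = 0\<close> is a dummy.\<close>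

fun L_bar ::
  "nat \<Rightarrow> 'k::field ^ ('n::finite \<times> 'n) ^ ('n \<times> 'n) \<Rightarrow> ('n, 'k) free_alg fps ^ 'n ^ 'n \<Rightarrow> nat \<Rightarrow>
   ('n, ('n, 'k) free_alg fps) tens_mat" where
  "L_bar m R L 0 = tid"
| "L_bar m R L (Suc 0) = at_pos 1 L"
| "L_bar m R L (Suc (Suc k)) =
     tprod m [tmap fscal (at_pos2 (Suc k) R), L_bar m R L (Suc k),
              tmap fscal (at_pos2 (Suc k) (matrix_inv R))]"

text \<open>\<open>R\<close>-trace over positions \<open>2, \<dots>, k\<close> of an operator on the \<open>k\<close>-fold tensor power.\<close>

definition R_trace_from2 ::
  "'k::field ^ 'n::finite ^ 'n \<Rightarrow> nat \<Rightarrow> ('n::finite, ('n, 'k) free_alg fps) tens_mat \<Rightarrow>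
   ('n, 'k) free_alg fps ^ 'n ^ 'n" where
  "R_trace_from2 C k X = (\<chi> i j. \<Sum>a | length a = k - 1.
     tprod k (map (\<lambda>s. tmap fscal (at_pos s C)) [2..<Suc k] @ [X]) (i # a) (j # a))"

definition L_wedge ::
  "'k::field \<Rightarrow> 'k ^ ('n::finite \<times> 'n) ^ ('n \<times> 'n) \<Rightarrow> 'k ^ 'n ^ 'n \<Rightarrow>
   ('n, 'k) free_alg fps ^ 'n ^ 'n \<Rightarrow> nat \<Rightarrow> ('n, 'k) free_alg fps ^ 'n ^ 'n" where
  "L_wedge q R C L k =
     (if k = 1 then L
      else R_trace_from2 C k (tprod k
        (tmap fscal (skew_sym k q R k) #
         map (\<lambda>s. L_bar k R (rescale (inverse q ^ (2 * (s - 1))) L) s) [1..<Suc k])))"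

definition e_elem ::
  "'k::field \<Rightarrow> 'k ^ ('n::finite \<times> 'n) ^ ('n \<times> 'n) \<Rightarrow> 'k ^ 'n ^ 'n \<Rightarrow>
   ('n, 'k) free_alg fps ^ 'n ^ 'n \<Rightarrow> nat \<Rightarrow> ('n, 'k) free_alg fps" where
  "e_elem q R C L k =
     (if k = 0 then 1 else trace ((\<chi> i j. fscal (C $ i $ j)) ** L_wedge q R C L k))"

end

theory Submission
  imports Defs
begin

text \<open>
  Every summand on the right-hand side has \<open>L(q^(-2(k-1))u)\<close> as its left factor. Splitting it off
  shows that the identity is equivalent, by induction on \<open>k\<close>, to the recursion

  \<open>k_q L^(\<and>k)(u) = L(q^(-2(k-1))u) (q^(k-1) e_(k-1)(u) - (k - 1)_q L^(\<and>(k-1))(u))\<close>,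

  which is \<open>wedge_recursion\<close>; the induction is \<open>wedge_expansion\<close>. Modulo the defining relations
  the skew-symmetrizer of order \<open>k\<close> reverses the order of the spectral parameters in
  the product of the matrices \<open>L\<close> in positions \<open>1, \<dots>, k\<close> (\<open>fusion\<close>). This brings the
  factor \<open>L(q^(-2(k-1))u)\<close> to position 1 and out of the \<open>R\<close>-trace. The other factors live in positions
  \<open>2, \<dots>, k\<close>. Building the skew-symmetrizer up from the other end of the chain,

  \<open>k_q P_(1\<dots>k) = P_(2\<dots>k) (q^(k-1) - (k - 1)_q R_1) P_(2\<dots>k)\<close>  (\<open>skew_Suc_low\<close>),

  and moving one \<open>P_(2\<dots>k)\<close> around the trace, one is left with the trace of
  \<open>R_1 \<cdots> R_(k-1) X (R_1 \<cdots> R_(k-1))^(-1) (q^(k-1) - (k - 1)_q R_1)\<close>, where \<open>X\<close> is the operator whose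
  trace is \<open>L^(\<and>(k-1))(u)\<close>. The first term gives the full trace \<open>e_(k-1)(u)\<close> (\<open>traces_conj\<close>), the second
  gives \<open>L^(\<and>(k-1))(u)\<close> itself (\<open>traces_conj_T\<close>).

  What is used about the \<open>R\<close>-trace is that \<open>Tr_(R(2)) R_12 = 1\<close>, that
  \<open>Tr_(R(2)) R_12 X_1 R_12^(-1) = Tr_R X\<close>, and that \<open>C_1C_2\<close> commutes with \<open>R_12\<close>; all three follow from
  skew-invertibility and the braid relation
  (\<open>C_mat_trace\<close>, \<open>conj_kernel_hecke\<close>, \<open>twofold_C_commute\<close>).

  The operators on all tensor powers are realized in one ring, the row-finite matrices indexed by
  sequences in \<open>'n\<close>: an operator on finitely many factors acts on the corresponding entries of a
  sequence and leaves the others alone. Partial traces are then maps of this ring to itself, and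
  passing to the quotient by the defining relations becomes a congruence modulo a two-sided ideal.
  The recursion is proved from axioms for such a ring, collected in the locale \<open>braided_trace\<close>.
  Positions in the ring are counted from 0.
\<close>

section \<open>Antisymmetrizers in quotients of Hecke algebras\<close>

locale algebra_over_field = vector_space scale
  for scale :: "'k::field \<Rightarrow> 'b::ring_1 \<Rightarrow> 'b" (infixr "\<cdot>" 75) +
  assumes scale_mult_left [simp]: "(a \<cdot> x) * y = a \<cdot> (x * y)"
    and scale_mult_right [simp]: "x * (a \<cdot> y) = a \<cdot> (x * y)"
begin

lemmas alg_simps = distrib_left distrib_right left_diff_distrib right_diff_distrib mult.assoc
  scale_right_distrib scale_left_distrib scale_right_diff_distrib scale_left_diff_distrib

end

text \<open>
  The form in which genericity of \<open>q\<close> enters: all \<open>q\<close>-integers can be inverted.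
\<close>
definition q_numbers_nonzero :: "'k::field \<Rightarrow> bool" where
  "q_numbers_nonzero q \<longleftrightarrow> q \<noteq> 0 \<and> q - inverse q \<noteq> 0 \<and> (\<forall>n\<ge>1. qnum q n \<noteq> 0)"

lemma qnum_Suc:
  assumes "q \<noteq> 0" "q - inverse q \<noteq> 0"
  shows "qnum q (Suc n) = q ^ n + inverse q * qnum q n"
proof -
  have "q ^ Suc n - inverse q ^ Suc n = q ^ n * (q - inverse q) + inverse q * (q ^ n - inverse q ^ n)"
    using assms(1) by (simp add: algebra_simps)
  then show ?thesis using assms unfolding qnum_def
    by (simp add: add_divide_distrib)
qed

context algebra_over_field
begin

text \<open>
  The generators of a Hecke algebra have the eigenvalues \<open>q\<close> and \<open>- 1 / q\<close>. Absorbing them with the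
  second eigenvalue is the analogue of being alternating under transpositions.
\<close>
definition absorbs :: "'k \<Rightarrow> 'b set \<Rightarrow> 'b \<Rightarrow> bool" where
  "absorbs q G p \<longleftrightarrow> (\<forall>t\<in>G. p * t = (- inverse q) \<cdot> p)"

definition absorbs_left :: "'k \<Rightarrow> 'b set \<Rightarrow> 'b \<Rightarrow> bool" where
  "absorbs_left q G p \<longleftrightarrow> (\<forall>t\<in>G. t * p = (- inverse q) \<cdot> p)"

text \<open>
  The last two clauses play the role of a normalization: they make the element idempotent and,
  more importantly, unique. So two recursive constructions can be identified without comparing
  them term by term.
\<close>
definition antisymmetrizer :: "'k \<Rightarrow> 'b set \<Rightarrow> 'b \<Rightarrow> bool" where
  "antisymmetrizer q G p \<longleftrightarrow> absorbs q G p \<and> absorbs_left q G p \<and>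
     (\<forall>x. absorbs q G x \<longrightarrow> x * p = x) \<and> (\<forall>x. absorbs_left q G x \<longrightarrow> p * x = x)"

lemma antisymmetrizer_unique:
  "antisymmetrizer q G p \<Longrightarrow> antisymmetrizer q G p' \<Longrightarrow> p = p'"
  unfolding antisymmetrizer_def by metis

definition hecke_generators :: "'k \<Rightarrow> nat \<Rightarrow> (nat \<Rightarrow> 'b) \<Rightarrow> bool" where
  "hecke_generators q n t \<longleftrightarrow>
     (\<forall>i<n. t i * t i = 1 + (q - inverse q) \<cdot> t i) \<and>
     (\<forall>i. Suc i < n \<longrightarrow> t i * t (Suc i) * t i = t (Suc i) * t i * t (Suc i)) \<and>
     (\<forall>i j. i + 2 \<le> j \<longrightarrow> j < n \<longrightarrow> t i * t j = t j * t i)"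

text \<open>
  The sum over the minimal coset representatives \<open>t_(n-1) t_(n-2) \<cdots> t_j\<close> of \<open>S_n\<close> in \<open>S_(n+1)\<close>, weighted by
  \<open>- 1 / q\<close> to the power of their length. Multiplied from the left by an antisymmetrizer for the smaller group it gives one for
  the larger group up to a factor, and unlike the defining recursion of the skew-symmetrizers it
  lends itself to induction.
\<close>
primrec coset_sum :: "'k \<Rightarrow> (nat \<Rightarrow> 'b) \<Rightarrow> nat \<Rightarrow> 'b" where
  "coset_sum q t 0 = 1"
| "coset_sum q t (Suc n) = 1 + (- inverse q) \<cdot> (t n * coset_sum q t n)"

primrec coset_sum_left :: "'k \<Rightarrow> (nat \<Rightarrow> 'b) \<Rightarrow> nat \<Rightarrow> 'b" where
  "coset_sum_left q t 0 = 1"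
| "coset_sum_left q t (Suc n) = 1 + (- inverse q) \<cdot> (coset_sum_left q t n * t n)"

lemma coset_sum_commute:
  assumes "\<And>i. i < n \<Longrightarrow> t i * x = x * t i"
  shows "coset_sum q t n * x = x * coset_sum q t n"
  using assms
proof (induction n)
  case (Suc n)
  have "t n * coset_sum q t n * x = x * (t n * coset_sum q t n)"
    using Suc.IH Suc.prems[of n] Suc.prems by (metis less_Suc_eq mult.assoc)
  then show ?case by (simp add: alg_simps)
qed simp

lemma coset_sum_left_commute:
  assumes "\<And>i. i < n \<Longrightarrow> t i * x = x * t i"
  shows "coset_sum_left q t n * x = x * coset_sum_left q t n"
  using assms
proof (induction n)
  case (Suc n)
  have "coset_sum_left q t n * t n * x = x * (coset_sum_left q t n * t n)"
    using Suc.IH Suc.prems[of n] Suc.prems by (metis less_Suc_eq mult.assoc)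
  then show ?case by (simp add: alg_simps)
qed simp

lemma hecke_generators_mono: "hecke_generators q (Suc n) t \<Longrightarrow> hecke_generators q n t"
  unfolding hecke_generators_def by (meson less_SucI)

lemma hecke_generators_far: "hecke_generators q n t \<Longrightarrow> i + 2 \<le> j \<Longrightarrow> j < n \<Longrightarrow> t i * t j = t j * t i"
  unfolding hecke_generators_def by blast

text \<open>
  For \<open>i < n\<close> the absorption of \<open>t_i\<close> is inherited by induction, because \<open>p t_n\<close> again absorbs
  \<open>t_0, \<dots>, t_(n-2)\<close>. For \<open>t_n\<close> itself one pulls a factor \<open>t_(n-1)\<close> through with the braid relation and lets \<open>p\<close>
  absorb it.
\<close>
lemma absorbs_coset_sum:
  assumes "q \<noteq> 0" "hecke_generators q (Suc n) t" "absorbs q (t ` {..<n}) p"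
  shows "absorbs q (t ` {..n}) (p * coset_sum q t (Suc n))"
  using assms
proof (induction n arbitrary: p)
  case 0
  have quad: "t 0 * t 0 = 1 + (q - inverse q) \<cdot> t 0"
    using 0 unfolding hecke_generators_def by simp
  have c: "1 + - inverse q * (q - inverse q) = (- inverse q) * (- inverse q)"
    using \<open>q \<noteq> 0\<close> by (simp add: algebra_simps)
  have "p * (1 + (- inverse q) \<cdot> t 0) * t 0
      = (1::'k) \<cdot> (p * t 0) + (- inverse q) \<cdot> p + (- inverse q * (q - inverse q)) \<cdot> (p * t 0)"
    by (simp add: alg_simps quad)
  also have "\<dots> = (- inverse q) \<cdot> p + (1 + - inverse q * (q - inverse q)) \<cdot> (p * t 0)"
    by (simp add: alg_simps)
  also have "\<dots> = (- inverse q) \<cdot> (p * (1 + (- inverse q) \<cdot> t 0))"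
    unfolding c by (simp add: alg_simps)
  finally show ?case by (simp add: absorbs_def)
next
  case (Suc n)
  let ?k = "- inverse q" and ?y = "coset_sum q t"
  have quad: "t (Suc n) * t (Suc n) = 1 + (q - inverse q) \<cdot> t (Suc n)"
    and braid: "t n * t (Suc n) * t n = t (Suc n) * t n * t (Suc n)"
    using Suc.prems unfolding hecke_generators_def by simp_all
  have far: "t i * t (Suc n) = t (Suc n) * t i" if "i < n" for i
    using hecke_generators_far[OF Suc.prems(2), of i "Suc n"] that by simp
  have abs: "p * t i = ?k \<cdot> p" if "i < Suc n" for i
    using Suc.prems that unfolding absorbs_def by blast
  have lower: "p * ?y (Suc (Suc n)) * t i = ?k \<cdot> (p * ?y (Suc (Suc n)))" if "i \<le> n" for i
  proof -
    have "absorbs q (t ` {..<n}) (p * t (Suc n))"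
      unfolding absorbs_def
    proof clarify
      fix i assume "i < n"
      then have "p * t (Suc n) * t i = p * t i * t (Suc n)"
        by (simp only: mult.assoc far)
      then show "p * t (Suc n) * t i = ?k \<cdot> (p * t (Suc n))"
        using abs[of i] \<open>i < n\<close> by simp
    qed
    from Suc.IH[OF Suc.prems(1) hecke_generators_mono[OF Suc.prems(2)] this] that
    have "p * t (Suc n) * ?y (Suc n) * t i = ?k \<cdot> (p * t (Suc n) * ?y (Suc n))"
      unfolding absorbs_def by blast
    then show ?thesis
      unfolding coset_sum.simps(2)[of _ _ "Suc n"] using abs[of i] that
      by (simp add: alg_simps del: coset_sum.simps)
  qed
  have top: "p * ?y (Suc (Suc n)) * t (Suc n) = ?k \<cdot> (p * ?y (Suc (Suc n)))"
  proof -
    have com: "?y n * t (Suc n) = t (Suc n) * ?y n"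
      by (rule coset_sum_commute, rule far)
    have "p * (t (Suc n) * t n * ?y n * t (Suc n)) = p * (t (Suc n) * t n * t (Suc n)) * ?y n"
      by (simp add: alg_simps com)
    also have "\<dots> = p * t n * t (Suc n) * t n * ?y n"
      unfolding braid[symmetric] by (simp only: mult.assoc)
    also have "\<dots> = ?k \<cdot> (p * (t (Suc n) * t n * ?y n))"
      using abs[of n] by (simp add: alg_simps)
    finally have 1: "p * (t (Suc n) * t n * ?y n * t (Suc n)) = ?k \<cdot> (p * (t (Suc n) * t n * ?y n))" .
    define z where "z = p * (t (Suc n) * t n * ?y n)"
    have z1: "p * (t (Suc n) * (t n * ?y n)) = z"
      and z2: "p * (t (Suc n) * (t n * (?y n * t (Suc n)))) = ?k \<cdot> z"
      using 1 by (simp_all add: z_def mult.assoc)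
    have qq: "1 + - inverse q * (q - inverse q) = - inverse q * - inverse q"
      using \<open>q \<noteq> 0\<close> by (simp add: algebra_simps)
    have "p * ?y (Suc (Suc n)) * t (Suc n)
       = p * t (Suc n) + ?k \<cdot> p + (- inverse q * (q - inverse q)) \<cdot> (p * t (Suc n)) + ?k \<cdot> (?k \<cdot> (?k \<cdot> z))"
      by (simp add: alg_simps quad z2)
    also have "\<dots> = ?k \<cdot> p + (1 + - inverse q * (q - inverse q)) \<cdot> (p * t (Suc n)) + ?k \<cdot> (?k \<cdot> (?k \<cdot> z))"
      by (simp add: alg_simps)
    also have "\<dots> = ?k \<cdot> (p * ?y (Suc (Suc n)))"
      unfolding qq by (simp add: alg_simps z1)
    finally show ?thesis .
  qed
  show ?case unfolding absorbs_def
    using lower top by (auto simp add: le_Suc_eq simp del: coset_sum.simps)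
qed

text \<open>
  The mirror image of the previous lemma. The relations are invariant under reversal of words, so
  the same computation applies.
\<close>
lemma absorbs_left_coset_sum_left:
  assumes "q \<noteq> 0" "hecke_generators q (Suc n) t" "absorbs_left q (t ` {..<n}) p"
  shows "absorbs_left q (t ` {..n}) (coset_sum_left q t (Suc n) * p)"
  using assms
proof (induction n arbitrary: p)
  case 0
  have quad: "t 0 * t 0 = 1 + (q - inverse q) \<cdot> t 0"
    using 0 unfolding hecke_generators_def by simp
  have c: "1 + - inverse q * (q - inverse q) = (- inverse q) * (- inverse q)"
    using \<open>q \<noteq> 0\<close> by (simp add: algebra_simps)
  have "t 0 * ((1 + (- inverse q) \<cdot> t 0) * p)
      = (1::'k) \<cdot> (t 0 * p) + (- inverse q) \<cdot> ((t 0 * t 0) * p)"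
    by (simp add: alg_simps)
  also have "\<dots> = (- inverse q) \<cdot> p + (1 + - inverse q * (q - inverse q)) \<cdot> (t 0 * p)"
    unfolding quad by (simp add: alg_simps)
  also have "\<dots> = (- inverse q) \<cdot> ((1 + (- inverse q) \<cdot> t 0) * p)"
    unfolding c by (simp add: alg_simps)
  finally show ?case by (simp add: absorbs_left_def)
next
  case (Suc n)
  let ?k = "- inverse q" and ?y = "coset_sum_left q t"
  have quad: "t (Suc n) * t (Suc n) = 1 + (q - inverse q) \<cdot> t (Suc n)"
    and braid: "t n * t (Suc n) * t n = t (Suc n) * t n * t (Suc n)"
    using Suc.prems unfolding hecke_generators_def by simp_all
  have far: "t i * t (Suc n) = t (Suc n) * t i" if "i < n" for i
    using hecke_generators_far[OF Suc.prems(2), of i "Suc n"] that by simp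
  have abs: "t i * p = ?k \<cdot> p" if "i < Suc n" for i
    using Suc.prems that unfolding absorbs_left_def by blast
  have lower: "t i * (?y (Suc (Suc n)) * p) = ?k \<cdot> (?y (Suc (Suc n)) * p)" if "i \<le> n" for i
  proof -
    have "absorbs_left q (t ` {..<n}) (t (Suc n) * p)"
      unfolding absorbs_left_def
    proof clarify
      fix i assume "i < n"
      then have "t i * (t (Suc n) * p) = t (Suc n) * (t i * p)"
        using far[of i] by (simp only: mult.assoc[symmetric])
      then show "t i * (t (Suc n) * p) = ?k \<cdot> (t (Suc n) * p)"
        using abs[of i] \<open>i < n\<close> by simp
    qed
    from Suc.IH[OF Suc.prems(1) hecke_generators_mono[OF Suc.prems(2)] this] that
    have "t i * (?y (Suc n) * (t (Suc n) * p)) = ?k \<cdot> (?y (Suc n) * (t (Suc n) * p))"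
      unfolding absorbs_left_def by blast
    then show ?thesis
      unfolding coset_sum_left.simps(2)[of _ _ "Suc n"] using abs[of i] that
      by (simp add: alg_simps del: coset_sum_left.simps)
  qed
  have top: "t (Suc n) * (?y (Suc (Suc n)) * p) = ?k \<cdot> (?y (Suc (Suc n)) * p)"
  proof -
    have com: "?y n * t (Suc n) = t (Suc n) * ?y n"
      by (rule coset_sum_left_commute, rule far)
    have "t (Suc n) * ?y n * t n * t (Suc n) * p = ?y n * (t (Suc n) * t n * t (Suc n)) * p"
      using com by (simp add: mult.assoc[symmetric])
    also have "\<dots> = ?y n * t n * t (Suc n) * (t n * p)"
      unfolding braid[symmetric] by (simp only: mult.assoc)
    also have "\<dots> = ?k \<cdot> (?y n * t n * t (Suc n) * p)"
      using abs[of n] by (simp add: alg_simps)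
    finally have 1: "t (Suc n) * ?y n * t n * t (Suc n) * p = ?k \<cdot> (?y n * t n * t (Suc n) * p)" .
    define z where "z = ?y n * (t n * (t (Suc n) * p))"
    have z2: "t (Suc n) * (?y n * (t n * (t (Suc n) * p))) = ?k \<cdot> z"
      using 1 by (simp_all add: z_def mult.assoc)
    have qq: "1 + - inverse q * (q - inverse q) = - inverse q * - inverse q"
      using \<open>q \<noteq> 0\<close> by (simp add: algebra_simps)
    have "t (Suc n) * (?y (Suc (Suc n)) * p)
       = t (Suc n) * p + ?k \<cdot> ((t (Suc n) * t (Suc n)) * p) + ?k \<cdot> (?k \<cdot> (?k \<cdot> z))"
      by (simp add: alg_simps z2)
    also have "\<dots> = ?k \<cdot> p + (1 + - inverse q * (q - inverse q)) \<cdot> (t (Suc n) * p) + ?k \<cdot> (?k \<cdot> (?k \<cdot> z))"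
      unfolding quad by (simp add: alg_simps)
    also have "\<dots> = ?k \<cdot> (?y (Suc (Suc n)) * p)"
      unfolding qq by (simp add: alg_simps z_def)
    finally show ?thesis .
  qed
  show ?case unfolding absorbs_left_def
    using lower top by (auto simp add: le_Suc_eq simp del: coset_sum_left.simps)
qed

text \<open>
  On an absorbing element each coset representative, with its weight, acts by a power of \<open>q^(-2)\<close>, and the powers
  add up to a \<open>q\<close>-integer.
\<close>
lemma coset_sum_absorbed:
  assumes "q_numbers_nonzero q" "absorbs_left q (t ` {..<n}) p"
  shows "(q ^ n) \<cdot> (coset_sum q t n * p) = (qnum q (Suc n)) \<cdot> p"
  using assms(2)
proof (induction n)
  case 0
  then show ?case using assms(1) by (simp add: alg_simps qnum_def q_numbers_nonzero_def)
next
  case (Suc n)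
  have q: "q \<noteq> 0" "q - inverse q \<noteq> 0" using assms(1) by (simp_all add: q_numbers_nonzero_def)
  have abs: "t n * p = (- inverse q) \<cdot> p"
    using Suc.prems unfolding absorbs_left_def by blast
  have "absorbs_left q (t ` {..<n}) p"
    using Suc.prems unfolding absorbs_left_def by auto
  note IH = Suc.IH[OF this]
  have "(q ^ Suc n) \<cdot> (coset_sum q t (Suc n) * p)
      = (q ^ Suc n) \<cdot> p + (- inverse q) \<cdot> (q \<cdot> (t n * ((q ^ n) \<cdot> (coset_sum q t n * p))))"
    by (simp add: alg_simps)
  also have "\<dots> = (q ^ Suc n + - inverse q * (q * (qnum q (Suc n) * (- inverse q)))) \<cdot> p"
    unfolding IH by (simp add: alg_simps abs)
  also have "q ^ Suc n + - inverse q * (q * (qnum q (Suc n) * (- inverse q))) = qnum q (Suc (Suc n))"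
    unfolding qnum_Suc[OF q, of "Suc n"] using q by simp
  finally show ?case .
qed

lemma coset_sum_left_absorbed:
  assumes "q_numbers_nonzero q" "absorbs q (t ` {..<n}) p"
  shows "(q ^ n) \<cdot> (p * coset_sum_left q t n) = (qnum q (Suc n)) \<cdot> p"
  using assms(2)
proof (induction n)
  case 0
  then show ?case using assms(1) by (simp add: alg_simps qnum_def q_numbers_nonzero_def)
next
  case (Suc n)
  have q: "q \<noteq> 0" "q - inverse q \<noteq> 0" using assms(1) by (simp_all add: q_numbers_nonzero_def)
  have abs: "p * t n = (- inverse q) \<cdot> p"
    using Suc.prems unfolding absorbs_def by blast
  have "absorbs q (t ` {..<n}) p"
    using Suc.prems unfolding absorbs_def by auto
  note IH = Suc.IH[OF this]
  have "(q ^ Suc n) \<cdot> (p * coset_sum_left q t (Suc n))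
      = (q ^ Suc n) \<cdot> p + (- inverse q) \<cdot> (q \<cdot> (((q ^ n) \<cdot> (p * coset_sum_left q t n)) * t n))"
    by (simp add: alg_simps)
  also have "\<dots> = (q ^ Suc n + - inverse q * (q * (qnum q (Suc n) * (- inverse q)))) \<cdot> p"
    unfolding IH by (simp add: alg_simps abs)
  also have "q ^ Suc n + - inverse q * (q * (qnum q (Suc n) * (- inverse q))) = qnum q (Suc (Suc n))"
    unfolding qnum_Suc[OF q, of "Suc n"] using q by simp
  finally show ?case .
qed

definition skew_step :: "'k \<Rightarrow> nat \<Rightarrow> 'b \<Rightarrow> 'b \<Rightarrow> 'b" where
  "skew_step q n g p = (1 / qnum q (n + 2)) \<cdot>
     (p * ((q ^ (n + 1)) \<cdot> 1 - (qnum q (n + 1)) \<cdot> g) * p)"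

text \<open>
  Up to a scalar, one step of the recursion for the skew-symmetrizers is \<open>p y p\<close> with \<open>y\<close> the coset
  sum, and the right factor \<open>p\<close> is already absorbed by \<open>p y\<close>. So the step equals \<open>p y\<close>, and by the
  mirrored argument \<open>y' p\<close>; the first form shows absorption on the right, the second on the left.
\<close>
lemma antisymmetrizer_skew_step:
  assumes gen: "q_numbers_nonzero q" and t: "hecke_generators q (Suc n) t"
    and p: "antisymmetrizer q (t ` {..<n}) p"
  shows "antisymmetrizer q (t ` {..n}) (skew_step q n (t n) p)"
proof -
  let ?p = "skew_step q n (t n) p"
  let ?y = "coset_sum q t (Suc n)" and ?y' = "coset_sum_left q t (Suc n)"
  have q: "q \<noteq> 0" "q - inverse q \<noteq> 0" using gen by (simp_all add: q_numbers_nonzero_def)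
  have nz: "qnum q (n + 2) \<noteq> 0" using gen by (simp add: q_numbers_nonzero_def)
  have pr: "absorbs q (t ` {..<n}) p" and pl: "absorbs_left q (t ` {..<n}) p"
    and fixr: "\<And>x. absorbs q (t ` {..<n}) x \<Longrightarrow> x * p = x"
    and fixl: "\<And>x. absorbs_left q (t ` {..<n}) x \<Longrightarrow> p * x = x"
    using p unfolding antisymmetrizer_def by blast+
  have qn: "- inverse q * q ^ Suc n = - (q ^ n)" using q by simp
  have "(q ^ Suc n) \<cdot> (?y * p) = (q ^ Suc n) \<cdot> p + (- inverse q * q ^ Suc n) \<cdot> (t n * coset_sum q t n * p)"
    by (simp add: alg_simps)
  also have "\<dots> = (q ^ Suc n) \<cdot> p - t n * ((q ^ n) \<cdot> (coset_sum q t n * p))"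
    unfolding qn by (simp add: alg_simps)
  also have "\<dots> = ((q ^ (n + 1)) \<cdot> 1 - (qnum q (n + 1)) \<cdot> t n) * p"
    unfolding coset_sum_absorbed[OF gen pl] by (simp add: alg_simps)
  finally have step: "(q ^ Suc n) \<cdot> (?y * p) = ((q ^ (n + 1)) \<cdot> 1 - (qnum q (n + 1)) \<cdot> t n) * p" .
  have "(q ^ Suc n) \<cdot> (p * ?y') = (q ^ Suc n) \<cdot> p + (- inverse q * q ^ Suc n) \<cdot> (p * coset_sum_left q t n * t n)"
    by (simp add: alg_simps)
  also have "\<dots> = (q ^ Suc n) \<cdot> p - (q ^ n) \<cdot> (p * coset_sum_left q t n) * t n"
    unfolding qn by (simp add: alg_simps)
  also have "\<dots> = p * ((q ^ (n + 1)) \<cdot> 1 - (qnum q (n + 1)) \<cdot> t n)"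
    unfolding coset_sum_left_absorbed[OF gen pr]
    by (simp add: alg_simps)
  finally have step': "(q ^ Suc n) \<cdot> (p * ?y') = p * ((q ^ (n + 1)) \<cdot> 1 - (qnum q (n + 1)) \<cdot> t n)" .
  have ar: "absorbs q (t ` {..n}) (p * ?y)"
    by (rule absorbs_coset_sum[OF q(1) t pr])
  then have f: "p * ?y * p = p * ?y"
    by (intro fixr) (auto simp: absorbs_def)
  have "?p = (1 / qnum q (n + 2)) \<cdot> (p * (q ^ Suc n \<cdot> (?y * p)))"
    unfolding step skew_step_def mult.assoc ..
  then have p1: "?p = (1 / qnum q (n + 2) * q ^ Suc n) \<cdot> (p * ?y)"
    unfolding scale_mult_right scale_scale using f by (simp only: mult.assoc)
  have al: "absorbs_left q (t ` {..n}) (?y' * p)"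
    by (rule absorbs_left_coset_sum_left[OF q(1) t pl])
  then have f': "p * (?y' * p) = ?y' * p"
    by (intro fixl) (auto simp: absorbs_left_def)
  have "?p = (1 / qnum q (n + 2)) \<cdot> ((q ^ Suc n \<cdot> (p * ?y')) * p)"
    unfolding step' skew_step_def mult.assoc ..
  then have p2: "?p = (1 / qnum q (n + 2) * q ^ Suc n) \<cdot> (?y' * p)"
    unfolding scale_mult_left scale_scale using f' by (simp only: mult.assoc)
  have "absorbs q (t ` {..n}) ?p"
    unfolding p1 using ar unfolding absorbs_def
    by (simp add: alg_simps del: coset_sum.simps)
  moreover have "absorbs_left q (t ` {..n}) ?p"
    unfolding p2 using al unfolding absorbs_left_def
    by (simp add: alg_simps del: coset_sum_left.simps)
  moreover have "x * ?p = x" if x: "absorbs q (t ` {..n}) x" for x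
  proof -
    have xp: "x * p = x" using x by (intro fixr) (auto simp: absorbs_def)
    have xt: "x * t n = (- inverse q) \<cdot> x" using x by (auto simp: absorbs_def)
    have "x * ?p = (1 / qnum q (n + 2)) \<cdot> ((x * p) * ((q ^ (n + 1)) \<cdot> 1 - (qnum q (n + 1)) \<cdot> t n) * p)"
      unfolding skew_step_def by (simp add: alg_simps)
    also have "\<dots> = (1 / qnum q (n + 2)) \<cdot> (((q ^ (n + 1)) \<cdot> x - (qnum q (n + 1)) \<cdot> (x * t n)) * p)"
      unfolding xp by (simp add: alg_simps)
    also have "\<dots> = (1 / qnum q (n + 2) * (q ^ (n + 1) - qnum q (n + 1) * - inverse q)) \<cdot> x"
      unfolding xt by (simp add: alg_simps xp)
    also have "q ^ (n + 1) - qnum q (n + 1) * - inverse q = qnum q (n + 2)"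
      using qnum_Suc[OF q, of "n + 1"] by (simp add: mult.commute)
    finally show ?thesis using nz by (simp add: alg_simps)
  qed
  moreover have "?p * x = x" if x: "absorbs_left q (t ` {..n}) x" for x
  proof -
    have px: "p * x = x" using x by (intro fixl) (auto simp: absorbs_left_def)
    have tx: "t n * x = (- inverse q) \<cdot> x" using x by (auto simp: absorbs_left_def)
    have "?p * x = (1 / qnum q (n + 2)) \<cdot> (p * (((q ^ (n + 1)) \<cdot> 1 - (qnum q (n + 1)) \<cdot> t n) * x))"
      unfolding skew_step_def by (simp add: alg_simps px)
    also have "\<dots> = (1 / qnum q (n + 2) * (q ^ (n + 1) - qnum q (n + 1) * - inverse q)) \<cdot> x"
      by (simp add: alg_simps tx px)
    also have "q ^ (n + 1) - qnum q (n + 1) * - inverse q = qnum q (n + 2)"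
      using qnum_Suc[OF q, of "n + 1"] by (simp add: mult.commute)
    finally show ?thesis using nz by (simp add: alg_simps)
  qed
  ultimately show ?thesis unfolding antisymmetrizer_def by blast
qed

primrec skew :: "'k \<Rightarrow> (nat \<Rightarrow> 'b) \<Rightarrow> nat \<Rightarrow> 'b" where
  "skew q t 0 = 1"
| "skew q t (Suc n) = skew_step q n (t n) (skew q t n)"

lemma antisymmetrizer_skew:
  assumes "q_numbers_nonzero q" "hecke_generators q n t"
  shows "antisymmetrizer q (t ` {..<n}) (skew q t n)"
  using assms(2)
proof (induction n)
  case 0
  then show ?case by (simp add: antisymmetrizer_def absorbs_def absorbs_left_def)
next
  case (Suc n)
  then show ?case
    using antisymmetrizer_skew_step[OF assms(1) Suc.prems] hecke_generators_mono[of q n t]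
    by (simp add: lessThan_Suc_atMost)
qed

text \<open>
  The skew-symmetrizer can also be grown at the lower end of the chain of generators. The right-hand
  side is a step of the recursion for the generators in reversed order, hence an antisymmetrizer for
  the same set of generators, and antisymmetrizers are unique.
\<close>
lemma skew_Suc_low:
  assumes gen: "q_numbers_nonzero q" and t: "hecke_generators q (Suc n) t"
  shows "skew q t (Suc n) = skew_step q n (t 0) (skew q (\<lambda>i. t (Suc i)) n)"
proof (rule antisymmetrizer_unique)
  show "antisymmetrizer q (t ` {..n}) (skew q t (Suc n))"
    using antisymmetrizer_skew[OF gen t] by (simp add: lessThan_Suc_atMost)
  \<comment> \<open>in the reversed chain the generator that is added last is \<open>t 0\<close>\<close>
  let ?r = "\<lambda>i. t (n - i)"
  have r: "hecke_generators q (Suc n) ?r"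
    unfolding hecke_generators_def
  proof (intro conjI allI impI)
    fix i assume "i < Suc n"
    show "t (n - i) * t (n - i) = 1 + (q - inverse q) \<cdot> t (n - i)"
      using t unfolding hecke_generators_def by simp
  next
    fix i assume "Suc i < Suc n"
    then have "Suc (n - Suc i) < Suc n" "Suc (n - Suc i) = n - i" by auto
    with t show "t (n - i) * t (n - Suc i) * t (n - i) = t (n - Suc i) * t (n - i) * t (n - Suc i)"
      unfolding hecke_generators_def by metis
  next
    fix i j assume "i + 2 \<le> j" "j < Suc n"
    then have "n - j + 2 \<le> n - i" "n - i < Suc n" by auto
    with t show "t (n - i) * t (n - j) = t (n - j) * t (n - i)"
      unfolding hecke_generators_def by metis
  qed
  have "hecke_generators q n (\<lambda>i. t (Suc i))"
    unfolding hecke_generators_def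
    using t hecke_generators_far[OF t, of "Suc i" "Suc j" for i j] by (auto simp: hecke_generators_def)
  then have "antisymmetrizer q ((\<lambda>i. t (Suc i)) ` {..<n}) (skew q (\<lambda>i. t (Suc i)) n)"
    by (rule antisymmetrizer_skew[OF gen])
  also have "(\<lambda>i. t (Suc i)) ` {..<n} = ?r ` {..<n}"
  proof -
    have "Suc ` {..<n} = (\<lambda>i. n - i) ` {..<n}"
    proof safe
      fix i assume "i < n"
      then show "Suc i \<in> (\<lambda>i. n - i) ` {..<n}"
        by (intro image_eqI[of _ _ "n - Suc i"]) auto
      show "n - i \<in> Suc ` {..<n}" using \<open>i < n\<close>
        by (intro image_eqI[of _ _ "n - Suc i"]) auto
    qed
    then show ?thesis by (metis image_image)
  qed
  finally have "antisymmetrizer q (?r ` {..n}) (skew_step q n (?r n) (skew q (\<lambda>i. t (Suc i)) n))"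
    by (rule antisymmetrizer_skew_step[OF gen r])
  moreover have "?r ` {..n} = t ` {..n}"
  proof -
    have "(\<lambda>i. n - i) ` {..n} = {..n}"
    proof safe
      fix i assume "i \<le> n"
      then show "i \<in> (\<lambda>i. n - i) ` {..n}"
        by (intro image_eqI[of _ _ "n - i"]) auto
    qed simp
    then show ?thesis by (metis image_image)
  qed
  ultimately show "antisymmetrizer q (t ` {..n}) (skew_step q n (t 0) (skew q (\<lambda>i. t (Suc i)) n))"
    by simp
qed

end

section \<open>Reversal of spectral parameters under the antisymmetrizer\<close>

text \<open>
  Commutation (\<open>x = y\<close>) and conjugation (\<open>g\<close> invertible) in a form that is closed under products and
  avoids inverses.
\<close>
definition intertwines :: "'b::semigroup_mult \<Rightarrow> 'b \<Rightarrow> 'b \<Rightarrow> bool" where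
  "intertwines g x y \<longleftrightarrow> g * x = y * g"

lemma intertwines_mult:
  "intertwines g x y \<Longrightarrow> intertwines g x' y' \<Longrightarrow> intertwines g (x * x') (y * y')"
  unfolding intertwines_def by (metis mult.assoc)

lemma intertwines_comp:
  "intertwines g x y \<Longrightarrow> intertwines h y z \<Longrightarrow> intertwines (h * g) x z"
  unfolding intertwines_def by (metis mult.assoc)

lemma intertwines_sym: "intertwines x y y \<Longrightarrow> intertwines y x x"
  unfolding intertwines_def by simp

lemma intertwines_one: "intertwines (g::'b::monoid_mult) 1 1"
  unfolding intertwines_def by simp

lemma intertwines_diff:
  fixes g :: "'b::ring"
  shows "intertwines g x y \<Longrightarrow> intertwines g x' y' \<Longrightarrow> intertwines g (x - x') (y - y')"
  unfolding intertwines_def by (simp add: left_diff_distrib right_diff_distrib)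

context algebra_over_field
begin

lemma intertwines_scale: "intertwines g x y \<Longrightarrow> intertwines g (a \<cdot> x) (a \<cdot> y)"
  unfolding intertwines_def by simp

lemma skew_closed:
  assumes "Pr 1" "\<And>x y. Pr x \<Longrightarrow> Pr y \<Longrightarrow> Pr (x * y)" "\<And>x y. Pr x \<Longrightarrow> Pr y \<Longrightarrow> Pr (x - y)"
    "\<And>a x. Pr x \<Longrightarrow> Pr (a \<cdot> x)" "\<And>i. i < n \<Longrightarrow> Pr (t i)"
  shows "Pr (skew q t n)"
  using assms(5) by (induction n) (simp_all add: skew_step_def assms(1-4))

lemma intertwines_skew:
  assumes "\<And>i. i < n \<Longrightarrow> intertwines g (t i) (t' i)"
  shows "intertwines g (skew q t n) (skew q t' n)"
  using assms
  by (induction n) (simp_all add: skew_step_def intertwines_scale intertwines_mult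
        intertwines_diff intertwines_one)

end

text \<open>
  Products \<open>m 0 j * m 1 (j + 1) * \<cdots>\<close> and \<open>m 0 (j + n) * \<cdots> * m n j\<close> over the positions \<open>0, \<dots>, n\<close>. The second
  argument of \<open>m\<close> stands for the exponent \<open>j\<close> in the spectral parameter \<open>q^(-2j)u\<close>.
\<close>
primrec ascending :: "(nat \<Rightarrow> nat \<Rightarrow> 'b::times) \<Rightarrow> nat \<Rightarrow> nat \<Rightarrow> 'b" where
  "ascending m 0 j = m 0 j"
| "ascending m (Suc n) j = ascending m n j * m (Suc n) (j + Suc n)"

primrec descending :: "(nat \<Rightarrow> nat \<Rightarrow> 'b::times) \<Rightarrow> nat \<Rightarrow> nat \<Rightarrow> 'b" where
  "descending m 0 j = m 0 j"
| "descending m (Suc n) j = descending m n (Suc j) * m (Suc n) j"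

lemma descending_Suc_left:
  fixes m :: "nat \<Rightarrow> nat \<Rightarrow> 'b::semigroup_mult"
  shows "descending m (Suc n) j = m 0 (j + Suc n) * descending (\<lambda>s. m (Suc s)) n j"
  by (induction n arbitrary: j) (simp_all add: mult.assoc)

lemma intertwines_ascending:
  "(\<And>i j. i \<le> n \<Longrightarrow> intertwines g (m i j) (m' i j)) \<Longrightarrow> intertwines g (ascending m n j) (ascending m' n j)"
  by (induction n) (simp_all add: intertwines_mult)

lemma intertwines_descending:
  "(\<And>i j. i \<le> n \<Longrightarrow> intertwines g (m i j) (m' i j)) \<Longrightarrow> intertwines g (descending m n j) (descending m' n j)"
  by (induction n arbitrary: j) (simp_all add: intertwines_mult)

lemma ascending_closed:
  assumes "\<And>x y. Pr x \<Longrightarrow> Pr y \<Longrightarrow> Pr (x * y)" "\<And>i j. i \<le> n \<Longrightarrow> Pr (m i j)"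
  shows "Pr (ascending m n j)"
  using assms(2) by (induction n) (simp_all add: assms(1))

text \<open>
  \<open>T s\<close> is \<open>R\<close> acting in positions \<open>s\<close> and \<open>s + 1\<close>, and \<open>L j\<close> is \<open>L(q^(-2j)u)\<close> in position 0. For \<open>v = q^(-2d)u\<close> the
  coefficient \<open>(q - q^(-1))u / (u - v)\<close> of the defining relation becomes \<open>q^d / d_q\<close>. The relation is required
  modulo the ideal \<open>J\<close> only.
\<close>
locale baxterized_matrix = algebra_over_field scale
  for scale :: "'k::field \<Rightarrow> 'b::ring_1 \<Rightarrow> 'b" (infixr "\<cdot>" 75) +
  fixes q :: 'k and T :: "nat \<Rightarrow> 'b" and L :: "nat \<Rightarrow> 'b" and J :: "'b set"
  assumes gen: "q_numbers_nonzero q"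
    and quadratic: "T s * T s = 1 + (q - inverse q) \<cdot> T s"
    and braid: "T s * T (Suc s) * T s = T (Suc s) * T s * T (Suc s)"
    and far: "s + 2 \<le> t \<Longrightarrow> T s * T t = T t * T s"
    and T_L: "T (Suc s) * L j = L j * T (Suc s)"
    and J_zero: "0 \<in> J" and J_add: "x \<in> J \<Longrightarrow> y \<in> J \<Longrightarrow> x + y \<in> J"
    and J_left: "x \<in> J \<Longrightarrow> z * x \<in> J" and J_right: "x \<in> J \<Longrightarrow> x * z \<in> J"
    and reflection: "d \<ge> 1 \<Longrightarrow>
      (T 0 - (q ^ d / qnum q d) \<cdot> 1) * L i * T 0 * L (i + d)
      - L (i + d) * T 0 * L i * (T 0 - (q ^ d / qnum q d) \<cdot> 1) \<in> J"
begin

definition cong :: "'b \<Rightarrow> 'b \<Rightarrow> bool" (infix "\<approx>" 50) where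
  "x \<approx> y \<longleftrightarrow> x - y \<in> J"

lemma cong_refl: "x \<approx> x"
  by (simp add: cong_def J_zero)

lemma cong_sym: "x \<approx> y \<Longrightarrow> y \<approx> x"
  using J_left[of "x - y" "- 1"] by (simp add: cong_def)

lemma cong_trans [trans]: "x \<approx> y \<Longrightarrow> y \<approx> z \<Longrightarrow> x \<approx> z"
  using J_add[of "x - y" "y - z"] by (simp add: cong_def)

lemma cong_eq_trans [trans]: "x \<approx> y \<Longrightarrow> y = z \<Longrightarrow> x \<approx> z"
  and eq_cong_trans [trans]: "x = y \<Longrightarrow> y \<approx> z \<Longrightarrow> x \<approx> z"
  by simp_all

lemma cong_mult: "x \<approx> y \<Longrightarrow> a * x * b \<approx> a * y * b"
  using J_right[OF J_left, of "x - y" a b] by (simp add: cong_def left_diff_distrib right_diff_distrib)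

lemma cong_mult_left: "x \<approx> y \<Longrightarrow> a * x \<approx> a * y"
  using cong_mult[of x y a 1] by simp

lemma cong_mult_right: "x \<approx> y \<Longrightarrow> x * b \<approx> y * b"
  using cong_mult[of x y 1 b] by simp

lemma cong_scale: "x \<approx> y \<Longrightarrow> a \<cdot> x \<approx> a \<cdot> y"
  using cong_mult_left[of x y "a \<cdot> 1"] by simp

lemma cong_add: "x \<approx> y \<Longrightarrow> x' \<approx> y' \<Longrightarrow> x + x' \<approx> y + y'"
  using J_add[of "x - y" "x' - y'"] by (simp add: cong_def algebra_simps)

definition T_inv :: "nat \<Rightarrow> 'b" where
  "T_inv s = T s - (q - inverse q) \<cdot> 1"

lemma T_T_inv: "T s * T_inv s = 1" and T_inv_T: "T_inv s * T s = 1"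
  by (simp_all add: T_inv_def right_diff_distrib left_diff_distrib quadratic)

lemma T_T_inv_left: "T s * (T_inv s * x) = x" and T_inv_T_left: "T_inv s * (T s * x) = x"
  by (simp_all add: T_T_inv T_inv_T flip: mult.assoc)

lemmas cancel = T_T_inv T_inv_T T_T_inv_left T_inv_T_left

lemma intertwines_T_inv: "intertwines g (T s) (T t) \<Longrightarrow> intertwines g (T_inv s) (T_inv t)"
  unfolding T_inv_def by (intro intertwines_diff intertwines_scale intertwines_one)

lemma intertwines_far: "s + 2 \<le> t \<or> t + 2 \<le> s \<Longrightarrow> intertwines (T s) (T t) (T t)"
  unfolding intertwines_def using far by metis

lemma intertwines_braid: "intertwines (T s * T (Suc s)) (T s) (T (Suc s))"
  unfolding intertwines_def using braid by (simp add: mult.assoc)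

primrec Lbar :: "nat \<Rightarrow> nat \<Rightarrow> 'b" where
  "Lbar 0 j = L j"
| "Lbar (Suc s) j = T s * Lbar s j * T_inv s"

lemma intertwines_T_Lbar_Suc: "intertwines (T s) (Lbar s j) (Lbar (Suc s) j)"
  by (simp add: intertwines_def mult.assoc T_inv_T)

text \<open>
  The matrix \<open>Lbar s j\<close> is built from operators in the positions \<open>0, \<dots>, s\<close>.
\<close>
lemma intertwines_T_Lbar_high: "s < i \<Longrightarrow> intertwines (T i) (Lbar s j) (Lbar s j)"
proof (induction s arbitrary: i)
  case 0
  then show ?case using T_L by (cases i) (auto simp: intertwines_def)
next
  case (Suc s)
  have "intertwines (T i) (T s) (T s)" using Suc.prems by (intro intertwines_far) simp
  moreover have "intertwines (T i) (Lbar s j) (Lbar s j)" using Suc by simp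
  ultimately show ?case by (simp add: intertwines_mult intertwines_T_inv)
qed

text \<open>
  Although \<open>Lbar s j\<close> acts nontrivially in all positions up to \<open>s\<close>, conjugation by the
  braiding makes it commute with the generators below. The essential case is \<open>s = i + 2\<close>, where
  \<open>T i\<close> passes \<open>T (i + 1) T i\<close> as \<open>T (i + 1)\<close>.
\<close>
lemma intertwines_T_Lbar_low: "Suc i < s \<Longrightarrow> intertwines (T i) (Lbar s j) (Lbar s j)"
proof (induction s)
  case (Suc s)
  show ?case
  proof (cases "Suc i < s")
    case True
    have "intertwines (T i) (T s) (T s)" using True by (intro intertwines_far) simp
    with Suc.IH[OF True] show ?thesis by (simp add: intertwines_mult intertwines_T_inv)
  next
    case False
    then have s: "s = Suc i" using Suc.prems by simp
    have up: "T i * (T s * (T i * x)) = T s * (T i * (T s * x))" for x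
      using braid[of i] unfolding s by (metis mult.assoc)
    have "T s * T_inv i * T_inv s = T_inv i * T_inv s * (T s * T i * T s) * T_inv i * T_inv s"
      by (simp add: mult.assoc cancel)
    also have "\<dots> = T_inv i * T_inv s * T i"
      unfolding s braid[symmetric] by (simp add: mult.assoc cancel)
    finally have down: "T s * (T_inv i * T_inv s) = T_inv i * (T_inv s * T i)" by (simp only: mult.assoc)
    have "T s * (Lbar i j * x) = Lbar i j * (T s * x)" for x
      using intertwines_T_Lbar_high[of i s j] s unfolding intertwines_def by (metis lessI mult.assoc)
    with up down show ?thesis
      unfolding intertwines_def by (simp add: s mult.assoc)
  qed
qed simp

definition baxterized :: "nat \<Rightarrow> nat \<Rightarrow> 'b" where
  "baxterized d s = T s - (q ^ d / qnum q d) \<cdot> 1"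

text \<open>
  In positions 0 and 1 this is the defining relation multiplied by the inverse of \<open>T 0\<close>. Conjugation by
  \<open>T s T (s + 1)\<close> moves it up by one position.
\<close>
lemma Lbar_exchange:
  assumes "d \<ge> 1"
  shows "baxterized d s * (Lbar s i * Lbar (Suc s) (i + d)) \<approx> Lbar s (i + d) * Lbar (Suc s) i * baxterized d s"
proof (induction s)
  case 0
  let ?R = "baxterized d 0"
  have com: "T_inv 0 * ?R = ?R * T_inv 0"
    unfolding baxterized_def by (simp add: left_diff_distrib right_diff_distrib cancel)
  have "?R * L i * T 0 * L (i + d) \<approx> L (i + d) * T 0 * L i * ?R"
    using reflection[OF assms] unfolding cong_def baxterized_def .
  from cong_mult_right[OF this, of "T_inv 0"] show ?case
    using com by (simp add: mult.assoc)
next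
  case (Suc s)
  let ?g = "T s * T (Suc s)" and ?gi = "T_inv (Suc s) * T_inv s"
  have g: "?g * ?gi = 1" by (simp add: mult.assoc cancel)
  have 0: "intertwines ?g (Lbar s j) (Lbar (Suc s) j)" for j
    by (rule intertwines_comp[OF intertwines_T_Lbar_high intertwines_T_Lbar_Suc]) simp
  have 1: "intertwines ?g (Lbar (Suc s) j) (Lbar (Suc (Suc s)) j)" for j
    by (rule intertwines_comp[OF intertwines_T_Lbar_Suc intertwines_T_Lbar_low]) simp
  have 2: "intertwines ?g (baxterized d s) (baxterized d (Suc s))"
    unfolding baxterized_def
    by (intro intertwines_diff intertwines_scale intertwines_one intertwines_braid)
  have conj: "?g * x * ?gi = y" if "intertwines ?g x y" for x y
    using that g unfolding intertwines_def by (metis mult.assoc mult.right_neutral)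
  have "?g * (baxterized d s * (Lbar s i * Lbar (Suc s) (i + d))) * ?gi
      = baxterized d (Suc s) * (Lbar (Suc s) i * Lbar (Suc (Suc s)) (i + d))"
    and "?g * (Lbar s (i + d) * Lbar (Suc s) i * baxterized d s) * ?gi
      = Lbar (Suc s) (i + d) * Lbar (Suc (Suc s)) i * baxterized d (Suc s)"
    by (intro conj intertwines_mult 0 1 2)+
  then show ?case using cong_mult[OF Suc.IH, of ?g ?gi] by (simp only:)
qed

abbreviation "projector n \<equiv> skew q T n"
abbreviation "projector_shift n \<equiv> skew q (\<lambda>i. T (Suc i)) n"

lemma hecke_generators_T: "hecke_generators q n T"
  unfolding hecke_generators_def using quadratic braid far by blast

lemma antisymmetrizer_projector: "antisymmetrizer q (T ` {..<n}) (projector n)"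
  by (rule antisymmetrizer_skew[OF gen hecke_generators_T])

lemma projector_mult_projector: "m \<le> n \<Longrightarrow> projector m * projector n = projector n"
  using antisymmetrizer_projector[of m] antisymmetrizer_projector[of n]
  unfolding antisymmetrizer_def absorbs_left_def by auto

lemma intertwines_projector:
  "(\<And>i. i < n \<Longrightarrow> intertwines (T i) x x) \<Longrightarrow> intertwines (projector n) x x"
  by (rule intertwines_sym, rule intertwines_skew, rule intertwines_sym) blast

text \<open>
  The exchange relation with \<open>d = n\<close> has the middle factor of \<open>projector n\<close> as its \<open>R\<close>-matrix, so it
  swaps the smallest and the largest parameter once they have become neighbours. This happens
  after the first \<open>n\<close> factors are reversed by induction. The parameters are then, for \<open>j = 0\<close>,
  \<open>n - 1, \<dots>, 1, n, 0\<close>. The projector of two orders less, which can be taken from the remaining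
  \<open>projector (n - 1)\<close>, turns the initial segment back into \<open>1, \<dots>, n - 1\<close>, and now \<open>1, \<dots>, n\<close> is reversed
  as a whole.
\<close>
lemma fusion: "projector n * ascending Lbar n j \<approx> descending Lbar n j * projector n"
proof (induction n arbitrary: j rule: less_induct)
  case (less n)
  show ?case
  proof (cases n)
    case 0
    then show ?thesis by (simp add: cong_refl)
  next
    case (Suc k)
    let ?p = "projector k" and ?U = "q ^ (k + 1) \<cdot> 1 - qnum q (k + 1) \<cdot> T k"
    have nz: "qnum q (k + 1) \<noteq> 0" using gen by (simp add: q_numbers_nonzero_def)
    have U: "?U = (- qnum q (k + 1)) \<cdot> baxterized (k + 1) k"
      unfolding baxterized_def using nz by (simp add: scale_right_diff_distrib)
    have Pn: "projector n = (1 / qnum q (k + 2)) \<cdot> (?p * ?U * ?p)"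
      unfolding Suc skew.simps skew_step_def ..
    have exch: "?U * (Lbar k j * Lbar (Suc k) (j + k + 1)) \<approx> Lbar k (j + k + 1) * Lbar (Suc k) j * ?U"
      unfolding U using cong_scale[OF Lbar_exchange[of "k + 1" k j], of "- qnum q (k + 1)"]
      by (simp add: add.assoc del: Lbar.simps)
    have pM: "intertwines ?p (Lbar (Suc k) i) (Lbar (Suc k) i)" for i
      by (intro intertwines_projector intertwines_T_Lbar_low) simp
    have IH: "?p * ascending Lbar k i \<approx> descending Lbar k i * ?p" for i
      using less.IH Suc by simp
    \<comment> \<open>the swap of the extreme parameters, followed by the return of the others to ascending order\<close>
    have main: "?p * (?U * (descending Lbar k j * Lbar (Suc k) (j + k + 1))) * ?p
                \<approx> ?p * ascending Lbar k (Suc j) * Lbar (Suc k) j * ?U * ?p"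
    proof (cases k)
      case 0
      with cong_mult[OF exch, of ?p ?p] show ?thesis by (simp add: mult.assoc)
    next
      case (Suc l)
      let ?p' = "projector l" and ?m = "Lbar (Suc k) j" and ?m' = "Lbar k (j + k + 1)"
      have UM: "intertwines ?U (descending Lbar l (Suc j)) (descending Lbar l (Suc j))"
      proof (rule intertwines_descending)
        fix s i assume "s \<le> l"
        then have "intertwines (T k) (Lbar s i) (Lbar s i)"
          using Suc by (intro intertwines_T_Lbar_high) simp
        then show "intertwines ?U (Lbar s i) (Lbar s i)"
          by (intro intertwines_sym[of "Lbar s i" ?U] intertwines_diff intertwines_scale
              intertwines_one intertwines_sym[of "T k" "Lbar s i"])
      qed
      have pm: "intertwines ?p' (?m' * ?m * ?U) (?m' * ?m * ?U)"
      proof (rule intertwines_projector)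
        fix i assume "i < l"
        then have *: "Suc i < k" "i + 2 \<le> k \<or> k + 2 \<le> i" using Suc by auto
        then show "intertwines (T i) (?m' * ?m * ?U) (?m' * ?m * ?U)"
          by (intro intertwines_mult intertwines_diff intertwines_scale intertwines_one
              intertwines_T_Lbar_low intertwines_far) auto
      qed
      have "?p * (?U * (descending Lbar k j * Lbar (Suc k) (j + k + 1))) * ?p
          = ?p * descending Lbar l (Suc j) * (?U * (Lbar k j * Lbar (Suc k) (j + k + 1))) * ?p"
      proof -
        have "?U * (descending Lbar k j * Lbar (Suc k) (j + k + 1))
            = ?U * descending Lbar l (Suc j) * (Lbar k j * Lbar (Suc k) (j + k + 1))"
          unfolding Suc descending.simps by (simp only: mult.assoc)
        also have "\<dots> = descending Lbar l (Suc j) * ?U * (Lbar k j * Lbar (Suc k) (j + k + 1))"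
          using UM unfolding intertwines_def by simp
        finally show ?thesis by (simp only: mult.assoc)
      qed
      also have "\<dots> \<approx> ?p * descending Lbar l (Suc j) * (?m' * ?m * ?U) * ?p"
        by (rule cong_mult[OF exch])
      also have "?p * descending Lbar l (Suc j) * (?m' * ?m * ?U) * ?p
          = ?p * descending Lbar l (Suc j) * (?m' * ?m * ?U) * (?p' * ?p)"
        by (subst projector_mult_projector) (simp_all add: Suc)
      also have "\<dots> = ?p * descending Lbar l (Suc j) * ((?m' * ?m * ?U) * ?p') * ?p"
        by (simp only: mult.assoc)
      also have "(?m' * ?m * ?U) * ?p' = ?p' * (?m' * ?m * ?U)"
        using pm unfolding intertwines_def by simp
      also have "?p * descending Lbar l (Suc j) * (?p' * (?m' * ?m * ?U)) * ?p
          = ?p * (descending Lbar l (Suc j) * ?p') * (?m' * ?m * ?U * ?p)"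
        by (simp only: mult.assoc)
      also have "\<dots> \<approx> ?p * (?p' * ascending Lbar l (Suc j)) * (?m' * ?m * ?U * ?p)"
        by (rule cong_mult[OF cong_sym[OF less.IH]]) (simp add: Suc \<open>n = Suc k\<close>)
      also have "?p * (?p' * ascending Lbar l (Suc j)) * (?m' * ?m * ?U * ?p)
          = ?p * ascending Lbar k (Suc j) * ?m * ?U * ?p"
      proof -
        have "?p * ?p' = ?p"
          using antisymmetrizer_projector[of l] antisymmetrizer_projector[of k]
          unfolding antisymmetrizer_def absorbs_def by (auto simp: Suc)
        then have "?p * (?p' * ascending Lbar l (Suc j)) = ?p * ascending Lbar l (Suc j)"
          by (simp flip: mult.assoc)
        moreover have "ascending Lbar k (Suc j) = ascending Lbar l (Suc j) * ?m'"
          by (simp add: Suc)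
        ultimately show ?thesis by (simp only: mult.assoc)
      qed
      finally show ?thesis .
    qed
    let ?c = "1 / qnum q (k + 2)"
    have "projector n * ascending Lbar n j = ?c \<cdot> (?p * ?U * (?p * ascending Lbar k j) * Lbar (Suc k) (j + k + 1))"
      unfolding Pn by (simp add: Suc mult.assoc del: Lbar.simps skew.simps)
    also have "\<dots> \<approx> ?c \<cdot> (?p * ?U * (descending Lbar k j * ?p) * Lbar (Suc k) (j + k + 1))"
      by (intro cong_scale cong_mult IH)
    also have "\<dots> = ?c \<cdot> (?p * (?U * (descending Lbar k j * Lbar (Suc k) (j + k + 1))) * ?p)"
      using pM unfolding intertwines_def by (simp only: mult.assoc)
    also have "\<dots> \<approx> ?c \<cdot> (?p * ascending Lbar k (Suc j) * (Lbar (Suc k) j * ?U * ?p))"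
      using cong_scale[OF main] by (simp add: mult.assoc)
    also have "\<dots> \<approx> ?c \<cdot> (descending Lbar k (Suc j) * ?p * (Lbar (Suc k) j * ?U * ?p))"
      by (intro cong_scale cong_mult_right IH)
    also have "\<dots> = ?c \<cdot> (descending Lbar k (Suc j) * (?p * Lbar (Suc k) j) * ?U * ?p)"
      by (simp only: mult.assoc)
    also have "\<dots> = descending Lbar n j * projector n"
      using pM[of j] unfolding intertwines_def Pn
      by (simp add: Suc mult.assoc del: Lbar.simps skew.simps)
    finally show ?thesis .
  qed
qed

text \<open>
  Conjugation by \<open>T 0 T 1 \<cdots>\<close> moves every operator built from the \<open>T i\<close> and the \<open>Lbar i j\<close> up by one position.
\<close>
primrec coxeter :: "nat \<Rightarrow> 'b" where
  "coxeter 0 = 1"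
| "coxeter (Suc n) = coxeter n * T n"

primrec coxeter_inv :: "nat \<Rightarrow> 'b" where
  "coxeter_inv 0 = 1"
| "coxeter_inv (Suc n) = T_inv n * coxeter_inv n"

lemma coxeter_coxeter_inv: "coxeter n * coxeter_inv n = 1"
proof (induction n)
  case (Suc n)
  have "coxeter n * T n * (T_inv n * coxeter_inv n) = coxeter n * coxeter_inv n" by (simp add: mult.assoc cancel)
  with Suc show ?case by simp
qed simp

lemma intertwines_coxeter: "(\<And>i. i < n \<Longrightarrow> intertwines (T i) x x) \<Longrightarrow> intertwines (coxeter n) x x"
proof (induction n)
  case (Suc n)
  then show ?case by (auto intro: intertwines_comp)
qed (simp add: intertwines_def)

lemma intertwines_coxeter_T: "Suc i < n \<Longrightarrow> intertwines (coxeter n) (T i) (T (Suc i))"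
proof (induction n)
  case (Suc n)
  show ?case
  proof (cases "Suc i < n")
    case True
    have "intertwines (T n) (T i) (T i)" using True by (intro intertwines_far) simp
    then show ?thesis using Suc.IH[OF True] by (simp add: intertwines_comp)
  next
    case False
    then have n: "n = Suc i" using Suc.prems by simp
    have "intertwines (coxeter i) (T (Suc i)) (T (Suc i))"
      by (intro intertwines_coxeter intertwines_far) simp
    from intertwines_comp[OF intertwines_braid this] show ?thesis
      by (simp add: n mult.assoc)
  qed
qed simp

lemma intertwines_coxeter_Lbar: "i < n \<Longrightarrow> intertwines (coxeter n) (Lbar i j) (Lbar (Suc i) j)"
proof (induction n)
  case (Suc n)
  show ?case
  proof (cases "i < n")
    case True
    then show ?thesis
      using intertwines_comp[OF intertwines_T_Lbar_high[OF True] Suc.IH[OF True]] by simp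
  next
    case False
    then have n: "n = i" using Suc.prems by simp
    have "intertwines (coxeter i) (Lbar (Suc i) j) (Lbar (Suc i) j)"
      by (intro intertwines_coxeter intertwines_T_Lbar_low) simp
    from intertwines_comp[OF intertwines_T_Lbar_Suc this] show ?thesis
      by (simp add: n)
  qed
qed simp

lemma coxeter_conj: "intertwines (coxeter n) x y \<Longrightarrow> y = coxeter n * x * coxeter_inv n"
  using coxeter_coxeter_inv[of n] unfolding intertwines_def by (metis mult.assoc mult.right_neutral)

lemma intertwines_coxeter_projector: "n < m \<Longrightarrow> intertwines (coxeter m) (projector n) (projector_shift n)"
  by (intro intertwines_skew intertwines_coxeter_T) simp

text \<open>
  Fusion moved up by one position, as it is needed for the factors behind the leftmost one.
\<close>
lemma fusion_shift:
  "projector_shift n * ascending (\<lambda>s. Lbar (Suc s)) n j \<approx> descending (\<lambda>s. Lbar (Suc s)) n j * projector_shift n"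
proof -
  have projector: "intertwines (coxeter (Suc n)) (projector n) (projector_shift n)" by (rule intertwines_coxeter_projector) simp
  have A: "intertwines (coxeter (Suc n)) (ascending Lbar n j) (ascending (\<lambda>s. Lbar (Suc s)) n j)"
    by (intro intertwines_ascending intertwines_coxeter_Lbar) simp
  have B: "intertwines (coxeter (Suc n)) (descending Lbar n j) (descending (\<lambda>s. Lbar (Suc s)) n j)"
    by (intro intertwines_descending intertwines_coxeter_Lbar) simp
  show ?thesis
    unfolding coxeter_conj[OF intertwines_mult[OF projector A]] coxeter_conj[OF intertwines_mult[OF B projector]]
    by (rule cong_mult[OF fusion])
qed

end

section \<open>The recursion for the skew powers\<close>

text \<open>
  \<open>tr s\<close> is the \<open>R\<close>-trace over position \<open>s\<close>, its value being regarded as an operator that acts as the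
  identity there, and \<open>Triv s\<close> is the set of operators acting as the identity in position \<open>s\<close>.
\<close>
locale braided_trace = baxterized_matrix scale q T L J
  for scale :: "'k::field \<Rightarrow> 'b::ring_1 \<Rightarrow> 'b" (infixr "\<cdot>" 75)
    and q :: 'k and T :: "nat \<Rightarrow> 'b" and L :: "nat \<Rightarrow> 'b" and J :: "'b set" +
  fixes tr :: "nat \<Rightarrow> 'b \<Rightarrow> 'b" and Triv :: "nat \<Rightarrow> 'b set"
  assumes trivial_one: "1 \<in> Triv s" and trivial_mult: "x \<in> Triv s \<Longrightarrow> y \<in> Triv s \<Longrightarrow> x * y \<in> Triv s"
    and trivial_diff: "x \<in> Triv s \<Longrightarrow> y \<in> Triv s \<Longrightarrow> x - y \<in> Triv s"
    and trivial_scale: "x \<in> Triv s \<Longrightarrow> a \<cdot> x \<in> Triv s"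
    and trivial_T: "s \<noteq> t \<Longrightarrow> s \<noteq> Suc t \<Longrightarrow> T t \<in> Triv s" and trivial_L: "s \<noteq> 0 \<Longrightarrow> L j \<in> Triv s"
    and trivial_trace_same: "tr s x \<in> Triv s" and trivial_trace: "x \<in> Triv s \<Longrightarrow> tr t x \<in> Triv s"
    and trace_diff: "tr s (x - y) = tr s x - tr s y" and trace_scale: "tr s (a \<cdot> x) = a \<cdot> tr s x"
    and trace_left: "x \<in> Triv s \<Longrightarrow> tr s (x * y) = x * tr s y"
    and trace_right: "x \<in> Triv s \<Longrightarrow> tr s (y * x) = tr s y * x"
    and trace_T: "tr (Suc s) (T s) = 1"
    and trace_conj: "x \<in> Triv (Suc s) \<Longrightarrow> tr (Suc s) (T s * x * (T s - (q - inverse q) \<cdot> 1)) = tr s x"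
    and trace_cyclic: "tr s (tr (Suc s) (T s * x)) = tr s (tr (Suc s) (x * T s))"
    and trace_J: "x \<in> J \<Longrightarrow> tr s x \<in> J"
begin

primrec traces :: "nat \<Rightarrow> nat \<Rightarrow> 'b \<Rightarrow> 'b" where
  "traces s 0 x = x"
| "traces s (Suc n) x = traces s n (tr (s + n) x)"

lemma traces_Suc_left: "traces s (Suc n) x = tr s (traces (Suc s) n x)"
  by (induction n arbitrary: x) simp_all

lemma traces_diff: "traces s n (x - y) = traces s n x - traces s n y"
  by (induction n arbitrary: x y) (simp_all add: trace_diff)

lemma traces_scale: "traces s n (a \<cdot> x) = a \<cdot> traces s n x"
  by (induction n arbitrary: x) (simp_all add: trace_scale)

lemma traces_cong: "x \<approx> y \<Longrightarrow> traces s n x \<approx> traces s n y"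
proof -
  have "z \<in> J \<Longrightarrow> traces s n z \<in> J" for z
    by (induction n arbitrary: z) (simp_all add: trace_J)
  then show "x \<approx> y \<Longrightarrow> traces s n x \<approx> traces s n y"
    unfolding cong_def traces_diff[symmetric] .
qed

lemma traces_left: "(\<And>t. s \<le> t \<Longrightarrow> t < s + n \<Longrightarrow> x \<in> Triv t) \<Longrightarrow> traces s n (x * y) = x * traces s n y"
  by (induction n arbitrary: y) (simp_all add: trace_left)

text \<open>
  Traces over the positions above \<open>i + 1\<close> do not see \<open>T i\<close>, so only those over \<open>i\<close> and \<open>i + 1\<close> matter.
\<close>
lemma traces_cyclic_T: "s \<le> i \<Longrightarrow> Suc i < s + n \<Longrightarrow> traces s n (T i * x) = traces s n (x * T i)"
proof (induction n arbitrary: x)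
  case (Suc n)
  show ?case
  proof (cases "Suc i < s + n")
    case True
    then have "T i \<in> Triv (s + n)" by (intro trivial_T) auto
    then show ?thesis using Suc.IH[OF Suc.prems(1) True] by (simp add: trace_left trace_right)
  next
    case False
    with Suc.prems have "n = Suc (i - s)" "i = s + (i - s)" by auto
    then obtain m where m: "n = Suc m" "i = s + m" by blast
    then show ?thesis using trace_cyclic[of "s + m" x] by simp
  qed
qed simp

lemma traces_cyclic_projector_shift: "traces 1 (Suc n) (projector_shift n * x) = traces 1 (Suc n) (x * projector_shift n)"
proof -
  have "\<forall>x. traces 1 (Suc n) (projector_shift n * x) = traces 1 (Suc n) (x * projector_shift n)"
  proof (rule skew_closed[where Pr = "\<lambda>z. \<forall>x. traces 1 (Suc n) (z * x) = traces 1 (Suc n) (x * z)"])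
    fix y z :: 'b
    assume "\<forall>x. traces 1 (Suc n) (y * x) = traces 1 (Suc n) (x * y)"
      and "\<forall>x. traces 1 (Suc n) (z * x) = traces 1 (Suc n) (x * z)"
    then show "\<forall>x. traces 1 (Suc n) (y * z * x) = traces 1 (Suc n) (x * (y * z))"
      by (metis mult.assoc)
  next
    fix i assume "i < n"
    then show "\<forall>x. traces 1 (Suc n) (T (Suc i) * x) = traces 1 (Suc n) (x * T (Suc i))"
      by (intro allI traces_cyclic_T) auto
  qed (simp_all add: left_diff_distrib right_diff_distrib traces_diff traces_scale del: traces.simps)
  then show ?thesis ..
qed

lemma trivial_T_inv: "T t \<in> Triv s \<Longrightarrow> T_inv t \<in> Triv s"
  unfolding T_inv_def by (intro trivial_diff trivial_scale trivial_one)

lemma trivial_coxeter: "n < s \<Longrightarrow> coxeter n \<in> Triv s" and trivial_coxeter_inv: "n < s \<Longrightarrow> coxeter_inv n \<in> Triv s"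
  by (induction n) (auto intro!: trivial_one trivial_mult trivial_T trivial_T_inv)

lemma trivial_Lbar: "i < s \<Longrightarrow> Lbar i j \<in> Triv s"
  by (induction i) (auto intro!: trivial_L trivial_mult trivial_T trivial_T_inv)

lemma trivial_projector: "n < s \<Longrightarrow> projector n \<in> Triv s"
  by (rule skew_closed[where Pr = "\<lambda>x. x \<in> Triv s"])
     (auto intro: trivial_one trivial_mult trivial_diff trivial_scale trivial_T)

lemma trace_conj_T_inv: "x \<in> Triv (Suc s) \<Longrightarrow> tr (Suc s) (T s * x * T_inv s) = tr s x"
  unfolding T_inv_def by (rule trace_conj)

text \<open>
  The conjugation by \<open>T (n - 1)\<close> turns the trace over position \<open>n\<close> into one over position \<open>n - 1\<close>, after
  which the next conjugation does the same one position below. In the end all traces have moved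
  down by one.
\<close>
lemma traces_conj:
  assumes "\<And>t. n \<le> t \<Longrightarrow> x \<in> Triv t"
  shows "traces 1 n (coxeter n * x * coxeter_inv n) = traces 0 n x"
  using assms
proof (induction n arbitrary: x)
  case (Suc n)
  have "tr n x \<in> Triv t" if "n \<le> t" for t
    using that Suc.prems by (cases "t = n") (auto intro: trivial_trace trivial_trace_same)
  note IH = Suc.IH[OF this]
  have "tr (Suc n) (coxeter n * (T n * x * T_inv n) * coxeter_inv n) = coxeter n * tr n x * coxeter_inv n"
    using Suc.prems[of "Suc n"] by (simp only: trace_left trace_right trace_conj_T_inv trivial_coxeter trivial_coxeter_inv lessI order_refl)
  then show ?case using IH by (simp add: mult.assoc)
qed simp

text \<open>
  With the additional \<open>T 0\<close> the descent stops one step earlier: at \<open>n = 0\<close> it cancels against the last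
  inverse, and the trace of the remaining \<open>T 0\<close> over position 1 is the identity.
\<close>
lemma traces_conj_T:
  assumes "\<And>t. Suc n \<le> t \<Longrightarrow> x \<in> Triv t"
  shows "traces 1 (Suc n) (coxeter (Suc n) * x * coxeter_inv (Suc n) * T 0) = traces 1 n x"
  using assms
proof (induction n arbitrary: x)
  case 0
  then show ?case by (simp add: mult.assoc cancel trace_right trace_T)
next
  case (Suc n)
  have "tr (Suc n) x \<in> Triv t" if "Suc n \<le> t" for t
    using that Suc.prems by (cases "t = Suc n") (auto intro: trivial_trace trivial_trace_same)
  note IH = Suc.IH[OF this]
  have T0: "T 0 \<in> Triv (Suc (Suc n))" by (intro trivial_T) auto
  have "tr (Suc (Suc n)) (coxeter (Suc n) * (T (Suc n) * x * T_inv (Suc n)) * coxeter_inv (Suc n) * T 0)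
      = coxeter (Suc n) * tr (Suc n) x * coxeter_inv (Suc n) * T 0"
    using Suc.prems[of "Suc (Suc n)"] T0
    by (simp only: trace_left trace_right trace_conj_T_inv trivial_coxeter trivial_coxeter_inv lessI order_refl)
  then have "tr (Suc (Suc n)) (coxeter (Suc (Suc n)) * x * coxeter_inv (Suc (Suc n)) * T 0)
      = coxeter (Suc n) * tr (Suc n) x * coxeter_inv (Suc n) * T 0"
    unfolding coxeter.simps(2)[of "Suc n"] coxeter_inv.simps(2)[of "Suc n"] by (simp only: mult.assoc)
  then show ?case using IH by simp
qed

text \<open>
  The order is shifted: \<open>wedge n\<close> is \<open>L^(\<and>(n+1))(u)\<close>, acting in position 0.
\<close>
definition wedge :: "nat \<Rightarrow> 'b" where
  "wedge n = traces 1 n (projector n * ascending Lbar n 0)"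

theorem wedge_recursion:
  "qnum q (n + 2) \<cdot> wedge (Suc n) \<approx>
     L (Suc n) * (q ^ (n + 1) \<cdot> tr 0 (wedge n) - qnum q (n + 1) \<cdot> wedge n)"
proof -
  let ?Tr = "traces 1 (Suc n)" and ?A = "ascending (\<lambda>s. Lbar (Suc s)) n 0" and ?B = "descending (\<lambda>s. Lbar (Suc s)) n 0"
  let ?U = "q ^ (n + 1) \<cdot> 1 - qnum q (n + 1) \<cdot> T 0"
  let ?x = "projector n * ascending Lbar n 0"
  have nz: "qnum q (n + 2) \<noteq> 0" using gen by (simp add: q_numbers_nonzero_def)
  have "projector (Suc n) = (1 / qnum q (n + 2)) \<cdot> (projector_shift n * ?U * projector_shift n)"
    using skew_Suc_low[OF gen hecke_generators_T] unfolding skew_step_def .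
  then have low: "qnum q (n + 2) \<cdot> projector (Suc n) = projector_shift n * ?U * projector_shift n"
    using nz by simp
  have "hecke_generators q n (\<lambda>i. T (Suc i))"
    unfolding hecke_generators_def by (intro conjI allI impI quadratic braid far) simp
  then have idem: "projector_shift n * projector_shift n = projector_shift n"
    using antisymmetrizer_skew[OF gen] unfolding antisymmetrizer_def by blast
  have x: "?x \<in> Triv t" if "Suc n \<le> t" for t
    using that by (intro trivial_mult trivial_projector ascending_closed[where Pr = "\<lambda>z. z \<in> Triv t"] trivial_Lbar) auto
  have shift: "projector_shift n * ?A = coxeter (Suc n) * ?x * coxeter_inv (Suc n)"
    by (intro coxeter_conj intertwines_mult intertwines_coxeter_projector intertwines_ascending intertwines_coxeter_Lbar) auto
  have "qnum q (n + 2) \<cdot> wedge (Suc n) \<approx> qnum q (n + 2) \<cdot> ?Tr (descending Lbar (Suc n) 0 * projector (Suc n))"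
    unfolding wedge_def by (intro cong_scale traces_cong fusion)
  also have "\<dots> = ?Tr (L (Suc n) * (?B * (projector_shift n * ?U * projector_shift n)))"
    unfolding low[symmetric] traces_scale[symmetric] descending_Suc_left by (simp add: mult.assoc)
  also have "\<dots> = L (Suc n) * ?Tr (?B * projector_shift n * ?U * projector_shift n)"
    by (subst traces_left) (auto intro: trivial_L simp: mult.assoc)
  also have "\<dots> = L (Suc n) * ?Tr (projector_shift n * (?B * projector_shift n) * ?U)"
    unfolding traces_cyclic_projector_shift[symmetric] by (simp only: mult.assoc)
  also have "\<dots> \<approx> L (Suc n) * ?Tr (projector_shift n * (projector_shift n * ?A) * ?U)"
    by (intro cong_mult_left traces_cong cong_mult cong_sym[OF fusion_shift])
  also have "?Tr (projector_shift n * (projector_shift n * ?A) * ?U) = ?Tr (coxeter (Suc n) * ?x * coxeter_inv (Suc n) * ?U)"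
    unfolding shift[symmetric] using idem by (simp flip: mult.assoc)
  also have "\<dots> = q ^ (n + 1) \<cdot> ?Tr (coxeter (Suc n) * ?x * coxeter_inv (Suc n))
      - qnum q (n + 1) \<cdot> ?Tr (coxeter (Suc n) * ?x * coxeter_inv (Suc n) * T 0)"
    by (simp only: right_diff_distrib scale_mult_right mult.right_neutral traces_diff traces_scale)
  also have "\<dots> = q ^ (n + 1) \<cdot> tr 0 (wedge n) - qnum q (n + 1) \<cdot> wedge n"
  proof -
    have "?Tr (coxeter (Suc n) * ?x * coxeter_inv (Suc n)) = traces 0 (Suc n) ?x"
      by (rule traces_conj[OF x])
    moreover have "?Tr (coxeter (Suc n) * ?x * coxeter_inv (Suc n) * T 0) = traces 1 n ?x"
      by (rule traces_conj_T[OF x])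
    ultimately show ?thesis unfolding traces_Suc_left wedge_def by simp
  qed
  finally show ?thesis .
qed

text \<open>
  This is \<open>L^p(q^(-2j)u)\<close> in position 0.
\<close>
primrec power_chain :: "nat \<Rightarrow> nat \<Rightarrow> 'b" where
  "power_chain 0 j = 1"
| "power_chain (Suc p) j = L (j + p) * power_chain p j"

fun elementary :: "nat \<Rightarrow> 'b" where
  "elementary 0 = 1"
| "elementary (Suc n) = tr 0 (wedge n)"

theorem wedge_expansion:
  "((- 1) ^ n * qnum q (n + 1)) \<cdot> wedge n \<approx>
     (\<Sum>p = 1..n + 1. (- q) ^ (n + 1 - p) \<cdot> (power_chain p (n + 1 - p) * elementary (n + 1 - p)))"
proof (induction n)
  case 0
  have "qnum q 1 = 1" using gen by (simp add: qnum_def q_numbers_nonzero_def)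
  then show ?case by (simp add: wedge_def cong_refl)
next
  case (Suc n)
  define S where "S n = (\<Sum>p = 1..n + 1. (- q) ^ (n + 1 - p) \<cdot>
    (power_chain p (n + 1 - p) * elementary (n + 1 - p)))" for n
  have "S (Suc n) = (- q) ^ (n + 1) \<cdot> (L (n + 1) * elementary (n + 1)) +
     (\<Sum>p = 1..n + 1. (- q) ^ (n + 1 - p) \<cdot> (power_chain (Suc p) (n + 1 - p) * elementary (n + 1 - p)))"
  proof -
    let ?f = "\<lambda>p. (- q) ^ (n + 2 - p) \<cdot> (power_chain p (n + 2 - p) * elementary (n + 2 - p))"
    have "S (Suc n) = ?f 1 + sum ?f {Suc 1..Suc (n + 1)}"
      unfolding S_def by (subst sum.atLeast_Suc_atMost) simp_all
    also have "sum ?f {Suc 1..Suc (n + 1)} = (\<Sum>p = 1..n + 1. ?f (Suc p))"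
      by (simp only: sum.atLeast_Suc_atMost_Suc_shift o_def)
    finally show ?thesis by simp
  qed
  also have "\<dots> = L (n + 1) * ((- q) ^ (n + 1) \<cdot> elementary (n + 1) + S n)"
    unfolding S_def distrib_left sum_distrib_left scale_mult_right
    by (intro arg_cong2[of _ _ _ _ "(+)"] sum.cong refl) (auto simp: mult.assoc)
  finally have rec: "S (Suc n) = L (n + 1) * ((- q) ^ (n + 1) \<cdot> elementary (n + 1) + S n)" .
  \<comment> \<open>the sign turns the difference in the recursion into the sum of the expansion\<close>
  have sign: "(- 1) ^ Suc n \<cdot> (q ^ (n + 1) \<cdot> z - qnum q (n + 1) \<cdot> w)
      = (- q) ^ (n + 1) \<cdot> z + ((- 1) ^ n * qnum q (n + 1)) \<cdot> w" for z w
    by (simp add: scale_right_diff_distrib power_minus[of q] )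
  have "((- 1) ^ Suc n * qnum q (n + 2)) \<cdot> wedge (Suc n)
      = (- 1) ^ Suc n \<cdot> (qnum q (n + 2) \<cdot> wedge (Suc n))" by simp
  also have "\<dots> \<approx> (- 1) ^ Suc n \<cdot> (L (Suc n) * (q ^ (n + 1) \<cdot> tr 0 (wedge n) - qnum q (n + 1) \<cdot> wedge n))"
    by (rule cong_scale[OF wedge_recursion])
  also have "\<dots> = L (n + 1) * ((- q) ^ (n + 1) \<cdot> elementary (n + 1) + ((- 1) ^ n * qnum q (n + 1)) \<cdot> wedge n)"
    by (simp only: sign flip: scale_mult_right) simp
  also have "\<dots> \<approx> L (n + 1) * ((- q) ^ (n + 1) \<cdot> elementary (n + 1) + S n)"
    using Suc.IH unfolding S_def by (intro cong_mult_left cong_add cong_refl)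
  also have "\<dots> = S (Suc n)" by (rule rec[symmetric])
  finally show ?case unfolding S_def by simp
qed

end

section \<open>Row-finite matrices\<close>

text \<open>
  The coefficients need not commute. Finiteness of the rows makes the product well defined for an
  infinite index set; matrices acting on finitely many entries of a sequence have this property.
\<close>
typedef (overloaded) ('i, 'a) row_finite_matrix =
    "{X :: 'i \<Rightarrow> 'i \<Rightarrow> 'a::zero. \<forall>f. finite {g. X f g \<noteq> 0}}"
  morphisms entry Row_Finite
  by (rule exI[of _ "\<lambda>_ _. 0"]) simp

setup_lifting type_definition_row_finite_matrix

lemma finite_row: "finite {g. entry X f g \<noteq> 0}"
  using entry[of X] by blast

lemma row_finite_eqI: "(\<And>f g. entry X f g = entry Y f g) \<Longrightarrow> X = Y"
  by (metis entry_inject ext)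

instantiation row_finite_matrix :: (type, ring_1) ring_1
begin

lift_definition zero_row_finite_matrix :: "('a, 'b) row_finite_matrix" is "\<lambda>_ _. 0" by simp

lift_definition one_row_finite_matrix :: "('a, 'b) row_finite_matrix"
  is "\<lambda>f g. if f = g then 1 else 0" by simp

lift_definition plus_row_finite_matrix ::
  "('a, 'b) row_finite_matrix \<Rightarrow> ('a, 'b) row_finite_matrix \<Rightarrow> ('a, 'b) row_finite_matrix"
  is "\<lambda>X Y f g. X f g + Y f g"
proof -
  fix X Y :: "'a \<Rightarrow> 'a \<Rightarrow> 'b" and f
  assume "\<And>f. finite {g. X f g \<noteq> 0}" "\<And>f. finite {g. Y f g \<noteq> 0}"
  then show "finite {g. X f g + Y f g \<noteq> 0}"
    by (rule_tac finite_subset[of _ "{g. X f g \<noteq> 0} \<union> {g. Y f g \<noteq> 0}"]) auto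
qed

lift_definition uminus_row_finite_matrix ::
  "('a, 'b) row_finite_matrix \<Rightarrow> ('a, 'b) row_finite_matrix" is "\<lambda>X f g. - X f g" by simp

lift_definition minus_row_finite_matrix ::
  "('a, 'b) row_finite_matrix \<Rightarrow> ('a, 'b) row_finite_matrix \<Rightarrow> ('a, 'b) row_finite_matrix"
  is "\<lambda>X Y f g. X f g - Y f g"
proof -
  fix X Y :: "'a \<Rightarrow> 'a \<Rightarrow> 'b" and f
  assume "\<And>f. finite {g. X f g \<noteq> 0}" "\<And>f. finite {g. Y f g \<noteq> 0}"
  then show "finite {g. X f g - Y f g \<noteq> 0}"
    by (rule_tac finite_subset[of _ "{g. X f g \<noteq> 0} \<union> {g. Y f g \<noteq> 0}"]) auto
qed

lift_definition times_row_finite_matrix ::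
  "('a, 'b) row_finite_matrix \<Rightarrow> ('a, 'b) row_finite_matrix \<Rightarrow> ('a, 'b) row_finite_matrix"
  is "\<lambda>X Y f g. \<Sum>h | X f h \<noteq> 0. X f h * Y h g"
proof -
  fix X Y :: "'a \<Rightarrow> 'a \<Rightarrow> 'b" and f
  assume fin: "\<And>f. finite {g. X f g \<noteq> 0}" "\<And>f. finite {g. Y f g \<noteq> 0}"
  have "\<exists>h\<in>{h. X f h \<noteq> 0}. Y h g \<noteq> 0" if "(\<Sum>h | X f h \<noteq> 0. X f h * Y h g) \<noteq> 0" for g
    using that by (metis (no_types, lifting) mult_zero_right sum.neutral)
  then have "{g. (\<Sum>h | X f h \<noteq> 0. X f h * Y h g) \<noteq> 0} \<subseteq> (\<Union>h\<in>{h. X f h \<noteq> 0}. {g. Y h g \<noteq> 0})"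
    by blast
  then show "finite {g. (\<Sum>h | X f h \<noteq> 0. X f h * Y h g) \<noteq> 0}"
    by (rule finite_subset) (simp add: fin)
qed

lemma entry_mult_sum:
  assumes "finite S" "\<And>h. h \<notin> S \<Longrightarrow> entry X f h * entry Y h g = 0"
  shows "entry (X * Y) f g = (\<Sum>h\<in>S. entry X f h * entry Y h g)"
proof -
  let ?T = "{h. entry X f h \<noteq> 0}"
  have "entry (X * Y) f g = (\<Sum>h\<in>?T. entry X f h * entry Y h g)"
    by (simp add: times_row_finite_matrix.rep_eq)
  also have "\<dots> = (\<Sum>h\<in>?T \<union> S. entry X f h * entry Y h g)"
    by (rule sum.mono_neutral_left) (use assms finite_row in auto)
  also have "\<dots> = (\<Sum>h\<in>S. entry X f h * entry Y h g)"
    by (rule sum.mono_neutral_right) (use assms finite_row in auto)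
  finally show ?thesis .
qed

instance
proof
  fix X Y Z :: "('a, 'b) row_finite_matrix"
  show "X * Y * Z = X * (Y * Z)"
  proof (rule row_finite_eqI)
    fix f g
    let ?S = "{h. entry X f h \<noteq> 0}"
    let ?T = "\<Union>h\<in>?S. {k. entry Y h k \<noteq> 0}"
    have fin: "finite ?S" "finite ?T" by (simp_all add: finite_row)
    have "entry (X * Y) f k = (\<Sum>h\<in>?S. entry X f h * entry Y h k)" for k
      by (rule entry_mult_sum) (simp_all add: fin)
    then have "entry (X * Y * Z) f g = (\<Sum>k\<in>?T. (\<Sum>h\<in>?S. entry X f h * entry Y h k) * entry Z k g)"
      by (subst entry_mult_sum[OF fin(2)]) (auto intro!: sum.neutral simp: sum_distrib_right)
    also have "\<dots> = (\<Sum>h\<in>?S. entry X f h * (\<Sum>k\<in>?T. entry Y h k * entry Z k g))"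
      by (simp add: sum_distrib_left sum_distrib_right mult.assoc)
         (rule sum.swap)
    also have "\<dots> = (\<Sum>h\<in>?S. entry X f h * entry (Y * Z) h g)"
    proof (rule sum.cong[OF refl])
      fix h assume "h \<in> ?S"
      then have "entry (Y * Z) h g = (\<Sum>k\<in>?T. entry Y h k * entry Z k g)"
        by (intro entry_mult_sum[OF fin(2)]) auto
      then show "entry X f h * (\<Sum>k\<in>?T. entry Y h k * entry Z k g) = entry X f h * entry (Y * Z) h g"
        by simp
    qed
    also have "\<dots> = entry (X * (Y * Z)) f g"
      by (rule entry_mult_sum[symmetric]) (simp_all add: fin)
    finally show "entry (X * Y * Z) f g = entry (X * (Y * Z)) f g" .
  qed
  show "1 * X = X"
    by (rule row_finite_eqI, subst entry_mult_sum[of "{f}" for f])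
       (auto simp: one_row_finite_matrix.rep_eq)
  show "X * 1 = X"
    by (rule row_finite_eqI, rename_tac f g, subst entry_mult_sum[of "{g}" for g])
       (auto simp: one_row_finite_matrix.rep_eq)
  show "(X + Y) * Z = X * Z + Y * Z"
  proof (rule row_finite_eqI)
    fix f g
    let ?S = "{h. entry X f h \<noteq> 0} \<union> {h. entry Y f h \<noteq> 0}"
    have fin: "finite ?S" using finite_row by auto
    show "entry ((X + Y) * Z) f g = entry (X * Z + Y * Z) f g"
      unfolding plus_row_finite_matrix.rep_eq
      by (subst (1 2 3) entry_mult_sum[OF fin])
         (auto simp: plus_row_finite_matrix.rep_eq sum.distrib distrib_right)
  qed
  show "X * (Y + Z) = X * Y + X * Z"
  proof (rule row_finite_eqI)
    fix f g
    show "entry (X * (Y + Z)) f g = entry (X * Y + X * Z) f g"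
      by (simp add: times_row_finite_matrix.rep_eq plus_row_finite_matrix.rep_eq sum.distrib distrib_left)
  qed
  show "(0 :: ('a, 'b) row_finite_matrix) \<noteq> 1"
    by transfer (metis zero_neq_one)
qed (transfer; auto simp: fun_eq_iff add.assoc add.commute)+

end

lemmas entry_simps [simp] = zero_row_finite_matrix.rep_eq plus_row_finite_matrix.rep_eq
  minus_row_finite_matrix.rep_eq uminus_row_finite_matrix.rep_eq

lemma entry_one: "entry (1 :: ('i, 'a::ring_1) row_finite_matrix) f g = (if f = g then 1 else 0)"
  by (simp add: one_row_finite_matrix.rep_eq)

lemma entry_sum: "entry (sum X S) f g = (\<Sum>s\<in>S. entry (X s) f g)"
  by (induction S rule: infinite_finite_induct) simp_all

section \<open>Operators in given positions and partial traces\<close>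
definition agree_off :: "nat set \<Rightarrow> (nat \<Rightarrow> 'n) \<Rightarrow> (nat \<Rightarrow> 'n) \<Rightarrow> bool" where
  "agree_off S f g \<longleftrightarrow> (\<forall>t. t \<notin> S \<longrightarrow> f t = g t)"

lemma finite_agree_off:
  fixes f :: "nat \<Rightarrow> 'n::finite"
  assumes "finite S"
  shows "finite {g. agree_off S f g}"
  using assms
proof induction
  case empty
  have "{g. agree_off {} f g} = {f}" by (auto simp: agree_off_def)
  then show ?case by simp
next
  case (insert s S)
  have "g \<in> (\<Union>h\<in>{h. agree_off S f h}. range (\<lambda>x. h(s := x)))" if "agree_off (insert s S) f g" for g
    using that by (intro UN_I[of "g(s := f s)"] image_eqI[of _ _ "g s"]) (auto simp: agree_off_def)
  then have "{g. agree_off (insert s S) f g} \<subseteq> (\<Union>h\<in>{h. agree_off S f h}. range (\<lambda>x. h(s := x)))"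
    by blast
  then show ?case by (rule finite_subset) (simp add: insert.IH)
qed

lemma finite_entry_if:
  fixes f :: "nat \<Rightarrow> 'n::finite"
  shows "finite S \<Longrightarrow> finite {g. (if agree_off S f g then x g else 0) \<noteq> (0::'a::zero)}"
  by (rule finite_subset[OF _ finite_agree_off[of S f]]) (auto split: if_splits)

lift_definition pos :: "nat \<Rightarrow> 'a::zero ^ 'n::finite ^ 'n \<Rightarrow> (nat \<Rightarrow> 'n, 'a) row_finite_matrix"
  is "\<lambda>s M f g. if agree_off {s} f g then M $ f s $ g s else 0"
  by (rule finite_entry_if) simp

lift_definition pos2 ::
  "nat \<Rightarrow> 'a::zero ^ ('n::finite \<times> 'n) ^ ('n \<times> 'n) \<Rightarrow> (nat \<Rightarrow> 'n, 'a) row_finite_matrix"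
  is "\<lambda>s M f g. if agree_off {s, Suc s} f g then M $ (f s, f (Suc s)) $ (g s, g (Suc s)) else 0"
  by (rule finite_entry_if) simp

definition upd2 :: "nat \<Rightarrow> (nat \<Rightarrow> 'n) \<Rightarrow> 'n \<times> 'n \<Rightarrow> nat \<Rightarrow> 'n" where
  "upd2 s f p = f(s := fst p, Suc s := snd p)"

lemma upd2_apply [simp]: "upd2 s f p s = fst p" "upd2 s f p (Suc s) = snd p"
  "t \<noteq> s \<Longrightarrow> t \<noteq> Suc s \<Longrightarrow> upd2 s f p t = f t"
  by (simp_all add: upd2_def)

lemma inj_upd2: "inj (upd2 s f)"
  by (rule injI) (metis prod.expand upd2_apply(1,2))

lemma agree_off_1: "agree_off {s} f g \<longleftrightarrow> g = f(s := g s)" "agree_off {s} f g \<longleftrightarrow> f = g(s := f s)"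
  by (auto simp: agree_off_def fun_eq_iff)

lemma agree_off_2:
  "agree_off {s, Suc s} f g \<longleftrightarrow> g = upd2 s f (g s, g (Suc s))"
  "agree_off {s, Suc s} f g \<longleftrightarrow> f = upd2 s g (f s, f (Suc s))"
  by (auto simp: agree_off_def fun_eq_iff upd2_def)

lemma agree_off_eq_iff:
  "agree_off {s} f g \<and> f s = g s \<longleftrightarrow> f = g"
  "agree_off {s, Suc s} f g \<and> f s = g s \<and> f (Suc s) = g (Suc s) \<longleftrightarrow> f = g"
  by (auto simp: agree_off_def fun_eq_iff)

lemma entry_pos_mult:
  "entry (pos s M * Y) f g = (\<Sum>i\<in>UNIV. M $ f s $ i * entry Y (f(s := i)) g)"
proof -
  have "inj (\<lambda>i. f(s := i))" by (rule injI) (metis fun_upd_same)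
  moreover have "entry (pos s M * Y) f g
      = (\<Sum>h\<in>range (\<lambda>i. f(s := i)). entry (pos s M) f h * entry Y h g)"
    by (rule entry_mult_sum) (auto simp: pos.rep_eq agree_off_1(1))
  ultimately show ?thesis
    by (simp add: sum.reindex pos.rep_eq agree_off_def)
qed

lemma entry_pos2_mult:
  "entry (pos2 s M * Y) f g = (\<Sum>p\<in>UNIV. M $ (f s, f (Suc s)) $ p * entry Y (upd2 s f p) g)"
proof -
  have "entry (pos2 s M * Y) f g
      = (\<Sum>h\<in>range (upd2 s f). entry (pos2 s M) f h * entry Y h g)"
    by (rule entry_mult_sum) (auto simp: pos2.rep_eq agree_off_2(1))
  then show ?thesis
    by (simp add: sum.reindex inj_upd2 pos2.rep_eq agree_off_def)
qed

lemma entry_mult_pos2: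
  "entry (Y * pos2 s M) f g = (\<Sum>p\<in>UNIV. entry Y f (upd2 s g p) * M $ p $ (g s, g (Suc s)))"
proof -
  have "entry (Y * pos2 s M) f g
      = (\<Sum>h\<in>range (upd2 s g). entry Y f h * entry (pos2 s M) h g)"
    by (rule entry_mult_sum) (auto simp: pos2.rep_eq agree_off_2(2))
  then show ?thesis
    by (simp add: sum.reindex inj_upd2 pos2.rep_eq agree_off_def)
qed

lemma pos_mult: "pos s (A ** B) = pos s A * pos s B"
  by (rule row_finite_eqI)
     (auto simp: entry_pos_mult pos.rep_eq matrix_matrix_mult_def agree_off_def intro!: sum.cong sum.neutral)

lemma pos2_mult: "pos2 s (A ** B) = pos2 s A * pos2 s B"
  by (rule row_finite_eqI)
     (auto simp: entry_pos2_mult pos2.rep_eq matrix_matrix_mult_def agree_off_def intro!: sum.cong sum.neutral)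

text \<open>
  Operators that are the identity in the tensor factor \<open>s\<close>, expressed through matrix entries.
\<close>
definition trivial_at :: "nat \<Rightarrow> (nat \<Rightarrow> 'n, 'a::zero) row_finite_matrix set" where
  "trivial_at s = {X. (\<forall>f g. f s \<noteq> g s \<longrightarrow> entry X f g = 0) \<and>
     (\<forall>f g x. f s = g s \<longrightarrow> entry X (f(s := x)) (g(s := x)) = entry X f g)}"

lemma trivial_atD:
  assumes "X \<in> trivial_at s"
  shows "f s \<noteq> g s \<Longrightarrow> entry X f g = 0"
    and "f s = g s \<Longrightarrow> entry X (f(s := x)) (g(s := x)) = entry X f g"
proof -
  note X = CollectD[OF assms[unfolded trivial_at_def]]
  show "f s \<noteq> g s \<Longrightarrow> entry X f g = 0"
    by (rule X[THEN conjunct1, rule_format])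
  show "f s = g s \<Longrightarrow> entry X (f(s := x)) (g(s := x)) = entry X f g"
    by (rule X[THEN conjunct2, rule_format])
qed

lemma trivial_atI:
  assumes "\<And>f g. f s \<noteq> g s \<Longrightarrow> entry X f g = 0"
    and "\<And>f g x. f s = g s \<Longrightarrow> entry X (f(s := x)) (g(s := x)) = entry X f g"
  shows "X \<in> trivial_at s"
  unfolding trivial_at_def by (intro CollectI conjI allI impI assms)

lemma fun_upd_cancel:
  assumes "h(s := x) = k(s := x)" "h s = k s"
  shows "h = k"
proof
  fix t show "h t = k t"
    using fun_cong[OF assms(1), of t] assms(2) by (cases "t = s") simp_all
qed

text \<open>
  Changing position \<open>s\<close> of the row index is passed on to the second factor. This is what allows a factor
  trivial in position \<open>s\<close> to leave a trace over that position.
\<close>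
lemma entry_mult_trivial_left:
  assumes X: "X \<in> trivial_at s"
  shows "entry (X * Y) (f(s := x)) g = (\<Sum>h | entry X f h \<noteq> 0. entry X f h * entry Y (h(s := x)) g)"
proof -
  let ?S = "{h. entry X f h \<noteq> 0}"
  have same: "h s = f s" if "entry X f h \<noteq> 0" for h
    using that trivial_atD(1)[OF X, of f h] by metis
  have "inj_on (\<lambda>h. h(s := x)) ?S"
  proof (rule inj_onI)
    fix h k assume "h \<in> ?S" "k \<in> ?S" "h(s := x) = k(s := x)"
    then show "h = k" using same[of h] same[of k] by (intro fun_upd_cancel[of h s x k]) simp_all
  qed
  moreover have "entry (X * Y) (f(s := x)) g
      = (\<Sum>h\<in>(\<lambda>h. h(s := x)) ` ?S. entry X (f(s := x)) h * entry Y h g)"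
  proof (rule entry_mult_sum)
    fix h assume "h \<notin> (\<lambda>h. h(s := x)) ` ?S"
    have "entry X (f(s := x)) h = 0"
    proof (cases "h s = x")
      case True
      have "entry X ((f(s := x))(s := f s)) (h(s := f s)) = entry X (f(s := x)) h"
        by (rule trivial_atD(2)[OF X]) (simp add: True)
      moreover have "h(s := f s) \<notin> ?S"
      proof
        assume "h(s := f s) \<in> ?S"
        then have "(h(s := f s))(s := x) \<in> (\<lambda>h. h(s := x)) ` ?S" by (rule imageI)
        then show False using \<open>h \<notin> _\<close> True by auto
      qed
      ultimately show ?thesis by simp
    next
      case False
      then show ?thesis by (intro trivial_atD(1)[OF X]) simp
    qed
    then show "entry X (f(s := x)) h * entry Y h g = 0" by simp
  qed (simp add: finite_row)
  ultimately have "entry (X * Y) (f(s := x)) g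
      = (\<Sum>h\<in>?S. entry X (f(s := x)) (h(s := x)) * entry Y (h(s := x)) g)"
    by (simp add: sum.reindex)
  also have "\<dots> = (\<Sum>h\<in>?S. entry X f h * entry Y (h(s := x)) g)"
  proof (rule sum.cong[OF refl])
    fix h assume "h \<in> ?S"
    then have "f s = h s" using same by simp
    then show "entry X (f(s := x)) (h(s := x)) * entry Y (h(s := x)) g
        = entry X f h * entry Y (h(s := x)) g"
      using trivial_atD(2)[OF X, of f h x] by simp
  qed
  finally show ?thesis .
qed

lemma trivial_at_one: "1 \<in> trivial_at s"
proof (rule trivial_atI)
  fix f g :: "nat \<Rightarrow> 'a" and x
  assume "f s = g s"
  then show "entry 1 (f(s := x)) (g(s := x)) = entry 1 f g"
    unfolding entry_one by (auto intro: fun_upd_cancel)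
qed (auto simp: entry_one)

lemma trivial_at_diff: "X \<in> trivial_at s \<Longrightarrow> Y \<in> trivial_at s \<Longrightarrow> X - Y \<in> trivial_at s"
  for X Y :: "(nat \<Rightarrow> 'n, 'a::ring_1) row_finite_matrix"
  by (rule trivial_atI) (simp_all add: trivial_atD)

lemma trivial_at_mult:
  fixes X Y :: "(nat \<Rightarrow> 'n, 'a::ring_1) row_finite_matrix"
  assumes X: "X \<in> trivial_at s" and Y: "Y \<in> trivial_at s"
  shows "X * Y \<in> trivial_at s"
proof (rule trivial_atI)
  fix f g :: "nat \<Rightarrow> 'n"
  assume "f s \<noteq> g s"
  then show "entry (X * Y) f g = 0"
    unfolding times_row_finite_matrix.rep_eq
    by (intro sum.neutral) (metis X Y mult_zero_right mult_zero_left trivial_atD(1))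
next
  fix f g :: "nat \<Rightarrow> 'n" and x
  assume fg: "f s = g s"
  have "entry Y (h(s := x)) (g(s := x)) = entry Y h g" if "entry X f h \<noteq> 0" for h
    using trivial_atD(1)[OF X] that fg by (intro trivial_atD(2)[OF Y]) metis
  then have "(\<Sum>h | entry X f h \<noteq> 0. entry X f h * entry Y (h(s := x)) (g(s := x)))
      = (\<Sum>h | entry X f h \<noteq> 0. entry X f h * entry Y h g)"
    by (intro sum.cong) auto
  then show "entry (X * Y) (f(s := x)) (g(s := x)) = entry (X * Y) f g"
    using entry_mult_trivial_left[OF X, of Y f x "g(s := x)"]
    by (simp add: times_row_finite_matrix.rep_eq)
qed

lemma trivial_at_pos: "s \<noteq> t \<Longrightarrow> pos t M \<in> trivial_at s"
  by (rule trivial_atI) (auto simp: pos.rep_eq agree_off_def)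

lemma trivial_at_pos2: "s \<noteq> t \<Longrightarrow> s \<noteq> Suc t \<Longrightarrow> pos2 t M \<in> trivial_at s"
  by (rule trivial_atI) (auto simp: pos2.rep_eq agree_off_def)

lemma entry_trivial_upd2:
  assumes "X \<in> trivial_at (Suc s)" "f (Suc s) = g (Suc s)"
  shows "entry X (upd2 s f p) (upd2 s g r)
    = (if snd p = snd r then entry X (f(s := fst p)) (g(s := fst r)) else 0)"
proof (cases "snd p = snd r")
  case True
  have "entry X ((f(s := fst p))(Suc s := snd p)) ((g(s := fst r))(Suc s := snd p))
      = entry X (f(s := fst p)) (g(s := fst r))"
    by (rule trivial_atD(2)[OF assms(1)]) (simp add: assms(2))
  then show ?thesis using True by (simp add: upd2_def)
next
  case False
  then show ?thesis by (simp add: trivial_atD(1)[OF assms(1)])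
qed

lemma pos2_commute:
  fixes Y :: "(nat \<Rightarrow> 'n::finite, 'a::ring_1) row_finite_matrix"
  assumes Y: "Y \<in> trivial_at s" "Y \<in> trivial_at (Suc s)"
    and central: "\<And>p r x. M $ p $ r * x = x * M $ p $ r"
  shows "pos2 s M * Y = Y * pos2 s M"
proof (rule row_finite_eqI)
  fix f g :: "nat \<Rightarrow> 'n"
  let ?F = "(f s, f (Suc s))" and ?G = "(g s, g (Suc s))"
  have 1: "entry Y (upd2 s f p) g = 0" if "p \<noteq> ?G" for p
    using that trivial_atD(1)[OF Y(1), of "upd2 s f p" g] trivial_atD(1)[OF Y(2), of "upd2 s f p" g]
    by (metis prod.collapse upd2_apply(1,2))
  have 2: "entry Y f (upd2 s g p) = 0" if "p \<noteq> ?F" for p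
    using that trivial_atD(1)[OF Y(1), of f "upd2 s g p"] trivial_atD(1)[OF Y(2), of f "upd2 s g p"]
    by (metis prod.collapse upd2_apply(1,2))
  have "entry Y (upd2 s f ?G) g = entry Y ((upd2 s f ?G)(s := f s)) (g(s := f s))"
    by (rule trivial_atD(2)[OF Y(1), symmetric]) simp
  also have "\<dots> = entry Y ((upd2 s f ?G)(s := f s, Suc s := f (Suc s))) (g(s := f s, Suc s := f (Suc s)))"
    by (rule trivial_atD(2)[OF Y(2), symmetric]) simp
  also have "(upd2 s f ?G)(s := f s, Suc s := f (Suc s)) = f"
    by (auto simp: upd2_def)
  also have "g(s := f s, Suc s := f (Suc s)) = upd2 s g ?F"
    by (simp add: upd2_def)
  finally have 3: "entry Y (upd2 s f ?G) g = entry Y f (upd2 s g ?F)" .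
  have "entry (pos2 s M * Y) f g = (\<Sum>p\<in>{?G}. M $ ?F $ p * entry Y (upd2 s f p) g)"
    unfolding entry_pos2_mult by (rule sum.mono_neutral_right) (auto simp: 1)
  moreover have "entry (Y * pos2 s M) f g = (\<Sum>p\<in>{?F}. entry Y f (upd2 s g p) * M $ p $ ?G)"
    unfolding entry_mult_pos2 by (rule sum.mono_neutral_right) (auto simp: 2)
  ultimately show "entry (pos2 s M * Y) f g = entry (Y * pos2 s M) f g"
    by (simp add: 3 central)
qed

text \<open>
  The trace of \<open>C_s X\<close> over position \<open>s\<close>, tensored with the identity in that position.
\<close>
lift_definition partial_trace :: "'a::ring_1 ^ 'n::finite ^ 'n \<Rightarrow> nat \<Rightarrow>
    (nat \<Rightarrow> 'n, 'a) row_finite_matrix \<Rightarrow> (nat \<Rightarrow> 'n, 'a) row_finite_matrix"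
  is "\<lambda>C s X f g. if f s = g s
        then \<Sum>i\<in>UNIV. \<Sum>j\<in>UNIV. C $ i $ j * X (f(s := j)) (g(s := i)) else 0"
proof -
  fix C :: "'a ^ 'n ^ 'n" and s and X :: "(nat \<Rightarrow> 'n) \<Rightarrow> (nat \<Rightarrow> 'n) \<Rightarrow> 'a" and f
  assume fin: "\<And>f. finite {g. X f g \<noteq> 0}"
  let ?t = "\<lambda>g. if f s = g s then \<Sum>i\<in>UNIV. \<Sum>j\<in>UNIV. C $ i $ j * X (f(s := j)) (g(s := i)) else 0"
  have "g \<in> (\<Union>j. (\<lambda>h. h(s := f s)) ` {h. X (f(s := j)) h \<noteq> 0})" if "?t g \<noteq> 0" for g
  proof -
    from that have fg: "f s = g s" by (auto split: if_splits)
    with that have "(\<Sum>i\<in>UNIV. \<Sum>j\<in>UNIV. C $ i $ j * X (f(s := j)) (g(s := i))) \<noteq> 0" by simp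
    then obtain i where "(\<Sum>j\<in>UNIV. C $ i $ j * X (f(s := j)) (g(s := i))) \<noteq> 0"
      by (meson sum.not_neutral_contains_not_neutral)
    then obtain j where "C $ i $ j * X (f(s := j)) (g(s := i)) \<noteq> 0"
      by (meson sum.not_neutral_contains_not_neutral)
    then have "X (f(s := j)) (g(s := i)) \<noteq> 0" by auto
    then show ?thesis
      by (intro UN_I[of j] image_eqI[of _ _ "g(s := i)"]) (auto simp: fg)
  qed
  then have "{g. ?t g \<noteq> 0} \<subseteq> (\<Union>j. (\<lambda>h. h(s := f s)) ` {h. X (f(s := j)) h \<noteq> 0})"
    by blast
  then show "finite {g. ?t g \<noteq> 0}"
    by (rule finite_subset) (simp add: fin)
qed

lemma partial_trace_diff: "partial_trace C s (X - Y) = partial_trace C s X - partial_trace C s Y"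
  by (rule row_finite_eqI) (simp add: partial_trace.rep_eq right_diff_distrib sum_subtractf)

lemma trivial_at_partial_trace_same: "partial_trace C s X \<in> trivial_at s"
  by (rule trivial_atI) (simp_all add: partial_trace.rep_eq)

lemma trivial_at_partial_trace:
  assumes "X \<in> trivial_at s"
  shows "partial_trace C t X \<in> trivial_at s"
proof (cases "s = t")
  case True
  then show ?thesis by (simp add: trivial_at_partial_trace_same)
next
  case False
  have "entry X (f(s := x, t := j)) (g(s := x, t := i)) = entry X (f(t := j)) (g(t := i))"
    if "f s = g s" for f g x i j
    using trivial_atD(2)[OF assms, of "f(t := j)" "g(t := i)" x] that False
    by (simp add: fun_upd_twist)
  then show ?thesis
    using False by (intro trivial_atI) (simp_all add: partial_trace.rep_eq trivial_atD(1)[OF assms])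
qed

lemma partial_trace_mult_left:
  assumes X: "X \<in> trivial_at s" and central: "\<And>i j x. C $ i $ j * x = x * C $ i $ j"
  shows "partial_trace C s (X * Y) = X * partial_trace C s Y"
proof (rule row_finite_eqI)
  fix f g :: "nat \<Rightarrow> 'a"
  let ?S = "{h. entry X f h \<noteq> 0}"
  have same: "h s = f s" if "entry X f h \<noteq> 0" for h
    using that trivial_atD(1)[OF X, of f h] by metis
  show "entry (partial_trace C s (X * Y)) f g = entry (X * partial_trace C s Y) f g"
  proof (cases "f s = g s")
    case True
    have pull: "c * (x * y) = x * (c * y)" if "c = C $ i $ j" for c x y i j
      using that central by (metis mult.assoc)
    let ?t = "\<lambda>i j h. C $ i $ j * (entry X f h * entry Y (h(s := j)) (g(s := i)))"
    have "entry (partial_trace C s (X * Y)) f g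
        = (\<Sum>i\<in>UNIV. \<Sum>j\<in>UNIV. \<Sum>h\<in>?S. ?t i j h)"
      using True by (simp add: partial_trace.rep_eq entry_mult_trivial_left[OF X] sum_distrib_left)
    also have "\<dots> = (\<Sum>i\<in>UNIV. \<Sum>h\<in>?S. \<Sum>j\<in>UNIV. ?t i j h)"
      by (rule sum.cong[OF refl], rule sum.swap)
    also have "\<dots> = (\<Sum>h\<in>?S. \<Sum>i\<in>UNIV. \<Sum>j\<in>UNIV. ?t i j h)"
      by (rule sum.swap)
    also have "\<dots> = (\<Sum>h\<in>?S. entry X f h * entry (partial_trace C s Y) h g)"
      using True same by (intro sum.cong refl)
         (simp add: partial_trace.rep_eq sum_distrib_left pull[OF refl])
    finally show ?thesis by (simp add: times_row_finite_matrix.rep_eq)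
  next
    case False
    then have "entry (X * partial_trace C s Y) f g = 0"
      unfolding times_row_finite_matrix.rep_eq
      using same by (intro sum.neutral) (auto simp: partial_trace.rep_eq)
    then show ?thesis using False by (simp add: partial_trace.rep_eq)
  qed
qed

text \<open>
  The columns of \<open>X\<close> may be infinite, so the sum over the intermediate index runs over a
  finite set read off from the rows of \<open>Y\<close>, with position \<open>s\<close> normalized.
\<close>
lemma partial_trace_mult_right:
  assumes X: "X \<in> trivial_at s"
  shows "partial_trace C s (Y * X) = partial_trace C s Y * X"
proof (rule row_finite_eqI)
  fix f g :: "nat \<Rightarrow> 'a"
  show "entry (partial_trace C s (Y * X)) f g = entry (partial_trace C s Y * X) f g"
  proof (cases "f s = g s")
    case True
    define H where "H = (\<lambda>h. h(s := f s)) ` (\<Union>j. {h. entry Y (f(s := j)) h \<noteq> 0})"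
    have fin: "finite H" by (simp add: H_def finite_row)
    have Hs: "h s = f s" if "h \<in> H" for h using that by (auto simp: H_def)
    have inner: "entry (Y * X) (f(s := j)) (g(s := i))
        = (\<Sum>h\<in>H. entry Y (f(s := j)) (h(s := i)) * entry X h g)" for i j
    proof -
      have "inj_on (\<lambda>h. h(s := i)) H"
      proof (rule inj_onI)
        fix h k assume "h \<in> H" "k \<in> H" "h(s := i) = k(s := i)"
        then show "h = k" using Hs[of h] Hs[of k] by (intro fun_upd_cancel[of h s i k]) simp_all
      qed
      moreover have "entry (Y * X) (f(s := j)) (g(s := i))
          = (\<Sum>h\<in>(\<lambda>h. h(s := i)) ` H. entry Y (f(s := j)) h * entry X h (g(s := i)))"
      proof (rule entry_mult_sum)
        fix h assume h: "h \<notin> (\<lambda>h. h(s := i)) ` H"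
        show "entry Y (f(s := j)) h * entry X h (g(s := i)) = 0"
        proof (cases "h s = i \<and> entry Y (f(s := j)) h \<noteq> 0")
          case True
          then have "h(s := f s) \<in> H" unfolding H_def by blast
          then have "(h(s := f s))(s := i) \<in> (\<lambda>h. h(s := i)) ` H" by (rule imageI)
          then show ?thesis using h True by auto
        next
          case False
          then show ?thesis using trivial_atD(1)[OF X, of h "g(s := i)"] by auto
        qed
      qed (simp add: fin)
      moreover have "entry X (h(s := i)) (g(s := i)) = entry X h g" if "h \<in> H" for h
        using True Hs[OF that] by (intro trivial_atD(2)[OF X]) simp
      ultimately show ?thesis by (simp add: sum.reindex)
    qed
    let ?t = "\<lambda>i j h. C $ i $ j * (entry Y (f(s := j)) (h(s := i)) * entry X h g)"
    have "entry (partial_trace C s (Y * X)) f g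
        = (\<Sum>i\<in>UNIV. \<Sum>j\<in>UNIV. \<Sum>h\<in>H. ?t i j h)"
      using True by (simp add: partial_trace.rep_eq inner sum_distrib_left)
    also have "\<dots> = (\<Sum>i\<in>UNIV. \<Sum>h\<in>H. \<Sum>j\<in>UNIV. ?t i j h)"
      by (rule sum.cong[OF refl], rule sum.swap)
    also have "\<dots> = (\<Sum>h\<in>H. \<Sum>i\<in>UNIV. \<Sum>j\<in>UNIV. ?t i j h)"
      by (rule sum.swap)
    also have "\<dots> = (\<Sum>h\<in>H. entry (partial_trace C s Y) f h * entry X h g)"
      by (intro sum.cong refl) (simp add: partial_trace.rep_eq Hs sum_distrib_right mult.assoc)
    also have "\<dots> = entry (partial_trace C s Y * X) f g"
    proof (rule entry_mult_sum[symmetric, OF fin])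
      fix h assume h: "h \<notin> H"
      show "entry (partial_trace C s Y) f h * entry X h g = 0"
      proof (cases "h s = f s")
        case hs: True
        have "entry Y (f(s := j)) (h(s := i)) = 0" for i j
        proof (rule ccontr)
          assume "entry Y (f(s := j)) (h(s := i)) \<noteq> 0"
          then have "(h(s := i))(s := f s) \<in> H" unfolding H_def by blast
          then show False using h hs[symmetric] by simp
        qed
        then show ?thesis by (simp add: partial_trace.rep_eq)
      qed (simp add: partial_trace.rep_eq)
    qed
    finally show ?thesis .
  next
    case False
    have "entry (partial_trace C s Y) f h * entry X h g = 0" for h
      using False trivial_atD(1)[OF X, of h g] by (auto simp: partial_trace.rep_eq)
    then show ?thesis using False
      by (simp add: partial_trace.rep_eq times_row_finite_matrix.rep_eq)
  qed
qed

lemma partial_trace_pos2: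
  assumes "\<And>a b. (\<Sum>i\<in>UNIV. \<Sum>j\<in>UNIV. C $ i $ j * R $ (a, j) $ (b, i)) = (if a = b then 1 else 0)"
  shows "partial_trace C (Suc s) (pos2 s R) = 1"
proof (rule row_finite_eqI)
  fix f g :: "nat \<Rightarrow> 'a"
  show "entry (partial_trace C (Suc s) (pos2 s R)) f g = entry 1 f g"
  proof (cases "agree_off {s} f g")
    case True
    then have "f (Suc s) = g (Suc s)" by (simp add: agree_off_def)
    moreover have "agree_off {s, Suc s} (f(Suc s := j)) (g(Suc s := i))" for i j
      using True by (auto simp: agree_off_def)
    moreover have "f = g \<longleftrightarrow> f s = g s"
      using True by (metis agree_off_1(1) fun_upd_triv)
    ultimately show ?thesis
      by (simp add: partial_trace.rep_eq pos2.rep_eq assms entry_one)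
  next
    case False
    have "entry (partial_trace C (Suc s) (pos2 s R)) f g = 0"
    proof (cases "f (Suc s) = g (Suc s)")
      case True
      then have "\<not> agree_off {s, Suc s} (f(Suc s := j)) (g(Suc s := i))" for i j
        using False by (auto simp: agree_off_def split: if_splits)
      then show ?thesis by (simp add: partial_trace.rep_eq pos2.rep_eq)
    qed (simp add: partial_trace.rep_eq)
    moreover have "f \<noteq> g" using False by (auto simp: agree_off_def)
    ultimately show ?thesis by (simp add: entry_one)
  qed
qed

section \<open>Scalars and finite tensor powers\<close>
locale central_hom =
  fixes \<phi> :: "'k::field \<Rightarrow> 'a::ring_1"
  assumes hom_add: "\<phi> (a + b) = \<phi> a + \<phi> b" and hom_mult: "\<phi> (a * b) = \<phi> a * \<phi> b"
    and hom_one: "\<phi> 1 = 1" and central: "\<phi> a * x = x * \<phi> a"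
begin

lemma hom_left_commute: "\<phi> a * (x * y) = x * (\<phi> a * y)"
  unfolding mult.assoc[symmetric] central[of a x] ..

lemma hom_zero: "\<phi> 0 = 0"
  using hom_add[of 0 0] by simp

lemma hom_minus: "\<phi> (- a) = - \<phi> a"
  using hom_add[of a "- a"] by (simp add: hom_zero eq_neg_iff_add_eq_0 add.commute)

lemma hom_diff: "\<phi> (a - b) = \<phi> a - \<phi> b"
  using hom_add[of a "- b"] by (simp add: hom_minus)

lemma hom_sum: "\<phi> (sum f S) = (\<Sum>s\<in>S. \<phi> (f s))"
  by (induction S rule: infinite_finite_induct) (simp_all add: hom_zero hom_add)

lemma map_matrix_mult: "map_matrix \<phi> (A ** B) = map_matrix \<phi> A ** map_matrix \<phi> B"
  by (simp add: vec_eq_iff matrix_matrix_mult_def hom_sum hom_mult)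

lift_definition scale :: "'k \<Rightarrow> ('i, 'a) row_finite_matrix \<Rightarrow> ('i, 'a) row_finite_matrix"
  is "\<lambda>c X f g. \<phi> c * X f g"
proof -
  fix c and X :: "'i \<Rightarrow> 'i \<Rightarrow> 'a" and f
  assume "\<And>f. finite {g. X f g \<noteq> 0}"
  then show "finite {g. \<phi> c * X f g \<noteq> 0}"
    by (rule_tac finite_subset[of _ "{g. X f g \<noteq> 0}"]) auto
qed

lemma algebra_scale: "algebra_over_field (scale :: 'k \<Rightarrow> ('i, 'a) row_finite_matrix \<Rightarrow> _)"
proof
  fix a b and X Y :: "('i, 'a) row_finite_matrix"
  show "scale a (X + Y) = scale a X + scale a Y"
    by (rule row_finite_eqI) (simp add: scale.rep_eq distrib_left)
  show "scale (a + b) X = scale a X + scale b X"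
    by (rule row_finite_eqI) (simp add: scale.rep_eq hom_add distrib_right)
  show "scale a (scale b X) = scale (a * b) X"
    by (rule row_finite_eqI) (simp add: scale.rep_eq hom_mult mult.assoc)
  show "scale 1 X = X"
    by (rule row_finite_eqI) (simp add: scale.rep_eq hom_one)
  show "scale a X * Y = scale a (X * Y)"
  proof (rule row_finite_eqI)
    fix f g
    have "entry (scale a X * Y) f g = (\<Sum>h | entry X f h \<noteq> 0. entry (scale a X) f h * entry Y h g)"
      by (rule entry_mult_sum) (auto simp: finite_row scale.rep_eq)
    then show "entry (scale a X * Y) f g = entry (scale a (X * Y)) f g"
      by (simp add: scale.rep_eq times_row_finite_matrix.rep_eq sum_distrib_left mult.assoc)
  qed
  have "x * (\<phi> a * y) = \<phi> a * (x * y)" for x y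
    by (metis central mult.assoc)
  then show "X * scale a Y = scale a (X * Y)"
    by (intro row_finite_eqI) (simp add: scale.rep_eq times_row_finite_matrix.rep_eq sum_distrib_left)
qed

end

lift_definition lift_tens :: "nat \<Rightarrow> nat \<Rightarrow> ('n::finite, 'a::zero) tens_mat \<Rightarrow> (nat \<Rightarrow> 'n, 'a) row_finite_matrix"
  is "\<lambda>s m A f g. if agree_off {s..<s + m} f g then A (map f [s..<s + m]) (map g [s..<s + m]) else 0"
  by (rule finite_entry_if) simp

definition override :: "nat \<Rightarrow> (nat \<Rightarrow> 'n) \<Rightarrow> 'n list \<Rightarrow> nat \<Rightarrow> 'n" where
  "override s f c = (\<lambda>t. if s \<le> t \<and> t < s + length c then c ! (t - s) else f t)"

lemma map_override: "length c = m \<Longrightarrow> map (override s f c) [s..<s + m] = c"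
  by (rule nth_equalityI) (simp_all add: override_def)

lemma inj_on_override: "inj_on (override s f) {c. length c = m}"
proof (rule inj_onI)
  fix c d assume "c \<in> {c. length c = m}" "d \<in> {c. length c = m}"
    and eq: "override s f c = override s f d"
  then have c: "length c = m" and d: "length d = m" by auto
  have "c = map (override s f c) [s..<s + m]" by (rule map_override[OF c, symmetric])
  also have "\<dots> = d" unfolding eq by (rule map_override[OF d])
  finally show "c = d" .
qed

lemma agree_off_override: "length c = m \<Longrightarrow> agree_off {s..<s + m} f (override s f c)"
  by (auto simp: agree_off_def override_def)

lemma agree_off_override_range:
  assumes "agree_off {s..<s + m} f g"
  shows "g = override s f (map g [s..<s + m])"
  using assms by (auto simp: agree_off_def override_def fun_eq_iff)

lemma finite_lists_of_length: "finite {c :: 'n::finite list. length c = m}"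
  using finite_lists_length_eq[of "UNIV :: 'n set" m] by simp

lemma lift_tens_cong:
  "(\<And>a b. length a = m \<Longrightarrow> length b = m \<Longrightarrow> A a b = B a b) \<Longrightarrow> lift_tens s m A = lift_tens s m B"
  by (rule row_finite_eqI) (simp add: lift_tens.rep_eq)

lemma lift_tens_mult:
  fixes A B :: "('n::finite, 'a::ring_1) tens_mat"
  shows "lift_tens s m (tmult m A B) = lift_tens s m A * lift_tens s m B"
proof (rule row_finite_eqI)
  fix f g :: "nat \<Rightarrow> 'n"
  let ?L = "{c :: 'n list. length c = m}" and ?l = "\<lambda>f. map f [s..<s + m]"
  have "entry (lift_tens s m A * lift_tens s m B) f g
      = (\<Sum>h\<in>override s f ` ?L. entry (lift_tens s m A) f h * entry (lift_tens s m B) h g)"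
  proof (rule entry_mult_sum)
    fix h assume h: "h \<notin> override s f ` ?L"
    have "\<not> agree_off {s..<s + m} f h"
    proof
      assume "agree_off {s..<s + m} f h"
      from agree_off_override_range[OF this] have "h \<in> override s f ` ?L"
        by (intro image_eqI[of _ _ "?l h"]) simp_all
      with h show False ..
    qed
    then show "entry (lift_tens s m A) f h * entry (lift_tens s m B) h g = 0"
      by (simp add: lift_tens.rep_eq)
  qed (simp add: finite_lists_of_length)
  also have "\<dots> = (\<Sum>c\<in>?L. entry (lift_tens s m A) f (override s f c) * entry (lift_tens s m B) (override s f c) g)"
    by (rule sum.reindex_cong[OF inj_on_override]) auto
  also have "\<dots> = (\<Sum>c\<in>?L. if agree_off {s..<s + m} f g then A (?l f) c * B c (?l g) else 0)"
  proof (rule sum.cong[OF refl])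
    fix c :: "'n list" assume "c \<in> ?L"
    then have c: "length c = m" by simp
    have "agree_off {s..<s + m} (override s f c) g \<longleftrightarrow> agree_off {s..<s + m} f g"
      using agree_off_override[OF c, of s f] by (auto simp: agree_off_def)
    then show "entry (lift_tens s m A) f (override s f c) * entry (lift_tens s m B) (override s f c) g
        = (if agree_off {s..<s + m} f g then A (?l f) c * B c (?l g) else 0)"
      using c by (simp add: lift_tens.rep_eq agree_off_override map_override)
  qed
  also have "\<dots> = entry (lift_tens s m (tmult m A B)) f g"
    by (simp add: lift_tens.rep_eq tmult_def)
  finally show "entry (lift_tens s m (tmult m A B)) f g = entry (lift_tens s m A * lift_tens s m B) f g" ..
qed

lemma lift_tens_tid: "lift_tens s m (tid :: ('n::finite, 'a::ring_1) tens_mat) = 1"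
proof (rule row_finite_eqI)
  fix f g :: "nat \<Rightarrow> 'n"
  have "f = g" if "agree_off {s..<s + m} f g" "map f [s..<s + m] = map g [s..<s + m]"
    using that by (auto simp: agree_off_def fun_eq_iff)
  then show "entry (lift_tens s m (tid :: ('n, 'a) tens_mat)) f g = entry 1 f g"
    by (auto simp: lift_tens.rep_eq tid_def entry_one agree_off_def)
qed

lemma lift_tens_tprod:
  fixes As :: "('n::finite, 'a::ring_1) tens_mat list"
  shows "lift_tens s m (tprod m As) = prod_list (map (lift_tens s m) As)"
  by (induction As) (simp_all add: tprod_def lift_tens_tid lift_tens_mult)

lemma lift_tens_at_pos:
  assumes "t < m"
  shows "lift_tens s m (at_pos (Suc t) M) = pos (s + t) M"
proof (rule row_finite_eqI)
  fix f g :: "nat \<Rightarrow> 'a"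
  have "agree_off {s..<s + m} f g \<and> (\<forall>i<m. i \<noteq> t \<longrightarrow> f (s + i) = g (s + i))
      \<longleftrightarrow> agree_off {s + t} f g" (is "?l \<longleftrightarrow> ?r")
  proof
    assume l: ?l
    show ?r unfolding agree_off_def
    proof (intro allI impI)
      fix x assume x: "x \<notin> {s + t}"
      show "f x = g x"
      proof (cases "x \<in> {s..<s + m}")
        case True
        then have "x - s < m" "x - s \<noteq> t" using x by auto
        then have "f (s + (x - s)) = g (s + (x - s))" using l by blast
        then show ?thesis using True by simp
      qed (use l in \<open>auto simp: agree_off_def\<close>)
    qed
  qed (use assms in \<open>auto simp: agree_off_def\<close>)
  then show "entry (lift_tens s m (at_pos (Suc t) M)) f g = entry (pos (s + t) M) f g"
    using assms by (auto simp: lift_tens.rep_eq pos.rep_eq at_pos_def)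
qed

lemma lift_tens_at_pos2:
  assumes "Suc t < m"
  shows "lift_tens s m (at_pos2 (Suc t) M) = pos2 (s + t) M"
proof (rule row_finite_eqI)
  fix f g :: "nat \<Rightarrow> 'a"
  have "agree_off {s..<s + m} f g \<and> (\<forall>i<m. i \<noteq> t \<and> i \<noteq> Suc t \<longrightarrow> f (s + i) = g (s + i))
      \<longleftrightarrow> agree_off {s + t, Suc (s + t)} f g" (is "?l \<longleftrightarrow> ?r")
  proof
    assume l: ?l
    show ?r unfolding agree_off_def
    proof (intro allI impI)
      fix x assume x: "x \<notin> {s + t, Suc (s + t)}"
      show "f x = g x"
      proof (cases "x \<in> {s..<s + m}")
        case True
        then have "x - s < m" "x - s \<noteq> t \<and> x - s \<noteq> Suc t" using x by auto
        then have "f (s + (x - s)) = g (s + (x - s))" using l by blast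
        then show ?thesis using True by simp
      qed (use l in \<open>auto simp: agree_off_def\<close>)
    qed
  qed (use assms in \<open>auto simp: agree_off_def\<close>)
  then show "entry (lift_tens s m (at_pos2 (Suc t) M)) f g = entry (pos2 (s + t) M) f g"
    using assms by (auto simp: lift_tens.rep_eq pos2.rep_eq at_pos2_def)
qed

context central_hom
begin

lemma tmap_tmult: "tmap \<phi> (tmult m A B) = tmult m (tmap \<phi> A) (tmap \<phi> B)"
  by (simp add: tmap_def tmult_def hom_sum hom_mult)

lemma tmap_tid: "tmap \<phi> tid = tid"
  by (simp add: tmap_def tid_def fun_eq_iff hom_zero hom_one)

lemma tmap_tprod: "tmap \<phi> (tprod m As) = tprod m (map (tmap \<phi>) As)"
  by (induction As) (simp_all add: tprod_def tmap_tid tmap_tmult)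

lemma tmap_at_pos: "tmap \<phi> (at_pos s M) = at_pos s (map_matrix \<phi> M)"
  by (intro ext) (auto simp: tmap_def at_pos_def hom_zero)

lemma tmap_at_pos2: "tmap \<phi> (at_pos2 s M) = at_pos2 s (map_matrix \<phi> M)"
  by (intro ext) (auto simp: tmap_def at_pos2_def hom_zero)

lemma pos2_braid:
  fixes R :: "'k ^ ('n::finite \<times> 'n) ^ ('n \<times> 'n)"
  assumes "braiding R"
  defines "T \<equiv> \<lambda>s. pos2 s (map_matrix \<phi> R)"
  shows "T s * T (Suc s) * T s = T (Suc s) * T s * T (Suc s)"
proof -
  have "lift_tens s 3 (tmap \<phi> (tprod 3 [at_pos2 1 R, at_pos2 2 R, at_pos2 1 R]))
      = lift_tens s 3 (tmap \<phi> (tprod 3 [at_pos2 2 R, at_pos2 1 R, at_pos2 2 R]))"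
    by (rule lift_tens_cong) (use assms(1) in \<open>simp add: tmap_def braiding_def\<close>)
  then show ?thesis
    using lift_tens_at_pos2[of 0 3 s "map_matrix \<phi> R"] lift_tens_at_pos2[of 1 3 s "map_matrix \<phi> R"]
    unfolding tmap_tprod lift_tens_tprod T_def
    by (simp add: tmap_at_pos2 mult.assoc numeral_2_eq_2)
qed

end

section \<open>The trace of a skew-invertible Hecke symmetry\<close>

text \<open>
  The coefficients of the linear map that sends \<open>X\<close> to \<open>Tr_2 (C_2 R X_1 R')\<close>.
\<close>
definition conj_kernel where
  "conj_kernel C R R' a k b m =
     (\<Sum>i\<in>UNIV. \<Sum>j\<in>UNIV. \<Sum>l\<in>UNIV. C $ i $ j * R $ (a, j) $ (k, l) * R' $ (b, l) $ (m, i))"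

lemma sum_pair: "(\<Sum>p\<in>UNIV. F p) = (\<Sum>a\<in>UNIV. \<Sum>b\<in>UNIV. F (a, b))"
  for F :: "'a::finite \<times> 'b::finite \<Rightarrow> 'c::comm_monoid_add"
  by (simp add: sum.cartesian_product flip: UNIV_Times_UNIV)

lemma entry_partial_trace_conj:
  fixes R R' :: "'a::ring_1 ^ ('n::finite \<times> 'n) ^ ('n \<times> 'n)"
  assumes X: "X \<in> trivial_at (Suc s)" and fg: "f (Suc s) = g (Suc s)"
    and central: "\<And>p r x. R' $ p $ r * x = x * R' $ p $ r"
  shows "entry (partial_trace C (Suc s) (pos2 s R * X * pos2 s R')) f g
    = (\<Sum>k\<in>UNIV. \<Sum>b\<in>UNIV. conj_kernel C R R' (f s) k b (g s) * entry X (f(s := k)) (g(s := b)))"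
proof -
  let ?X = "\<lambda>k b. entry X (f(s := k)) (g(s := b))"
  have upd: "upd2 s (f(Suc s := x)) p = upd2 s f p" for f :: "nat \<Rightarrow> 'n" and x p
    by (auto simp: upd2_def)
  have inner: "entry (pos2 s R * X * pos2 s R') (f(Suc s := j)) (g(Suc s := i))
      = (\<Sum>b\<in>UNIV. \<Sum>l\<in>UNIV. \<Sum>k\<in>UNIV. R $ (f s, j) $ (k, l) * ?X k b * R' $ (b, l) $ (g s, i))" for i j
  proof -
    have "entry (pos2 s R * X * pos2 s R') (f(Suc s := j)) (g(Suc s := i))
        = (\<Sum>r\<in>UNIV. (\<Sum>p\<in>UNIV. R $ (f s, j) $ p * entry X (upd2 s f p) (upd2 s g r)) * R' $ r $ (g s, i))"
      by (simp add: entry_mult_pos2 entry_pos2_mult upd)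
    also have "\<dots> = (\<Sum>r\<in>UNIV. (\<Sum>k\<in>UNIV. R $ (f s, j) $ (k, snd r) * ?X k (fst r)) * R' $ r $ (g s, i))"
    proof (intro sum.cong refl arg_cong2[of _ _ _ _ "(*)"])
      fix r :: "'n \<times> 'n"
      have "(\<Sum>p\<in>UNIV. R $ (f s, j) $ p * entry X (upd2 s f p) (upd2 s g r))
          = (\<Sum>k\<in>UNIV. \<Sum>l\<in>UNIV. if l = snd r then R $ (f s, j) $ (k, l) * ?X k (fst r) else 0)"
        unfolding sum_pair entry_trivial_upd2[where s = s and f = f and g = g, OF X fg] by (intro sum.cong refl) auto
      then show "(\<Sum>p\<in>UNIV. R $ (f s, j) $ p * entry X (upd2 s f p) (upd2 s g r))
          = (\<Sum>k\<in>UNIV. R $ (f s, j) $ (k, snd r) * ?X k (fst r))"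
        by simp
    qed
    also have "\<dots> = (\<Sum>b\<in>UNIV. \<Sum>l\<in>UNIV. \<Sum>k\<in>UNIV. R $ (f s, j) $ (k, l) * ?X k b * R' $ (b, l) $ (g s, i))"
      unfolding sum_pair by (simp add: sum_distrib_right)
    finally show ?thesis .
  qed
  let ?t = "\<lambda>i j b l k. C $ i $ j * R $ (f s, j) $ (k, l) * R' $ (b, l) $ (g s, i) * ?X k b"
  have "entry (partial_trace C (Suc s) (pos2 s R * X * pos2 s R')) f g
      = (\<Sum>i\<in>UNIV. \<Sum>j\<in>UNIV. \<Sum>b\<in>UNIV. \<Sum>l\<in>UNIV. \<Sum>k\<in>UNIV. ?t i j b l k)"
    using fg unfolding partial_trace.rep_eq inner
    by (simp add: sum_distrib_left mult.assoc central[of _ _ "?X _ _"])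
  also have "\<dots> = (\<Sum>i\<in>UNIV. \<Sum>j\<in>UNIV. \<Sum>l\<in>UNIV. \<Sum>k\<in>UNIV. \<Sum>b\<in>UNIV. ?t i j b l k)"
    by (rule sum.cong[OF refl], rule sum.cong[OF refl], subst sum.swap, rule sum.cong[OF refl],
        rule sum.swap)
  also have "\<dots> = (\<Sum>k\<in>UNIV. \<Sum>b\<in>UNIV. \<Sum>i\<in>UNIV. \<Sum>j\<in>UNIV. \<Sum>l\<in>UNIV. ?t i j b l k)"
  proof -
    have rot: "(\<Sum>i\<in>UNIV. \<Sum>j\<in>UNIV. \<Sum>l\<in>UNIV. \<Sum>k\<in>UNIV. F i j l k)
        = (\<Sum>k\<in>UNIV. \<Sum>i\<in>UNIV. \<Sum>j\<in>UNIV. \<Sum>l\<in>UNIV. F i j l k)" for F :: "'n \<Rightarrow> 'n \<Rightarrow> 'n \<Rightarrow> 'n \<Rightarrow> 'a"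
    proof -
      have "(\<Sum>i\<in>UNIV. \<Sum>j\<in>UNIV. \<Sum>l\<in>UNIV. \<Sum>k\<in>UNIV. F i j l k)
          = (\<Sum>i\<in>UNIV. \<Sum>j\<in>UNIV. \<Sum>k\<in>UNIV. \<Sum>l\<in>UNIV. F i j l k)"
        by (intro sum.cong refl sum.swap)
      also have "\<dots> = (\<Sum>i\<in>UNIV. \<Sum>k\<in>UNIV. \<Sum>j\<in>UNIV. \<Sum>l\<in>UNIV. F i j l k)"
        by (intro sum.cong refl sum.swap)
      also have "\<dots> = (\<Sum>k\<in>UNIV. \<Sum>i\<in>UNIV. \<Sum>j\<in>UNIV. \<Sum>l\<in>UNIV. F i j l k)"
        by (rule sum.swap)
      finally show ?thesis .
    qed
    show ?thesis
      by (rule trans[OF rot], rule sum.cong[OF refl], rule rot)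
  qed
  also have "\<dots> = (\<Sum>k\<in>UNIV. \<Sum>b\<in>UNIV. conj_kernel C R R' (f s) k b (g s) * ?X k b)"
    by (simp add: conj_kernel_def sum_distrib_right)
  finally show ?thesis .
qed

text \<open>
  The operator \<open>C_1C_2\<close>.
\<close>
definition twofold :: "'a::times ^ 'n ^ 'n \<Rightarrow> 'a ^ ('n \<times> 'n) ^ ('n \<times> 'n)" where
  "twofold C = (\<chi> p r. C $ fst p $ fst r * C $ snd p $ snd r)"

lemma partial_trace_cyclic:
  fixes R :: "'a::ring_1 ^ ('n::finite \<times> 'n) ^ ('n \<times> 'n)"
  assumes com: "twofold C ** R = R ** twofold C"
    and centralR: "\<And>p r x. R $ p $ r * x = x * R $ p $ r"
    and centralC: "\<And>i j x. C $ i $ j * x = x * C $ i $ j"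
  shows "partial_trace C s (partial_trace C (Suc s) (pos2 s R * X))
    = partial_trace C s (partial_trace C (Suc s) (X * pos2 s R))"
proof (rule row_finite_eqI)
  fix f g :: "nat \<Rightarrow> 'n"
  have two: "entry (partial_trace C s (partial_trace C (Suc s) Y)) f g
      = (\<Sum>p\<in>UNIV. \<Sum>r\<in>UNIV. twofold C $ p $ r * entry Y (upd2 s f r) (upd2 s g p))"
    if fg: "f s = g s" "f (Suc s) = g (Suc s)" for Y :: "(nat \<Rightarrow> 'n, 'a) row_finite_matrix"
  proof -
    have "entry (partial_trace C s (partial_trace C (Suc s) Y)) f g
        = (\<Sum>i\<in>UNIV. \<Sum>j\<in>UNIV. \<Sum>i'\<in>UNIV. \<Sum>j'\<in>UNIV.
             C $ i $ j * C $ i' $ j' * entry Y (upd2 s f (j, j')) (upd2 s g (i, i')))"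
      using fg by (simp add: partial_trace.rep_eq sum_distrib_left upd2_def mult.assoc)
    also have "\<dots> = (\<Sum>i\<in>UNIV. \<Sum>i'\<in>UNIV. \<Sum>j\<in>UNIV. \<Sum>j'\<in>UNIV.
             C $ i $ j * C $ i' $ j' * entry Y (upd2 s f (j, j')) (upd2 s g (i, i')))"
      by (intro sum.cong refl sum.swap)
    finally show ?thesis by (simp add: sum_pair twofold_def)
  qed
  have zero: "entry (partial_trace C s (partial_trace C (Suc s) Y)) f g = 0"
    if "\<not> (f s = g s \<and> f (Suc s) = g (Suc s))" for Y :: "(nat \<Rightarrow> 'n, 'a) row_finite_matrix"
    using that by (auto simp: partial_trace.rep_eq)
  have cc: "twofold C $ p $ r * x = x * twofold C $ p $ r" for p r x
    unfolding twofold_def by (simp add: mult.assoc) (metis centralC mult.assoc)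
  have upd: "upd2 s (upd2 s h p) r = upd2 s h r" for h :: "nat \<Rightarrow> 'n" and p r
    by (auto simp: upd2_def)
  show "entry (partial_trace C s (partial_trace C (Suc s) (pos2 s R * X))) f g
      = entry (partial_trace C s (partial_trace C (Suc s) (X * pos2 s R))) f g"
  proof (cases "f s = g s \<and> f (Suc s) = g (Suc s)")
    case True
    then have fg: "f s = g s" "f (Suc s) = g (Suc s)" by auto
    let ?X = "\<lambda>u p. entry X (upd2 s f u) (upd2 s g p)"
    let ?t = "\<lambda>p r u. R $ p $ r * twofold C $ r $ u * ?X u p"
    have "entry (partial_trace C s (partial_trace C (Suc s) (pos2 s R * X))) f g
        = (\<Sum>p\<in>UNIV. \<Sum>r\<in>UNIV. \<Sum>u\<in>UNIV. twofold C $ p $ r * R $ r $ u * ?X u p)"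
      unfolding two[OF fg] by (simp add: entry_pos2_mult upd sum_distrib_left mult.assoc)
    also have "\<dots> = (\<Sum>p\<in>UNIV. \<Sum>u\<in>UNIV. (twofold C ** R) $ p $ u * ?X u p)"
      by (rule sum.cong[OF refl], subst sum.swap) (simp add: matrix_matrix_mult_def sum_distrib_right)
    also have "\<dots> = (\<Sum>p\<in>UNIV. \<Sum>u\<in>UNIV. \<Sum>r\<in>UNIV. ?t p r u)"
      unfolding com by (simp add: matrix_matrix_mult_def sum_distrib_right)
    also have "\<dots> = (\<Sum>p\<in>UNIV. \<Sum>r\<in>UNIV. \<Sum>u\<in>UNIV. ?t p r u)"
      by (rule sum.cong[OF refl], rule sum.swap)
    also have "\<dots> = (\<Sum>r\<in>UNIV. \<Sum>p\<in>UNIV. \<Sum>u\<in>UNIV. ?t p r u)"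
      by (rule sum.swap)
    also have "\<dots> = (\<Sum>r\<in>UNIV. \<Sum>u\<in>UNIV. \<Sum>p\<in>UNIV. ?t p r u)"
      by (rule sum.cong[OF refl], rule sum.swap)
    also have "\<dots> = (\<Sum>r\<in>UNIV. \<Sum>u\<in>UNIV. twofold C $ r $ u * (\<Sum>p\<in>UNIV. ?X u p * R $ p $ r))"
    proof -
      have "R $ p $ r * twofold C $ r $ u * x = twofold C $ r $ u * (x * R $ p $ r)" for p r u x
        by (metis cc centralR mult.assoc)
      then show ?thesis by (simp add: sum_distrib_left)
    qed
    also have "\<dots> = entry (partial_trace C s (partial_trace C (Suc s) (X * pos2 s R))) f g"
      unfolding two[OF fg] by (simp add: entry_mult_pos2 upd)
    finally show ?thesis .
  next
    case False
    show ?thesis using zero[OF False] by simp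
  qed
qed

lemma q_numbers_nonzero_hecke:
  assumes "hecke_symmetry q R" "generic q"
  shows "q_numbers_nonzero q"
proof -
  have q: "q \<noteq> 0" "q\<^sup>2 \<noteq> 1" using assms unfolding hecke_symmetry_def by auto
  have "q - inverse q \<noteq> 0"
    using q by (auto simp: power2_eq_square field_simps)
  moreover have "qnum q n \<noteq> 0" if "n \<ge> 1" for n
  proof
    assume "qnum q n = 0"
    then have "q ^ n = inverse q ^ n"
      using \<open>q - inverse q \<noteq> 0\<close> by (simp add: qnum_def)
    then have "q ^ n * q ^ n = q ^ n * inverse (q ^ n)"
      unfolding power_inverse by (rule arg_cong)
    moreover have "q ^ n * inverse (q ^ n) = 1" using q by (intro right_inverse) simp
    ultimately have "q ^ n * q ^ n = 1" by (rule trans)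
    then have "q powi int (n + n) = 1"
      by (simp only: power_int_of_nat power_add)
    moreover have "int (n + n) \<noteq> 0" using that by simp
    ultimately show False using assms(2) unfolding generic_def by blast
  qed
  ultimately show ?thesis using q by (simp add: q_numbers_nonzero_def)
qed

definition hecke_inverse :: "'k::field \<Rightarrow> 'k ^ ('n::finite \<times> 'n) ^ ('n \<times> 'n) \<Rightarrow> 'k ^ ('n \<times> 'n) ^ ('n \<times> 'n)" where
  "hecke_inverse q R = R - mat (q - inverse q)"

lemma mat_mult_nth: "(mat c ** M) $ a $ b = c * M $ a $ b" "(M ** mat c) $ a $ b = M $ a $ b * c"
  for M :: "'a::semiring_1 ^ 'n::finite ^ 'n"
  by (simp_all add: matrix_matrix_mult_def mat_def if_distrib[of "\<lambda>x. x * _"] if_distrib[of "\<lambda>x. _ * x"]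
      cong: if_cong)

lemma hecke_quadratic:
  assumes "hecke_symmetry q R"
  shows "(R ** R) $ a $ b = (if a = b then 1 else 0) + (q - inverse q) * R $ a $ b"
proof -
  have q: "q \<noteq> 0" and H: "(mat q - R) ** (mat (inverse q) + R) = 0"
    using assms unfolding hecke_symmetry_def by auto
  have "((mat q - R) ** (mat (inverse q) + R)) $ a $ b
      = (mat q ** (mat (inverse q) + R)) $ a $ b - (R ** (mat (inverse q) + R)) $ a $ b"
    by (simp add: matrix_matrix_mult_def left_diff_distrib sum_subtractf)
  also have "\<dots> = q * (mat (inverse q) + R) $ a $ b - ((R ** mat (inverse q)) $ a $ b + (R ** R) $ a $ b)"
    unfolding matrix_add_ldistrib[of R] by (simp add: mat_mult_nth)
  also have "\<dots> = (if a = b then 1 else 0) + (q - inverse q) * R $ a $ b - (R ** R) $ a $ b"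
    unfolding mat_mult_nth using q by (simp add: mat_def algebra_simps)
  finally show ?thesis using H by simp
qed

lemma hecke_inverse_mult:
  assumes "hecke_symmetry q R"
  shows "R ** hecke_inverse q R = mat 1" "hecke_inverse q R ** R = mat 1"
proof -
  have "(R ** (R - mat c)) $ a $ b = (R ** R) $ a $ b - (R ** mat c) $ a $ b"
    and "((R - mat c) ** R) $ a $ b = (R ** R) $ a $ b - (mat c ** R) $ a $ b" for a b c
    by (simp_all add: matrix_matrix_mult_def left_diff_distrib right_diff_distrib sum_subtractf)
  then have "(R ** hecke_inverse q R) $ a $ b = mat 1 $ a $ b"
    and "(hecke_inverse q R ** R) $ a $ b = mat 1 $ a $ b" for a b
    unfolding hecke_inverse_def by (simp_all only: mat_mult_nth hecke_quadratic[OF assms])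
      (simp_all add: mat_def)
  then show "R ** hecke_inverse q R = mat 1" "hecke_inverse q R ** R = mat 1"
    by (simp_all add: vec_eq_iff)
qed

lemma matrix_inv_hecke:
  assumes "hecke_symmetry q R"
  shows "matrix_inv R = hecke_inverse q R"
proof -
  have "R ** matrix_inv R = mat 1 \<and> matrix_inv R ** R = mat 1"
    unfolding matrix_inv_def by (rule someI[of _ "hecke_inverse q R"]) (simp add: hecke_inverse_mult[OF assms])
  then show ?thesis
    using hecke_inverse_mult[OF assms] by (metis matrix_mul_assoc matrix_mul_lid matrix_mul_rid)
qed

text \<open>
  After a permutation of the indices the definition says that \<open>\<Psi>\<close> is a right inverse of \<open>R\<close>; for square
  matrices it is then a left inverse. This gives the contraction over the other pair of indices.
\<close>
lemma skew_inverse_left: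
  assumes "is_skew_inverse R \<Psi>"
  shows "(\<Sum>x\<in>UNIV. \<Sum>y\<in>UNIV. \<Psi> $ (l, y) $ (j, x) * R $ (x, a) $ (y, c)) = (if j = a \<and> l = c then 1 else 0)"
proof -
  define A where "A = (\<chi> p r. R $ (fst p, fst r) $ (snd p, snd r))"
  define B where "B = (\<chi> p r. \<Psi> $ (snd p, snd r) $ (fst p, fst r))"
  have "A ** B = mat 1"
    using assms unfolding is_skew_inverse_def
    by (auto simp: vec_eq_iff matrix_matrix_mult_def A_def B_def sum_pair mat_def)
  then have "B ** A = mat 1" by (simp add: matrix_left_right_inverse)
  then have "(B ** A) $ (j, l) $ (a, c) = (if j = a \<and> l = c then 1 else 0)"
    by (simp add: mat_def)
  then show ?thesis
    by (simp add: matrix_matrix_mult_def A_def B_def sum_pair)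
qed

lemma skew_inverse_contract:
  assumes S: "is_skew_inverse R \<Psi>"
  shows "(\<Sum>x\<in>UNIV. \<Sum>y\<in>UNIV. \<Psi> $ (l', y) $ (j', x) *
      (\<Sum>j\<in>UNIV. \<Sum>l\<in>UNIV. Z j l * R $ (x, j) $ (y, l))) = Z j' l'"
proof -
  let ?t = "\<lambda>x y j l. Z j l * (\<Psi> $ (l', y) $ (j', x) * R $ (x, j) $ (y, l))"
  have "(\<Sum>x\<in>UNIV. \<Sum>y\<in>UNIV. \<Psi> $ (l', y) $ (j', x) *
      (\<Sum>j\<in>UNIV. \<Sum>l\<in>UNIV. Z j l * R $ (x, j) $ (y, l)))
      = (\<Sum>u\<in>UNIV. \<Sum>v\<in>UNIV. ?t (fst u) (snd u) (fst v) (snd v))"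
    by (simp add: sum_pair sum_distrib_left algebra_simps)
  also have "\<dots> = (\<Sum>v\<in>UNIV. \<Sum>u\<in>UNIV. ?t (fst u) (snd u) (fst v) (snd v))"
    by (rule sum.swap)
  also have "\<dots> = (\<Sum>j\<in>UNIV. \<Sum>l\<in>UNIV. Z j l * (if j' = j \<and> l' = l then 1 else 0))"
    unfolding sum_pair by (simp only: fst_conv snd_conv sum_distrib_left[symmetric] skew_inverse_left[OF S])
  also have "\<dots> = (\<Sum>j\<in>UNIV. if j' = j then (\<Sum>l\<in>UNIV. if l' = l then Z j l else 0) else 0)"
    by (intro sum.cong refl) (auto simp: if_distrib[of "\<lambda>x. _ * x"] cong: if_cong)
  also have "\<dots> = Z j' l'" by simp
  finally show ?thesis .
qed

text \<open>
  The coefficients of \<open>R\<close> in one tensor factor span all matrices there. Hence linear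
  functionals on matrices can be compared on them.
\<close>
lemma skew_invertible_cancel:
  fixes R :: "'k::field ^ ('n::finite \<times> 'n) ^ ('n \<times> 'n)"
  assumes "is_skew_inverse R \<Psi>"
    and "\<And>x y. (\<Sum>k\<in>UNIV. \<Sum>b\<in>UNIV. F k b * R $ (x, k) $ (y, b))
      = (\<Sum>k\<in>UNIV. \<Sum>b\<in>UNIV. G k b * R $ (x, k) $ (y, b))"
  shows "F k b = G k b"
  using skew_inverse_contract[OF assms(1), of b k F] skew_inverse_contract[OF assms(1), of b k G]
  unfolding assms(2) by simp

text \<open>
  Tracing the defining equation of \<open>\<Psi>\<close> over the third factor gives \<open>Tr_2 (C_2 R) = 1\<close>.
\<close>
lemma C_mat_trace:
  assumes "is_skew_inverse R \<Psi>"
  shows "(\<Sum>i\<in>UNIV. \<Sum>j\<in>UNIV. C_mat \<Psi> $ i $ j * R $ (a, j) $ (b, i)) = (if a = b then 1 else 0)"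
proof -
  let ?t = "\<lambda>i j k. R $ (a, j) $ (b, i) * \<Psi> $ (i, k) $ (j, k)"
  have "(\<Sum>i\<in>UNIV. \<Sum>j\<in>UNIV. C_mat \<Psi> $ i $ j * R $ (a, j) $ (b, i))
      = (\<Sum>j\<in>UNIV. \<Sum>i\<in>UNIV. \<Sum>k\<in>UNIV. ?t i j k)"
    by (subst sum.swap) (simp add: C_mat_def sum_distrib_left mult.commute)
  also have "\<dots> = (\<Sum>j\<in>UNIV. \<Sum>k\<in>UNIV. \<Sum>i\<in>UNIV. ?t i j k)"
    by (rule sum.cong[OF refl], rule sum.swap)
  also have "\<dots> = (\<Sum>k\<in>UNIV. \<Sum>j\<in>UNIV. \<Sum>i\<in>UNIV. ?t i j k)"
    by (rule sum.swap)
  also have "\<dots> = (\<Sum>k\<in>UNIV. if a = k \<and> k = b then 1 else 0)"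
    using assms unfolding is_skew_inverse_def by simp
  also have "\<dots> = (\<Sum>k\<in>UNIV. if a = k then (if a = b then 1 else 0) else 0)"
    by (intro sum.cong) auto
  finally show ?thesis by simp
qed

lemma pos2_mat_one: "pos2 s (mat 1 :: 'a::ring_1 ^ ('n::finite \<times> 'n) ^ ('n \<times> 'n)) = 1"
proof (rule row_finite_eqI)
  fix f g :: "nat \<Rightarrow> 'n"
  note agree_off_eq_iff(2)[of s f g]
  then show "entry (pos2 s (mat 1 :: 'a ^ ('n \<times> 'n) ^ ('n \<times> 'n))) f g = entry 1 f g"
    by (auto simp: pos2.rep_eq mat_def entry_one)
qed

text \<open>
  By the braid relation \<open>R_23 R_12 R_23^(-1) = R_12^(-1) R_23 R_12\<close>. On the right-hand side the trace over the third
  factor only meets \<open>R_23\<close> and gives \<open>R_12^(-1) R_12 = 1\<close>. So the map \<open>X \<mapsto> Tr_2 (C_2 R X_1 R^(-1))\<close> takes the coefficients of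
  \<open>R_12\<close> in the second factor to the same values as \<open>X \<mapsto> Tr (C X)\<close>, and these coefficients span all
  matrices. The same works with \<open>R\<close> and \<open>R^(-1)\<close> exchanged.
\<close>
lemma conj_kernel_hecke:
  fixes R :: "'k::field ^ ('n::finite \<times> 'n) ^ ('n \<times> 'n)"
  assumes H: "hecke_symmetry q R" and S: "is_skew_inverse R \<Psi>"
  shows "conj_kernel (C_mat \<Psi>) R (hecke_inverse q R) a k b m = (if a = m then C_mat \<Psi> $ b $ k else 0)"
    and "conj_kernel (C_mat \<Psi>) (hecke_inverse q R) R a k b m = (if a = m then C_mat \<Psi> $ b $ k else 0)"
proof -
  interpret central_hom "\<lambda>x :: 'k. x" by unfold_locales simp_all
  have id: "map_matrix (\<lambda>x. x) R = R" by (simp add: vec_eq_iff)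
  let ?T = "\<lambda>s. pos2 s R" and ?Ti = "\<lambda>s. pos2 s (hecke_inverse q R)" and ?C = "C_mat \<Psi>"
  have inv: "?T s * ?Ti s = 1" "?Ti s * ?T s = 1" for s
    by (simp_all add: pos2_mult[symmetric] hecke_inverse_mult[OF H] pos2_mat_one)
  have br: "?T 0 * ?T 1 * ?T 0 = ?T 1 * ?T 0 * ?T 1"
    using pos2_braid[of R 0] H unfolding hecke_symmetry_def id by simp
  have tr: "partial_trace ?C 2 (?T 1) = 1"
    using partial_trace_pos2[of ?C R 1] C_mat_trace[OF S] by (simp add: numeral_2_eq_2)
  have triv: "?T 0 \<in> trivial_at 2" "?Ti 0 \<in> trivial_at 2" by (simp_all add: trivial_at_pos2)
  have "?Ti 0 * ?T 1 * ?T 0 = ?Ti 0 * (?T 1 * ?T 0 * ?T 1) * ?Ti 1"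
    by (simp add: mult.assoc inv)
  also have "\<dots> = ?Ti 0 * (?T 0 * ?T 1 * ?T 0) * ?Ti 1" unfolding br ..
  also have "\<dots> = (?Ti 0 * ?T 0) * (?T 1 * ?T 0 * ?Ti 1)" by (simp only: mult.assoc)
  finally have c1: "?T 1 * ?T 0 * ?Ti 1 = ?Ti 0 * ?T 1 * ?T 0" by (simp add: inv)
  have "?T 0 * ?T 1 * ?Ti 0 = ?Ti 1 * (?T 1 * ?T 0 * ?T 1) * ?Ti 0"
    by (simp add: inv flip: mult.assoc)
  also have "\<dots> = ?Ti 1 * (?T 0 * ?T 1 * ?T 0) * ?Ti 0" unfolding br ..
  also have "\<dots> = (?Ti 1 * ?T 0 * ?T 1) * (?T 0 * ?Ti 0)" by (simp only: mult.assoc)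
  finally have c2: "?Ti 1 * ?T 0 * ?T 1 = ?T 0 * ?T 1 * ?Ti 0" by (simp add: inv)
  have p1: "partial_trace ?C 2 (?T 1 * ?T 0 * ?Ti 1) = 1"
    unfolding c1 partial_trace_mult_right[OF triv(1)]
      partial_trace_mult_left[OF triv(2) mult.commute] tr by (simp add: inv)
  have p2: "partial_trace ?C 2 (?Ti 1 * ?T 0 * ?T 1) = 1"
    unfolding c2 partial_trace_mult_right[OF triv(2)]
      partial_trace_mult_left[OF triv(1) mult.commute] tr by (simp add: inv)
  have main: "conj_kernel ?C A B a k b m = (if a = m then ?C $ b $ k else 0)"
    if AB: "partial_trace ?C 2 (pos2 1 A * ?T 0 * pos2 1 B) = 1" for A B a k b m
  proof (rule skew_invertible_cancel[OF S, where F = "\<lambda>k b. conj_kernel ?C A B a k b m"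
        and G = "\<lambda>k b. if a = m then ?C $ b $ k else 0"])
    fix x y
    \<comment> \<open>row and column indices that read off the entries in positions 0 and 1\<close>
    define f g :: "nat \<Rightarrow> _" where "f = (\<lambda>_. a)(0 := x)" and "g = (\<lambda>_. a)(0 := y, 1 := m)"
    have f: "f 0 = x" "f 1 = a" "f 2 = a" "g 0 = y" "g 1 = m" "g 2 = a" by (simp_all add: f_def g_def)
    have "agree_off {0, 1} (f(1 := k)) (g(1 := b))" for k b
      by (auto simp: agree_off_def f_def g_def)
    then have ent: "entry (?T 0) (f(1 := k)) (g(1 := b)) = R $ (x, k) $ (y, b)" for k b
      by (simp add: pos2.rep_eq f_def g_def)
    have "f = g \<longleftrightarrow> x = y \<and> a = m"
    proof
      assume "f = g"
      then show "x = y \<and> a = m" using f by metis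
    qed (auto simp: f_def g_def)
    then have "(if x = y \<and> a = m then 1 else 0) = entry (partial_trace ?C (Suc 1) (pos2 1 A * ?T 0 * pos2 1 B)) f g"
      unfolding AB[unfolded numeral_2_eq_2, folded One_nat_def] by (simp add: entry_one)
    also have "\<dots> = (\<Sum>k\<in>UNIV. \<Sum>b\<in>UNIV. conj_kernel ?C A B (f 1) k b (g 1) * entry (?T 0) (f(1 := k)) (g(1 := b)))"
      using triv f by (intro entry_partial_trace_conj) (simp_all add: numeral_2_eq_2 mult.commute)
    finally have "(\<Sum>k\<in>UNIV. \<Sum>b\<in>UNIV. conj_kernel ?C A B a k b m * R $ (x, k) $ (y, b))
        = (if x = y \<and> a = m then 1 else 0)"
      unfolding ent f by simp
    also have "\<dots> = (if a = m then \<Sum>b\<in>UNIV. \<Sum>k\<in>UNIV. ?C $ b $ k * R $ (x, k) $ (y, b) else 0)"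
      by (simp add: C_mat_trace[OF S])
    also have "\<dots> = (\<Sum>b\<in>UNIV. \<Sum>k\<in>UNIV. (if a = m then ?C $ b $ k else 0) * R $ (x, k) $ (y, b))"
      by simp
    also have "\<dots> = (\<Sum>k\<in>UNIV. \<Sum>b\<in>UNIV. (if a = m then ?C $ b $ k else 0) * R $ (x, k) $ (y, b))"
      by (rule sum.swap)
    finally show "(\<Sum>k\<in>UNIV. \<Sum>b\<in>UNIV. conj_kernel ?C A B a k b m * R $ (x, k) $ (y, b))
        = (\<Sum>k\<in>UNIV. \<Sum>b\<in>UNIV. (if a = m then ?C $ b $ k else 0) * R $ (x, k) $ (y, b))" .
  qed
  show "conj_kernel ?C R (hecke_inverse q R) a k b m = (if a = m then ?C $ b $ k else 0)"
    by (rule main[OF p1])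
  show "conj_kernel ?C (hecke_inverse q R) R a k b m = (if a = m then ?C $ b $ k else 0)"
    by (rule main[OF p2])
qed

text \<open>
  Contracting the two identities of the previous lemma with \<open>\<Psi>\<close> yields \<open>R^(-1) C_2 = C_1 \<Psi>_21\<close> and
  \<open>C_2 R^(-1) = \<Psi>_21 C_1\<close>, whence \<open>C_1 C_2 R^(-1) = C_1 \<Psi>_21 C_1 = R^(-1) C_1 C_2\<close>.
\<close>
lemma twofold_C_commute:
  fixes R :: "'k::field ^ ('n::finite \<times> 'n) ^ ('n \<times> 'n)"
  assumes H: "hecke_symmetry q R" and S: "is_skew_inverse R \<Psi>"
  shows "twofold (C_mat \<Psi>) ** R = R ** twofold (C_mat \<Psi>)"
proof -
  let ?C = "C_mat \<Psi>" and ?Ri = "hecke_inverse q R"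
  have A: "(\<Sum>i\<in>UNIV. ?Ri $ (b, l) $ (m, i) * ?C $ i $ j) = (\<Sum>k\<in>UNIV. ?C $ b $ k * \<Psi> $ (l, k) $ (j, m))" for b l m j
  proof -
    let ?Z = "\<lambda>j l. \<Sum>i\<in>UNIV. ?Ri $ (b, l) $ (m, i) * ?C $ i $ j"
    have "conj_kernel ?C R ?Ri x y b m = (\<Sum>j\<in>UNIV. \<Sum>l\<in>UNIV. ?Z j l * R $ (x, j) $ (y, l))" for x y
    proof -
      have "conj_kernel ?C R ?Ri x y b m
          = (\<Sum>j\<in>UNIV. \<Sum>i\<in>UNIV. \<Sum>l\<in>UNIV. ?C $ i $ j * R $ (x, j) $ (y, l) * ?Ri $ (b, l) $ (m, i))"
        unfolding conj_kernel_def by (rule sum.swap)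
      also have "\<dots> = (\<Sum>j\<in>UNIV. \<Sum>l\<in>UNIV. \<Sum>i\<in>UNIV. ?C $ i $ j * R $ (x, j) $ (y, l) * ?Ri $ (b, l) $ (m, i))"
        by (rule sum.cong[OF refl], rule sum.swap)
      finally show ?thesis by (simp add: sum_distrib_left sum_distrib_right algebra_simps)
    qed
    then have "?Z j l = (\<Sum>x\<in>UNIV. \<Sum>y\<in>UNIV. \<Psi> $ (l, y) $ (j, x) * conj_kernel ?C R ?Ri x y b m)"
      using skew_inverse_contract[OF S, of l j ?Z] by simp
    also have "\<dots> = (\<Sum>x\<in>UNIV. if x = m then \<Sum>y\<in>UNIV. ?C $ b $ y * \<Psi> $ (l, y) $ (j, x) else 0)"
      unfolding conj_kernel_hecke[OF H S] by (intro sum.cong refl) (simp add: mult.commute)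
    finally show ?thesis by simp
  qed
  have B: "(\<Sum>i\<in>UNIV. ?C $ l $ i * ?Ri $ (a, i) $ (k, j)) = (\<Sum>b\<in>UNIV. \<Psi> $ (l, a) $ (j, b) * ?C $ b $ k)" for l a k j
  proof -
    let ?Z = "\<lambda>j l. \<Sum>i\<in>UNIV. ?C $ l $ i * ?Ri $ (a, i) $ (k, j)"
    have "conj_kernel ?C ?Ri R a k x y = (\<Sum>j\<in>UNIV. \<Sum>l\<in>UNIV. ?Z j l * R $ (x, j) $ (y, l))" for x y
    proof -
      have "conj_kernel ?C ?Ri R a k x y
          = (\<Sum>l\<in>UNIV. \<Sum>j\<in>UNIV. \<Sum>i\<in>UNIV. ?C $ l $ i * ?Ri $ (a, i) $ (k, j) * R $ (x, j) $ (y, l))"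
        unfolding conj_kernel_def by (rule sum.cong[OF refl], rule sum.swap)
      also have "\<dots> = (\<Sum>j\<in>UNIV. \<Sum>l\<in>UNIV. \<Sum>i\<in>UNIV. ?C $ l $ i * ?Ri $ (a, i) $ (k, j) * R $ (x, j) $ (y, l))"
        by (rule sum.swap)
      finally show ?thesis by (simp add: sum_distrib_right)
    qed
    then have "?Z j l = (\<Sum>x\<in>UNIV. \<Sum>y\<in>UNIV. \<Psi> $ (l, y) $ (j, x) * conj_kernel ?C ?Ri R a k x y)"
      using skew_inverse_contract[OF S, of l j ?Z] by simp
    also have "\<dots> = (\<Sum>x\<in>UNIV. \<Sum>y\<in>UNIV. if a = y then \<Psi> $ (l, y) $ (j, x) * ?C $ x $ k else 0)"
      unfolding conj_kernel_hecke[OF H S] by (intro sum.cong refl) simp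
    finally show ?thesis by simp
  qed
  have CRi: "twofold ?C ** ?Ri = ?Ri ** twofold ?C"
  proof -
    have "(twofold ?C ** ?Ri) $ (p, l) $ (k, j) = (?Ri ** twofold ?C) $ (p, l) $ (k, j)" for p l k j
    proof -
      have "(twofold ?C ** ?Ri) $ (p, l) $ (k, j)
          = (\<Sum>a\<in>UNIV. ?C $ p $ a * (\<Sum>i\<in>UNIV. ?C $ l $ i * ?Ri $ (a, i) $ (k, j)))"
        by (simp add: matrix_matrix_mult_def sum_pair twofold_def sum_distrib_left mult.assoc)
      also have "\<dots> = (\<Sum>b\<in>UNIV. \<Sum>a\<in>UNIV. ?C $ p $ a * \<Psi> $ (l, a) $ (j, b) * ?C $ b $ k)"
        unfolding B sum_distrib_left by (subst sum.swap) (simp add: mult.assoc)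
      also have "\<dots> = (\<Sum>b\<in>UNIV. (\<Sum>i\<in>UNIV. ?Ri $ (p, l) $ (b, i) * ?C $ i $ j) * ?C $ b $ k)"
        unfolding A by (simp add: sum_distrib_right)
      also have "\<dots> = (?Ri ** twofold ?C) $ (p, l) $ (k, j)"
        by (simp add: matrix_matrix_mult_def sum_pair twofold_def sum_distrib_left sum_distrib_right
            algebra_simps)
      finally show ?thesis .
    qed
    then show ?thesis by (simp add: vec_eq_iff)
  qed
  have "twofold ?C ** R = (R ** ?Ri) ** (twofold ?C ** R)"
    by (simp add: hecke_inverse_mult[OF H])
  also have "\<dots> = R ** (?Ri ** twofold ?C) ** R" by (simp add: matrix_mul_assoc)
  also have "\<dots> = R ** (twofold ?C ** ?Ri) ** R" unfolding CRi ..
  also have "\<dots> = R ** twofold ?C ** (?Ri ** R)" by (simp add: matrix_mul_assoc)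
  finally show ?thesis by (simp add: hecke_inverse_mult[OF H])
qed

definition ring_ideal :: "'a::ring_1 set \<Rightarrow> bool" where
  "ring_ideal I \<longleftrightarrow> 0 \<in> I \<and> (\<forall>x\<in>I. \<forall>y\<in>I. x + y \<in> I) \<and> (\<forall>x\<in>I. \<forall>z. z * x \<in> I \<and> x * z \<in> I)"

lemma ring_ideal_sum: "ring_ideal I \<Longrightarrow> (\<And>s. s \<in> S \<Longrightarrow> f s \<in> I) \<Longrightarrow> sum f S \<in> I"
  by (induction S rule: infinite_finite_induct) (auto simp: ring_ideal_def)

definition ideal_matrices :: "'a::zero set \<Rightarrow> ('i, 'a) row_finite_matrix set" where
  "ideal_matrices I = {X. \<forall>f g. entry X f g \<in> I}"

context central_hom
begin

lemma braided_trace_pos: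
  fixes R \<Psi> :: "'k ^ ('n::finite \<times> 'n) ^ ('n \<times> 'n)" and L :: "nat \<Rightarrow> 'a ^ 'n ^ 'n"
  defines "T \<equiv> \<lambda>s. pos2 s (map_matrix \<phi> R)"
  assumes H: "hecke_symmetry q R" and G: "generic q" and S: "is_skew_inverse R \<Psi>"
    and I: "ring_ideal I"
    and refl: "\<And>i d. d \<ge> 1 \<Longrightarrow>
      (T 0 - scale (q ^ d / qnum q d) 1) * pos 0 (L i) * T 0 * pos 0 (L (i + d))
      - pos 0 (L (i + d)) * T 0 * pos 0 (L i) * (T 0 - scale (q ^ d / qnum q d) 1) \<in> ideal_matrices I"
  shows "braided_trace scale q T (\<lambda>j. pos 0 (L j)) (ideal_matrices I)
    (partial_trace (map_matrix \<phi> (C_mat \<Psi>))) trivial_at"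
proof -
  interpret algebra_over_field "scale :: 'k \<Rightarrow> (nat \<Rightarrow> 'n, 'a) row_finite_matrix \<Rightarrow> _"
    by (rule algebra_scale)
  let ?C = "map_matrix \<phi> (C_mat \<Psi>)"
  have cR: "map_matrix \<phi> M $ p $ r * x = x * map_matrix \<phi> M $ p $ r" for M :: "'k ^ 'm ^ 'l" and p r x
    by (simp add: central)
  have quad: "T s * T s = 1 + scale (q - inverse q) (T s)" for s
  proof (rule row_finite_eqI)
    fix f g :: "nat \<Rightarrow> 'n"
    have "T s * T s = pos2 s (map_matrix \<phi> (R ** R))"
      unfolding T_def pos2_mult[symmetric] map_matrix_mult ..
    moreover note agree_off_eq_iff(2)[of s f g]
    ultimately show "entry (T s * T s) f g = entry (1 + scale (q - inverse q) (T s)) f g"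
      by (auto simp: T_def pos2.rep_eq scale.rep_eq entry_one hecke_quadratic[OF H] hom_add hom_mult hom_one hom_zero)
  qed
  have Ti: "T s - scale (q - inverse q) 1 = pos2 s (map_matrix \<phi> (hecke_inverse q R))" for s
  proof (rule row_finite_eqI)
    fix f g :: "nat \<Rightarrow> 'n"
    note agree_off_eq_iff(2)[of s f g]
    then show "entry (T s - scale (q - inverse q) 1) f g = entry (pos2 s (map_matrix \<phi> (hecke_inverse q R))) f g"
      by (auto simp: T_def pos2.rep_eq scale.rep_eq entry_one hecke_inverse_def mat_def hom_diff hom_zero)
  qed
  show ?thesis
  proof
    show "q_numbers_nonzero q" by (rule q_numbers_nonzero_hecke[OF H G])
    show "T s * T s = 1 + scale (q - inverse q) (T s)" for s by (rule quad)
    show "T s * T (Suc s) * T s = T (Suc s) * T s * T (Suc s)" for s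
      unfolding T_def by (rule pos2_braid) (use H in \<open>simp add: hecke_symmetry_def\<close>)
    show "T s * T t = T t * T s" if "s + 2 \<le> t" for s t
      unfolding T_def using that by (intro pos2_commute trivial_at_pos2 cR) auto
    show "T (Suc s) * pos 0 (L j) = pos 0 (L j) * T (Suc s)" for s j
      unfolding T_def by (intro pos2_commute trivial_at_pos cR) auto
    show "0 \<in> ideal_matrices I"
      using I by (simp add: ideal_matrices_def ring_ideal_def)
    show "x + y \<in> ideal_matrices I" if "x \<in> ideal_matrices I" "y \<in> ideal_matrices I"
      for x y :: "(nat \<Rightarrow> 'n, 'a) row_finite_matrix"
      using I that by (simp add: ideal_matrices_def ring_ideal_def)
    show "z * x \<in> ideal_matrices I" "x * z \<in> ideal_matrices I" if "x \<in> ideal_matrices I"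
      for x z :: "(nat \<Rightarrow> 'n, 'a) row_finite_matrix"
      using that I unfolding ideal_matrices_def mem_Collect_eq times_row_finite_matrix.rep_eq
      by (auto intro!: ring_ideal_sum[OF I] simp: ring_ideal_def)
    show "(T 0 - scale (q ^ d / qnum q d) 1) * pos 0 (L i) * T 0 * pos 0 (L (i + d))
      - pos 0 (L (i + d)) * T 0 * pos 0 (L i) * (T 0 - scale (q ^ d / qnum q d) 1) \<in> ideal_matrices I"
      if "d \<ge> 1" for d i by (rule refl[OF that])
    show "1 \<in> trivial_at s" for s by (rule trivial_at_one)
    show "x * y \<in> trivial_at s" if "x \<in> trivial_at s" "y \<in> trivial_at s"
      for x y :: "(nat \<Rightarrow> 'n, 'a) row_finite_matrix" and s by (rule trivial_at_mult[OF that])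
    show "x - y \<in> trivial_at s" if "x \<in> trivial_at s" "y \<in> trivial_at s"
      for x y :: "(nat \<Rightarrow> 'n, 'a) row_finite_matrix" and s by (rule trivial_at_diff[OF that])
    show "scale a x \<in> trivial_at s" if "x \<in> trivial_at s"
      for x :: "(nat \<Rightarrow> 'n, 'a) row_finite_matrix" and s a
      using that by (intro trivial_atI) (simp_all add: scale.rep_eq trivial_atD)
    show "T t \<in> trivial_at s" if "s \<noteq> t" "s \<noteq> Suc t" for s t
      unfolding T_def using that by (rule trivial_at_pos2)
    show "pos 0 (L j) \<in> trivial_at s" if "s \<noteq> 0" for s j
      using that by (rule trivial_at_pos)
    show "partial_trace ?C s x \<in> trivial_at s" for s x by (rule trivial_at_partial_trace_same)
    show "partial_trace ?C t x \<in> trivial_at s" if "x \<in> trivial_at s" for s t x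
      by (rule trivial_at_partial_trace[OF that])
    show "partial_trace ?C s (x - y) = partial_trace ?C s x - partial_trace ?C s y" for s x y
      by (rule partial_trace_diff)
    show "partial_trace ?C s (scale a x) = scale a (partial_trace ?C s x)" for s a x
    proof (rule row_finite_eqI)
      have "c * (\<phi> a * y) = \<phi> a * (c * y)" for c y by (metis central mult.assoc)
      then show "entry (partial_trace ?C s (scale a x)) f g = entry (scale a (partial_trace ?C s x)) f g" for f g
        by (simp add: partial_trace.rep_eq scale.rep_eq sum_distrib_left)
    qed
    show "partial_trace ?C s (x * y) = x * partial_trace ?C s y" if "x \<in> trivial_at s" for x s y
      by (rule partial_trace_mult_left[OF that cR])
    show "partial_trace ?C s (y * x) = partial_trace ?C s y * x" if "x \<in> trivial_at s" for x s y
      by (rule partial_trace_mult_right[OF that])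
    show "partial_trace ?C (Suc s) (T s) = 1" for s
      unfolding T_def
    proof (rule partial_trace_pos2)
      fix a b
      have "\<phi> (\<Sum>i\<in>UNIV. \<Sum>j\<in>UNIV. C_mat \<Psi> $ i $ j * R $ (a, j) $ (b, i)) = (if a = b then 1 else 0)"
        unfolding C_mat_trace[OF S] by (simp add: hom_one hom_zero)
      then show "(\<Sum>i\<in>UNIV. \<Sum>j\<in>UNIV. ?C $ i $ j * map_matrix \<phi> R $ (a, j) $ (b, i)) = (if a = b then 1 else 0)"
        by (simp add: hom_sum hom_mult)
    qed
    show "partial_trace ?C (Suc s) (T s * x * (T s - scale (q - inverse q) 1)) = partial_trace ?C s x"
      if x: "x \<in> trivial_at (Suc s)" for x s
    proof (rule row_finite_eqI)
      fix f g :: "nat \<Rightarrow> 'n"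
      let ?R = "map_matrix \<phi> R" and ?Ri = "map_matrix \<phi> (hecke_inverse q R)"
      have K: "conj_kernel ?C ?R ?Ri a k b m = (if a = m then ?C $ b $ k else 0)" for a k b m
      proof -
        have "conj_kernel ?C ?R ?Ri a k b m = \<phi> (conj_kernel (C_mat \<Psi>) R (hecke_inverse q R) a k b m)"
          by (simp add: conj_kernel_def hom_sum hom_mult)
        then show ?thesis unfolding conj_kernel_hecke[OF H S] by (simp add: hom_zero)
      qed
      show "entry (partial_trace ?C (Suc s) (T s * x * (T s - scale (q - inverse q) 1))) f g
          = entry (partial_trace ?C s x) f g"
      proof (cases "f (Suc s) = g (Suc s)")
        case True
        have "entry (partial_trace ?C (Suc s) (T s * x * (T s - scale (q - inverse q) 1))) f g
            = (\<Sum>k\<in>UNIV. \<Sum>b\<in>UNIV. (if f s = g s then ?C $ b $ k else 0) * entry x (f(s := k)) (g(s := b)))"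
          unfolding Ti unfolding T_def entry_partial_trace_conj[where f = f and g = g and s = s, OF x True cR] K ..
        also have "\<dots> = (\<Sum>b\<in>UNIV. \<Sum>k\<in>UNIV. (if f s = g s then ?C $ b $ k else 0) * entry x (f(s := k)) (g(s := b)))"
          by (rule sum.swap)
        also have "\<dots> = entry (partial_trace ?C s x) f g"
          by (simp add: partial_trace.rep_eq)
        finally show ?thesis .
      next
        case False
        then have "entry (partial_trace ?C s x) f g = 0"
          by (intro trivial_atD(1)[OF trivial_at_partial_trace[OF x]])
        then show ?thesis using False by (simp add: partial_trace.rep_eq)
      qed
    qed
    have two: "twofold ?C ** map_matrix \<phi> R = map_matrix \<phi> R ** twofold ?C"
    proof -
      have "twofold ?C = map_matrix \<phi> (twofold (C_mat \<Psi>))"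
        by (simp add: twofold_def vec_eq_iff hom_mult)
      then show ?thesis by (simp add: twofold_C_commute[OF H S] flip: map_matrix_mult)
    qed
    show "partial_trace ?C s (partial_trace ?C (Suc s) (T s * x))
        = partial_trace ?C s (partial_trace ?C (Suc s) (x * T s))" for s x
      unfolding T_def by (rule partial_trace_cyclic[OF two cR cR])
    show "partial_trace ?C s x \<in> ideal_matrices I" if "x \<in> ideal_matrices I" for x s
      using that I unfolding ideal_matrices_def mem_Collect_eq partial_trace.rep_eq
      by (auto intro!: ring_ideal_sum[OF I] simp: ring_ideal_def)
  qed
qed

end

section \<open>The exchange relation in the braided Yangian\<close>
lemma two_sided_ideal_add: "y \<in> two_sided_ideal S \<Longrightarrow> x \<in> two_sided_ideal S \<Longrightarrow> x + y \<in> two_sided_ideal S"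
proof (induction rule: two_sided_ideal.induct)
  case (step y s c d)
  then show ?case using two_sided_ideal.step[of "x + y" S s c d] by (simp add: add.assoc)
qed simp

lemma two_sided_ideal_mult: "x \<in> two_sided_ideal S \<Longrightarrow> z * x * w \<in> two_sided_ideal S"
proof (induction rule: two_sided_ideal.induct)
  case (step x s c d)
  then show ?case using two_sided_ideal.step[of "z * x * w" S s "z * c" "d * w"]
    by (simp add: distrib_left distrib_right mult.assoc)
qed (simp add: two_sided_ideal.zero)

lemma ring_ideal_two_sided_ideal: "ring_ideal (two_sided_ideal S)"
  unfolding ring_ideal_def
  using two_sided_ideal_mult[of _ S 1] two_sided_ideal_mult[of _ S _ 1] two_sided_ideal_add
  by (auto intro: two_sided_ideal.zero)

lemma two_sided_ideal_generator: "s \<in> S \<Longrightarrow> s \<in> two_sided_ideal S"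
  using two_sided_ideal.step[OF two_sided_ideal.zero, of s S 1 1] by simp

lemma ring_ideal_mult_left: "ring_ideal I \<Longrightarrow> x \<in> I \<Longrightarrow> z * x \<in> I"
  by (simp add: ring_ideal_def)

lemma ring_ideal_diff: "ring_ideal I \<Longrightarrow> x \<in> I \<Longrightarrow> y \<in> I \<Longrightarrow> x - y \<in> I"
  using ring_ideal_mult_left[of I y "- 1"] unfolding ring_ideal_def
  by (metis add_uminus_conv_diff mult_minus1)

lemma ring_ideal_fps:
  fixes I :: "'a::ring_1 set"
  assumes "ring_ideal I"
  shows "ring_ideal {f :: 'a fps. \<forall>r. fps_nth f r \<in> I}"
  using assms unfolding ring_ideal_def
  by (auto simp: fps_mult_nth intro!: ring_ideal_sum[OF assms])

lemma poly_mapping_sum_single: "x = (\<Sum>w\<in>Poly_Mapping.keys x. Poly_Mapping.single w (Poly_Mapping.lookup x w))"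
  by (rule poly_mapping_eqI) (auto simp: lookup_sum lookup_single when_def in_keys_iff)

interpretation scal: central_hom "scal :: 'k::field \<Rightarrow> ('n, 'k) free_alg"
proof
  fix a b :: 'k and x :: "('n, 'k) free_alg"
  show "scal (a + b) = (scal a + scal b :: ('n, 'k) free_alg)" by (simp add: scal_def single_add)
  show "scal (a * b) = (scal a * scal b :: ('n, 'k) free_alg)" by (simp add: scal_def mult_single)
  show "scal 1 = (1 :: ('n, 'k) free_alg)" by (simp add: scal_def)
  show "scal a * x = x * scal a"
    by (subst (1 2) poly_mapping_sum_single[of x])
       (simp add: scal_def sum_distrib_left sum_distrib_right mult_single mult.commute)
qed

interpretation fscal: central_hom "fscal :: 'k::field \<Rightarrow> ('n, 'k) free_alg fps"
proof
  fix a b :: 'k and x :: "('n, 'k) free_alg fps"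
  show "fscal (a + b) = (fscal a + fscal b :: ('n, 'k) free_alg fps)"
    by (simp add: fscal_def scal.hom_add)
  show "fscal (a * b) = (fscal a * fscal b :: ('n, 'k) free_alg fps)"
    by (simp add: fscal_def scal.hom_mult)
  show "fscal 1 = (1 :: ('n, 'k) free_alg fps)" by (simp add: fscal_def scal.hom_one)
  show "fscal a * x = x * fscal a"
    by (rule fps_ext) (simp add: fscal_def scal.central)
qed

text \<open>
  \<open>P r s\<close> and \<open>Q r s\<close> are coefficients of \<open>u^(-r)v^(-s)\<close>, and the sum over \<open>i\<close> comes from the expansion of
  \<open>u / (u - v)\<close>. Putting \<open>u\<close> and \<open>v\<close> proportional to each other is not defined for
  series with infinitely many coefficients of a given total degree. Multiplication by \<open>1 - v / u\<close>, which is the difference \<open>D\<close>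
  of consecutive relations, makes them finite in number, and after the substitution this factor
  becomes, up to the factor \<open>y\<close>, the nonzero scalar \<open>y - x\<close>.
\<close>
lemma (in central_hom) specialize_parameters:
  fixes P Q :: "int \<Rightarrow> int \<Rightarrow> 'a"
  assumes I: "ring_ideal I"
    and neg: "\<And>r s. r < 0 \<or> s < 0 \<Longrightarrow> P r s = 0" "\<And>r s. r < 0 \<or> s < 0 \<Longrightarrow> Q r s = 0"
    and rel: "\<And>(r::nat) s. P (int r) s - \<phi> c * (\<Sum>i\<le>r. Q (int r - int i) (s + int i)) \<in> I"
    and xy: "x \<noteq> y"
  shows "(\<Sum>r\<le>n. \<phi> (x ^ r * y ^ (n - r)) *
      (P (int r) (int n - int r) - \<phi> (c * y / (y - x)) * Q (int r) (int n - int r))) \<in> I"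
proof -
  define D where "D r s = P r s - P (r - 1) (s + 1) - \<phi> c * Q r s" for r s
  have D: "D (int r) s \<in> I" for r :: nat and s
  proof (cases r)
    case 0
    then show ?thesis using rel[of 0 s] neg(1)[of "- 1"] by (simp add: D_def)
  next
    case (Suc m)
    have "(\<Sum>i\<le>Suc m. Q (int (Suc m) - int i) (s + int i))
        = Q (int (Suc m)) s + (\<Sum>i\<le>m. Q (int m - int i) (s + 1 + int i))"
      by (subst sum.atMost_Suc_shift) (simp add: add.assoc)
    then have "D (int r) s = (P (int (Suc m)) s - \<phi> c * (\<Sum>i\<le>Suc m. Q (int (Suc m) - int i) (s + int i)))
        - (P (int m) (s + 1) - \<phi> c * (\<Sum>i\<le>m. Q (int m - int i) (s + 1 + int i)))"
      by (simp add: D_def Suc distrib_left)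
    then show ?thesis using ring_ideal_diff[OF I rel[of "Suc m" s] rel[of m "s + 1"]] by simp
  qed
  let ?p = "\<lambda>r. P (int r) (int n - int r)" and ?q = "\<lambda>r. Q (int r) (int n - int r)"
  have wt: "y ^ (Suc n - r) = y * y ^ (n - r)" if "r \<le> n" for r
    using that by (simp add: Suc_diff_le)
  have "(\<Sum>r\<le>Suc n. \<phi> (x ^ r * y ^ (Suc n - r)) * D (int r) (int n - int r))
      = (\<Sum>r\<le>Suc n. \<phi> (x ^ r * y ^ (Suc n - r)) * (?p r - \<phi> c * ?q r))
        - (\<Sum>r\<le>Suc n. \<phi> (x ^ r * y ^ (Suc n - r)) * P (int r - 1) (int n - int r + 1))"
    unfolding sum_subtractf[symmetric] by (intro sum.cong refl) (simp add: D_def algebra_simps)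
  also have "(\<Sum>r\<le>Suc n. \<phi> (x ^ r * y ^ (Suc n - r)) * (?p r - \<phi> c * ?q r))
      = (\<Sum>r\<le>n. \<phi> (x ^ r * y ^ (Suc n - r)) * (?p r - \<phi> c * ?q r))"
    by (simp add: neg)
  also have "(\<Sum>r\<le>Suc n. \<phi> (x ^ r * y ^ (Suc n - r)) * P (int r - 1) (int n - int r + 1))
      = (\<Sum>r\<le>n. \<phi> (x ^ Suc r * y ^ (n - r)) * ?p r)"
    by (subst sum.atMost_Suc_shift) (simp add: neg)
  also have "(\<Sum>r\<le>n. \<phi> (x ^ r * y ^ (Suc n - r)) * (?p r - \<phi> c * ?q r))
        - (\<Sum>r\<le>n. \<phi> (x ^ Suc r * y ^ (n - r)) * ?p r)
      = (\<Sum>r\<le>n. \<phi> (y - x) * (\<phi> (x ^ r * y ^ (n - r)) * (?p r - \<phi> (c * y / (y - x)) * ?q r)))"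
    unfolding sum_subtractf[symmetric]
  proof (intro sum.cong refl)
    fix r assume "r \<in> {..n}"
    then have r: "r \<le> n" by simp
    let ?w = "x ^ r * y ^ (n - r)"
    have "y - x \<noteq> 0" using xy by simp
    then have 1: "(y - x) * (?w * (c * y / (y - x))) = (y * ?w) * c" by simp
    have 2: "\<phi> p * (\<phi> w * (u - \<phi> e * v)) = \<phi> (p * w) * u - \<phi> (p * (w * e)) * v" for p w e u v
      by (simp add: hom_mult right_diff_distrib mult.assoc)
    have "\<phi> (x ^ r * y ^ (Suc n - r)) * (u - \<phi> c * v) - \<phi> (x ^ Suc r * y ^ (n - r)) * u
        = \<phi> ((y - x) * ?w) * u - \<phi> ((y * ?w) * c) * v" for u v
    proof -
      have e1: "x ^ r * y ^ (Suc n - r) = y * ?w" and e2: "x ^ Suc r * y ^ (n - r) = x * ?w"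
        by (simp_all only: wt[OF r] power_Suc mult.left_commute mult.assoc)
      have "a * (u - d * v) - b * u = (a - b) * u - a * d * v" for a b d :: 'a
        by (simp add: algebra_simps)
      then show ?thesis
        unfolding e1 e2 left_diff_distrib[of y x] hom_diff hom_mult[of "y * ?w" c] .
    qed
    then show "\<phi> (x ^ r * y ^ (Suc n - r)) * (?p r - \<phi> c * ?q r) - \<phi> (x ^ Suc r * y ^ (n - r)) * ?p r
        = \<phi> (y - x) * (\<phi> ?w * (?p r - \<phi> (c * y / (y - x)) * ?q r))"
      unfolding 2 1 .
  qed
  also have "\<dots> = \<phi> (y - x) * (\<Sum>r\<le>n. \<phi> (x ^ r * y ^ (n - r)) * (?p r - \<phi> (c * y / (y - x)) * ?q r))"
    by (simp add: sum_distrib_left)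
  finally have eq: "\<phi> (y - x) * (\<Sum>r\<le>n. \<phi> (x ^ r * y ^ (n - r)) * (?p r - \<phi> (c * y / (y - x)) * ?q r))
      = (\<Sum>r\<le>Suc n. \<phi> (x ^ r * y ^ (Suc n - r)) * D (int r) (int n - int r))" ..
  have "\<phi> (inverse (y - x)) * (\<phi> (y - x) * z) = z" for z
  proof -
    have "\<phi> (inverse (y - x)) * \<phi> (y - x) = 1"
      using xy by (simp add: hom_one flip: hom_mult)
    then show ?thesis by (simp flip: mult.assoc)
  qed
  moreover have "\<phi> (inverse (y - x)) * (\<Sum>r\<le>Suc n. \<phi> (x ^ r * y ^ (Suc n - r)) * D (int r) (int n - int r)) \<in> I"
    by (intro ring_ideal_mult_left[OF I] ring_ideal_sum[OF I] D)
  ultimately show ?thesis unfolding eq[symmetric] by simp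
qed

text \<open>
  Integer indices, with value zero below zero, make it possible to shift coefficients without case
  distinctions.
\<close>
definition L_coeff_mat :: "int \<Rightarrow> ('n::finite, 'k::field) free_alg ^ 'n ^ 'n" where
  "L_coeff_mat s = (\<chi> i j. if s < 0 then 0 else L_coeff (nat s) i j)"

text \<open>
  The coefficient of \<open>u^(-r)v^(-s)\<close> in \<open>L_1(u) R L_1(v)\<close>.
\<close>
definition LRL_coeff :: "'k::field ^ ('n::finite \<times> 'n) ^ ('n \<times> 'n) \<Rightarrow> int \<Rightarrow> int \<Rightarrow> ('n, ('n, 'k) free_alg) tens_mat" where
  "LRL_coeff R r s = tmult 2 (at_pos 1 (L_coeff_mat r))
     (tmult 2 (tmap scal (at_pos2 1 R)) (at_pos 1 (L_coeff_mat s)))"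

lemma LRL_coeff_neg:
  fixes R :: "'k::field ^ ('n::finite \<times> 'n) ^ ('n \<times> 'n)"
  shows "r < 0 \<or> s < 0 \<Longrightarrow> LRL_coeff R r s a b = 0"
proof -
  have "at_pos 1 (L_coeff_mat t) a b = (0 :: ('n, 'k) free_alg)" if "t < 0" for t and a b :: "'n list"
    using that by (simp add: at_pos_def L_coeff_mat_def)
  then show "r < 0 \<or> s < 0 \<Longrightarrow> LRL_coeff R r s a b = 0"
    by (auto simp: LRL_coeff_def tmult_def)
qed

lemma tmult_tid: "length b = m \<Longrightarrow> tmult m A tid a b = A a b"
  by (simp add: tmult_def tid_def if_distrib[of "\<lambda>x. _ * x"] sum.delta[OF finite_lists_of_length] cong: if_cong)

lemma tid_tmult: "length a = m \<Longrightarrow> tmult m tid A a b = A a b"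
  by (simp add: tmult_def tid_def if_distrib[of "\<lambda>x. x * _"] sum.delta'[OF finite_lists_of_length] cong: if_cong)

lemma tmult_cong_right:
  "(\<And>c. length c = m \<Longrightarrow> B c b = B' c b) \<Longrightarrow> tmult m A B a b = tmult m A B' a b"
  by (simp add: tmult_def)

lemma tprod4:
  assumes "length b = m"
  shows "tprod m [A, B, C, D] a b = tmult m A (tmult m B (tmult m C D)) a b"
  unfolding tprod_def
  by (simp, intro tmult_cong_right tmult_tid assms)

lemma tmult_assoc: "tmult m (tmult m A B) C = tmult m A (tmult m B C)"
proof (intro ext)
  fix a b
  have "tmult m (tmult m A B) C a b = (\<Sum>c | length c = m. \<Sum>d | length d = m. A a d * B d c * C c b)"
    by (simp add: tmult_def sum_distrib_right)
  also have "\<dots> = (\<Sum>d | length d = m. \<Sum>c | length c = m. A a d * B d c * C c b)"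
    by (rule sum.swap)
  finally show "tmult m (tmult m A B) C a b = tmult m A (tmult m B C) a b"
    by (simp add: tmult_def sum_distrib_left mult.assoc)
qed

lemma tmap_apply: "tmap f A a b = f (A a b)"
  by (simp add: tmap_def)

abbreviation coeff2 :: "'a::zero fls fps \<Rightarrow> nat \<Rightarrow> int \<Rightarrow> 'a" where
  "coeff2 x r s \<equiv> fls_nth (fps_nth x r) s"

lemma coeff2_sum: "coeff2 (sum f S) r s = (\<Sum>x\<in>S. coeff2 (f x) r s)"
  by (simp add: fps_sum_nth fls_nth_sum)

lemma coeff2_scal2: "coeff2 (scal2 c * x) r s = scal c * coeff2 x r s"
  "coeff2 (x * scal2 c) r s = coeff2 x r s * scal c"
  by (simp_all add: scal2_def)

lemma coeff2_geometric:
  "coeff2 (u_over_u_minus_v * x) r s = (\<Sum>i\<le>r. coeff2 x (r - i) (s + int i))"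
  "coeff2 (x * u_over_u_minus_v) r s = (\<Sum>i\<le>r. coeff2 x (r - i) (s + int i))"
proof -
  show "coeff2 (u_over_u_minus_v * x) r s = (\<Sum>i\<le>r. coeff2 x (r - i) (s + int i))"
    by (simp add: fps_mult_nth u_over_u_minus_v_def fls_nth_sum fls_X_inv_power_times_conv_shift
        atLeast0AtMost)
  have "coeff2 (x * u_over_u_minus_v) r s = (\<Sum>i\<le>r. coeff2 x i (s + int (r - i)))"
    by (simp add: fps_mult_nth u_over_u_minus_v_def fls_nth_sum fls_X_inv_power_times_conv_shift
        atLeast0AtMost)
  also have "\<dots> = (\<Sum>i\<le>r. coeff2 x (r - i) (s + int i))"
    by (rule sum.reindex_bij_witness[of _ "\<lambda>i. r - i" "\<lambda>i. r - i"]) auto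
  finally show "coeff2 (x * u_over_u_minus_v) r s = (\<Sum>i\<le>r. coeff2 x (r - i) (s + int i))" .
qed

lemma L1_u_coeff: "L1_u a c = Abs_fps (\<lambda>r. fls_const (at_pos 1 (L_coeff_mat (int r)) a c))"
  by (rule fps_ext) (auto simp: L1_u_def at_pos_def L_coeff_mat_def L_gen_def)

lemma L1_v_coeff: "L1_v a c = fps_const (fps_to_fls (Abs_fps (\<lambda>s. at_pos 1 (L_coeff_mat (int s)) a c)))"
  by (rule fps_ext, rule fls_eqI) (auto simp: L1_v_def at_pos_def L_coeff_mat_def L_gen_def)

lemma fps_to_fls_coeff:
  "fls_nth (fps_to_fls (Abs_fps (\<lambda>s. at_pos 1 (L_coeff_mat (int s)) a c))) s = at_pos 1 (L_coeff_mat s) a c"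
  by (auto simp: at_pos_def L_coeff_mat_def)

lemma coeff2_LRL:
  "coeff2 (tmult 2 L1_u (tmult 2 (tmap scal2 (at_pos2 1 R)) L1_v) a b) r s = LRL_coeff R (int r) s a b"
  "coeff2 (tmult 2 L1_v (tmult 2 (tmap scal2 (at_pos2 1 R)) L1_u) a b) r s = LRL_coeff R s (int r) a b"
proof -
  have 1: "coeff2 (L1_u a c * (scal2 z * L1_v d b)) r s
      = at_pos 1 (L_coeff_mat (int r)) a c * (scal z * at_pos 1 (L_coeff_mat s) d b)" for a b c d and z :: 'b
    by (simp add: L1_u_coeff L1_v_coeff scal2_def fps_to_fls_coeff[unfolded One_nat_def] del: fps_to_fls_nth flip: mult.assoc)
  have 2: "coeff2 (L1_v a c * (scal2 z * L1_u d b)) r s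
      = at_pos 1 (L_coeff_mat s) a c * (scal z * at_pos 1 (L_coeff_mat (int r)) d b)" for a b c d and z :: 'b
    by (simp add: L1_u_coeff L1_v_coeff scal2_def fps_to_fls_coeff[unfolded One_nat_def] del: fps_to_fls_nth)
  show "coeff2 (tmult 2 L1_u (tmult 2 (tmap scal2 (at_pos2 1 R)) L1_v) a b) r s = LRL_coeff R (int r) s a b"
    by (simp add: tmult_def LRL_coeff_def tmap_def coeff2_sum sum_distrib_left 1)
  show "coeff2 (tmult 2 L1_v (tmult 2 (tmap scal2 (at_pos2 1 R)) L1_u) a b) r s = LRL_coeff R s (int r) a b"
    by (simp add: tmult_def LRL_coeff_def tmap_def coeff2_sum sum_distrib_left 2)
qed

definition exchange_coeff where
  "exchange_coeff R a b r s = tmult 2 (tmap scal (at_pos2 1 R)) (LRL_coeff R r s) a b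
     - tmult 2 (LRL_coeff R s r) (tmap scal (at_pos2 1 R)) a b"

definition plain_coeff where
  "plain_coeff R a b r s = LRL_coeff R r s a b - LRL_coeff R s r a b"

lemma coeff2_yangian_relation:
  fixes R :: "'k::field ^ ('n::finite \<times> 'n) ^ ('n \<times> 'n)"
  assumes "length a = 2" "length b = 2"
  shows "coeff2 (yangian_relation q R a b) r s = exchange_coeff R a b (int r) s
    - scal (q - inverse q) * (\<Sum>i\<le>r. plain_coeff R a b (int r - int i) (s + int i))"
proof -
  let ?F = "tmult 2 L1_u (tmult 2 (tmap scal2 (at_pos2 1 R)) L1_v)"
  let ?G = "tmult 2 L1_v (tmult 2 (tmap scal2 (at_pos2 1 R)) L1_u)"
  let ?R = "tmap scal2 (at_pos2 1 R)" and ?U = "scal2 (q - inverse q) * u_over_u_minus_v"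
  have tm: "tmult 2 (R_uv q R) ?F a b = tmult 2 ?R ?F a b - ?U * ?F a b"
  proof -
    have "tmult 2 (R_uv q R) ?F a b = tmult 2 ?R ?F a b - ?U * tmult 2 tid ?F a b"
      unfolding tmult_def[of 2 "R_uv q R"] tmult_def[of 2 ?R] tmult_def[of 2 tid]
      by (simp add: R_uv_def tmap_def left_diff_distrib sum_subtractf sum_distrib_left mult.assoc)
    then show ?thesis by (simp only: tid_tmult[OF assms(1)])
  qed
  have tm': "tmult 2 ?G (R_uv q R) a b = tmult 2 ?G ?R a b - ?G a b * ?U"
  proof -
    have U: "x * (?U * tid c b) = x * tid c b * ?U" for x c
      by (simp add: tid_def)
    have "tmult 2 ?G (R_uv q R) a b = (\<Sum>c | length c = 2. ?G a c * ?R c b - ?G a c * tid c b * ?U)"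
      unfolding tmult_def[of 2 ?G]
      by (intro sum.cong refl) (simp only: R_uv_def tmap_def right_diff_distrib U)
    also have "\<dots> = tmult 2 ?G ?R a b - tmult 2 ?G tid a b * ?U"
      unfolding tmult_def[of 2 ?G] sum_subtractf sum_distrib_right ..
    finally have "tmult 2 ?G (R_uv q R) a b = tmult 2 ?G ?R a b - tmult 2 ?G tid a b * ?U" .
    then show ?thesis by (simp only: tmult_tid[OF assms(2)])
  qed
  have "yangian_relation q R a b = tmult 2 (R_uv q R) ?F a b - tmult 2 ?G (R_uv q R) a b"
    unfolding yangian_relation_def tprod4[OF assms(2)] by (simp add: tmult_assoc)
  then have "coeff2 (yangian_relation q R a b) r s = coeff2 (tmult 2 ?R ?F a b) r s - coeff2 (?U * ?F a b) r s
      - (coeff2 (tmult 2 ?G ?R a b) r s - coeff2 (?G a b * ?U) r s)"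
    unfolding tm tm' by simp
  moreover have "coeff2 (tmult 2 ?R ?F a b) r s = tmult 2 (tmap scal (at_pos2 1 R)) (LRL_coeff R (int r) s) a b"
    unfolding tmult_def[of 2 ?R ?F] tmult_def[of 2 "tmap scal (at_pos2 1 R)" "LRL_coeff R (int r) s"]
    by (simp only: coeff2_sum tmap_apply coeff2_scal2 coeff2_LRL)
  moreover have "coeff2 (tmult 2 ?G ?R a b) r s = tmult 2 (LRL_coeff R s (int r)) (tmap scal (at_pos2 1 R)) a b"
    unfolding tmult_def[of 2 ?G ?R] tmult_def[of 2 "LRL_coeff R s (int r)"]
    by (simp only: coeff2_sum tmap_apply coeff2_scal2 coeff2_LRL)
  moreover have "coeff2 (?U * ?F a b) r s = scal (q - inverse q) * (\<Sum>i\<le>r. LRL_coeff R (int r - int i) (s + int i) a b)"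
    by (simp only: mult.assoc coeff2_scal2 coeff2_geometric coeff2_LRL) (simp add: of_nat_diff)
  moreover have "coeff2 (?G a b * ?U) r s = scal (q - inverse q) * (\<Sum>i\<le>r. LRL_coeff R (s + int i) (int r - int i) a b)"
  proof -
    have "?G a b * ?U = ?G a b * scal2 (q - inverse q) * u_over_u_minus_v" by (simp only: mult.assoc)
    then show ?thesis
      by (simp only: coeff2_scal2 coeff2_geometric coeff2_LRL)
         (simp add: of_nat_diff sum_distrib_left scal.central)
  qed
  ultimately show ?thesis
    by (simp only:) (simp add: exchange_coeff_def plain_coeff_def sum_subtractf right_diff_distrib)
qed

definition L_shifted :: "'k::field \<Rightarrow> nat \<Rightarrow> ('n::finite, 'k) free_alg fps ^ 'n ^ 'n" where
  "L_shifted q j = rescale (inverse q ^ (2 * j)) L_gen"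

text \<open>
  Under \<open>u \<mapsto> q^(-2j)u\<close> the coefficient of \<open>u^(-r)\<close> is multiplied by the \<open>r\<close>-th power of this scalar.
\<close>
definition weight :: "'k::field \<Rightarrow> nat \<Rightarrow> 'k" where
  "weight q j = inverse (inverse q ^ (2 * j))"

lemma nth_at_pos_L_shifted: "fps_nth (at_pos 1 (L_shifted q j) a c) r = scal (weight q j ^ r) * at_pos 1 (L_coeff_mat (int r)) a c"
  by (auto simp: at_pos_def L_shifted_def rescale_def weight_def L_gen_def L_coeff_mat_def)

definition LRL :: "'k::field \<Rightarrow> 'k ^ ('n::finite \<times> 'n) ^ ('n \<times> 'n) \<Rightarrow> nat \<Rightarrow> nat \<Rightarrow> ('n, ('n, 'k) free_alg fps) tens_mat" where
  "LRL q R i j = tmult 2 (at_pos 1 (L_shifted q i)) (tmult 2 (tmap fscal (at_pos2 1 R)) (at_pos 1 (L_shifted q j)))"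

lemma nth_LRL:
  fixes R :: "'k::field ^ ('n::finite \<times> 'n) ^ ('n \<times> 'n)"
  shows "fps_nth (LRL q R i j a b) n
    = (\<Sum>r\<le>n. scal (weight q i ^ r * weight q j ^ (n - r)) * LRL_coeff R (int r) (int n - int r) a b)"
proof -
  have c: "scal a * x * (scal z * (scal b * y)) = scal (a * b) * (x * (scal z * y))" for a b z :: 'k and x y
  proof -
    have "scal a * x * (scal z * (scal b * y)) = scal a * (x * (scal b * (scal z * y)))"
      unfolding scal.hom_left_commute[of b "scal z" y] by (rule mult.assoc)
    also have "\<dots> = scal (a * b) * (x * (scal z * y))"
      unfolding scal.hom_left_commute[of b x, symmetric] scal.hom_mult by (simp only: mult.assoc)
    finally show ?thesis .
  qed
  have "fps_nth (at_pos 1 (L_shifted q i) a d * (fscal z * at_pos 1 (L_shifted q j) e b)) n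
      = (\<Sum>r\<le>n. scal (weight q i ^ r * weight q j ^ (n - r)) *
         (at_pos 1 (L_coeff_mat (int r)) a d * (scal z * at_pos 1 (L_coeff_mat (int (n - r))) e b)))" for d e z
    unfolding fps_mult_nth[of "at_pos 1 (L_shifted q i) a d"] fscal_def fps_mult_left_const_nth
      nth_at_pos_L_shifted c atLeast0AtMost ..
  note entry = this
  let ?t = "\<lambda>r d e. scal (weight q i ^ r * weight q j ^ (n - r)) *
         (at_pos 1 (L_coeff_mat (int r)) a d * (scal (at_pos2 1 R d e) * at_pos 1 (L_coeff_mat (int (n - r))) e b))"
  from entry have "fps_nth (LRL q R i j a b) n = (\<Sum>d | length d = 2. \<Sum>e | length e = 2. \<Sum>r\<le>n. ?t r d e)"
    by (simp add: LRL_def tmult_def tmap_def sum_distrib_left fps_sum_nth)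
  also have "\<dots> = (\<Sum>d | length d = 2. \<Sum>r\<le>n. \<Sum>e | length e = 2. ?t r d e)"
    by (rule sum.cong[OF refl], rule sum.swap)
  also have "\<dots> = (\<Sum>r\<le>n. \<Sum>d | length d = 2. \<Sum>e | length e = 2. ?t r d e)"
    by (rule sum.swap)
  also have "\<dots> = (\<Sum>r\<le>n. scal (weight q i ^ r * weight q j ^ (n - r)) * LRL_coeff R (int r) (int n - int r) a b)"
    by (intro sum.cong refl) (simp add: LRL_coeff_def tmult_def tmap_def sum_distrib_left of_nat_diff)
  finally show ?thesis .
qed

lemma nth_LRL_swap:
  "fps_nth (LRL q R j i a b) n
    = (\<Sum>r\<le>n. scal (weight q i ^ r * weight q j ^ (n - r)) * LRL_coeff R (int n - int r) (int r) a b)"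
  unfolding nth_LRL
  by (rule sum.reindex_bij_witness[of _ "\<lambda>r. n - r" "\<lambda>r. n - r"]) (auto simp: of_nat_diff mult.commute)

definition yangian_fps_ideal :: "'k::field \<Rightarrow> 'k ^ ('n::finite \<times> 'n) ^ ('n \<times> 'n) \<Rightarrow> ('n, 'k) free_alg fps set" where
  "yangian_fps_ideal q R = {f. \<forall>r. fps_nth f r \<in> yangian_ideal q R}"

lemma ring_ideal_yangian_fps_ideal: "ring_ideal (yangian_fps_ideal q R)"
  unfolding yangian_fps_ideal_def yangian_ideal_def
  by (intro ring_ideal_fps ring_ideal_two_sided_ideal)

lemma exchange_in_ideal:
  fixes R :: "'k::field ^ ('n::finite \<times> 'n) ^ ('n \<times> 'n)"
  assumes ab: "length a = 2" "length b = 2" and w: "weight q i \<noteq> weight q j"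
  defines "c \<equiv> (q - inverse q) * weight q j / (weight q j - weight q i)"
  shows "tmult 2 (tmap fscal (at_pos2 1 R)) (LRL q R i j) a b - fscal c * LRL q R i j a b
    - (tmult 2 (LRL q R j i) (tmap fscal (at_pos2 1 R)) a b - fscal c * LRL q R j i a b)
    \<in> yangian_fps_ideal q R"
  unfolding yangian_fps_ideal_def
proof (intro CollectI allI)
  fix n
  let ?w = "\<lambda>r. scal (weight q i ^ r * weight q j ^ (n - r)) :: ('n, 'k) free_alg"
  have I: "ring_ideal (yangian_ideal q R)"
    unfolding yangian_ideal_def by (rule ring_ideal_two_sided_ideal)
  have rel: "exchange_coeff R a b (int r) s - scal (q - inverse q) *
      (\<Sum>i\<le>r. plain_coeff R a b (int r - int i) (s + int i)) \<in> yangian_ideal q R" for r s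
    unfolding coeff2_yangian_relation[OF ab, symmetric] yangian_ideal_def
    by (rule two_sided_ideal_generator) (use ab in blast)
  have neg: "exchange_coeff R a b r s = 0" "plain_coeff R a b r s = 0" if "r < 0 \<or> s < 0" for r s
  proof -
    have "s < 0 \<or> r < 0" using that by blast
    then show "exchange_coeff R a b r s = 0" "plain_coeff R a b r s = 0"
      using that by (simp_all only: exchange_coeff_def plain_coeff_def tmult_def LRL_coeff_neg) simp_all
  qed
  have RF: "fps_nth (tmult 2 (tmap fscal (at_pos2 1 R)) (LRL q R i j) a b) n
      = (\<Sum>r\<le>n. ?w r * tmult 2 (tmap scal (at_pos2 1 R)) (LRL_coeff R (int r) (int n - int r)) a b)"
  proof -
    have c: "scal z * (?w r * y) = ?w r * (scal z * y)" for z r y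
      by (rule scal.hom_left_commute)
    have "fps_nth (tmult 2 (tmap fscal (at_pos2 1 R)) (LRL q R i j) a b) n
        = (\<Sum>d | length d = 2. \<Sum>r\<le>n. ?w r * (scal (at_pos2 1 R a d) * LRL_coeff R (int r) (int n - int r) d b))"
      by (simp add: tmult_def tmap_def fps_sum_nth fscal_def nth_LRL sum_distrib_left c)
    also have "\<dots> = (\<Sum>r\<le>n. \<Sum>d | length d = 2. ?w r * (scal (at_pos2 1 R a d) * LRL_coeff R (int r) (int n - int r) d b))"
      by (rule sum.swap)
    finally show ?thesis by (simp add: tmult_def tmap_def sum_distrib_left)
  qed
  have GR: "fps_nth (tmult 2 (LRL q R j i) (tmap fscal (at_pos2 1 R)) a b) n
      = (\<Sum>r\<le>n. ?w r * tmult 2 (LRL_coeff R (int n - int r) (int r)) (tmap scal (at_pos2 1 R)) a b)"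
  proof -
    have "fps_nth (tmult 2 (LRL q R j i) (tmap fscal (at_pos2 1 R)) a b) n
        = (\<Sum>d | length d = 2. \<Sum>r\<le>n. ?w r * (LRL_coeff R (int n - int r) (int r) a d * scal (at_pos2 1 R d b)))"
      by (simp add: tmult_def tmap_def fps_sum_nth fscal_def nth_LRL_swap[of q R j i] sum_distrib_right mult.assoc)
    also have "\<dots> = (\<Sum>r\<le>n. \<Sum>d | length d = 2. ?w r * (LRL_coeff R (int n - int r) (int r) a d * scal (at_pos2 1 R d b)))"
      by (rule sum.swap)
    finally show ?thesis by (simp add: tmult_def tmap_def sum_distrib_left)
  qed
  have F: "fps_nth (fscal c * LRL q R i j a b) n = (\<Sum>r\<le>n. ?w r * (scal c * LRL_coeff R (int r) (int n - int r) a b))"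
    and G: "fps_nth (fscal c * LRL q R j i a b) n = (\<Sum>r\<le>n. ?w r * (scal c * LRL_coeff R (int n - int r) (int r) a b))"
  proof -
    have c: "scal c * (?w r * y) = ?w r * (scal c * y)" for r y
      by (rule scal.hom_left_commute)
    show "fps_nth (fscal c * LRL q R i j a b) n = (\<Sum>r\<le>n. ?w r * (scal c * LRL_coeff R (int r) (int n - int r) a b))"
      by (simp add: fscal_def nth_LRL sum_distrib_left c)
    show "fps_nth (fscal c * LRL q R j i a b) n = (\<Sum>r\<le>n. ?w r * (scal c * LRL_coeff R (int n - int r) (int r) a b))"
      by (simp add: fscal_def nth_LRL_swap[of q R j i] sum_distrib_left c)
  qed
  have "fps_nth (tmult 2 (tmap fscal (at_pos2 1 R)) (LRL q R i j) a b - fscal c * LRL q R i j a b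
    - (tmult 2 (LRL q R j i) (tmap fscal (at_pos2 1 R)) a b - fscal c * LRL q R j i a b)) n
    = (\<Sum>r\<le>n. ?w r * (exchange_coeff R a b (int r) (int n - int r) - scal c * plain_coeff R a b (int r) (int n - int r)))"
    unfolding fps_sub_nth RF GR F G sum_subtractf[symmetric]
    by (intro sum.cong refl) (simp add: exchange_coeff_def plain_coeff_def right_diff_distrib)
  also have "\<dots> \<in> yangian_ideal q R"
    unfolding c_def by (rule scal.specialize_parameters[OF I neg rel w])
  finally show "fps_nth (tmult 2 (tmap fscal (at_pos2 1 R)) (LRL q R i j) a b - fscal c * LRL q R i j a b
    - (tmult 2 (LRL q R j i) (tmap fscal (at_pos2 1 R)) a b - fscal c * LRL q R j i a b)) n \<in> yangian_ideal q R" .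
qed

text \<open>
  For the weights of \<open>i\<close> and \<open>i + d\<close>, whose quotient is \<open>q^(2d)\<close>, the scalar of the preceding lemma is \<open>q^d / d_q\<close>.
\<close>
lemma reflection_L_shifted:
  fixes R :: "'k::field ^ ('n::finite \<times> 'n) ^ ('n \<times> 'n)"
  defines "T \<equiv> pos2 0 (map_matrix fscal R)"
  assumes q: "q_numbers_nonzero q" and d: "d \<ge> 1"
  shows "(T - fscal.scale (q ^ d / qnum q d) 1) * pos 0 (L_shifted q i) * T * pos 0 (L_shifted q (i + d))
      - pos 0 (L_shifted q (i + d)) * T * pos 0 (L_shifted q i) * (T - fscal.scale (q ^ d / qnum q d) 1)
      \<in> ideal_matrices (yangian_fps_ideal q R)"
proof -
  interpret algebra_over_field "fscal.scale :: 'k \<Rightarrow> (nat \<Rightarrow> 'n, ('n, 'k) free_alg fps) row_finite_matrix \<Rightarrow> _"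
    by (rule fscal.algebra_scale)
  let ?c = "q ^ d / qnum q d" and ?j = "i + d" and ?R = "tmap fscal (at_pos2 1 R)"
  have q0: "q \<noteq> 0" "q - inverse q \<noteq> 0" and nz: "qnum q d \<noteq> 0" using q d by (auto simp: q_numbers_nonzero_def)
  have wj: "weight q ?j = weight q i * (q ^ d * q ^ d)"
  proof -
    have "2 * ?j = 2 * i + (d + d)" by simp
    then show ?thesis by (simp only: weight_def power_inverse power_add inverse_mult_distrib
        inverse_inverse_eq)
  qed
  have wi: "weight q i \<noteq> 0" using q0 by (simp add: weight_def)
  have qd: "q ^ d - inverse q ^ d \<noteq> 0" using nz q0 by (auto simp: qnum_def)
  have dw: "weight q ?j - weight q i = weight q i * q ^ d * (q ^ d - inverse q ^ d)"
    unfolding wj using q0 by (simp add: right_diff_distrib power_inverse mult.assoc)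
  then have w: "weight q i \<noteq> weight q ?j" using wi q0 qd by auto
  have c: "(q - inverse q) * weight q ?j / (weight q ?j - weight q i) = ?c"
    unfolding dw unfolding wj qnum_def using wi q0 qd by (simp add: field_simps)
  have T: "T = lift_tens 0 2 ?R"
    unfolding T_def by (simp add: lift_tens_at_pos2[of 0 2 0, simplified] fscal.tmap_at_pos2)
  have L: "pos 0 (L_shifted q j) = lift_tens 0 2 (at_pos 1 (L_shifted q j))" for j
    by (simp add: lift_tens_at_pos[of 0 2 0, simplified])
  have LTL: "pos 0 (L_shifted q i) * (T * pos 0 (L_shifted q j)) = lift_tens 0 2 (LRL q R i j)" for i j
    unfolding T L LRL_def lift_tens_mult ..
  have "(T - fscal.scale ?c 1) * pos 0 (L_shifted q i) * T * pos 0 (L_shifted q ?j)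
      - pos 0 (L_shifted q ?j) * T * pos 0 (L_shifted q i) * (T - fscal.scale ?c 1)
      = lift_tens 0 2 (tmult 2 ?R (LRL q R i ?j)) - fscal.scale ?c (lift_tens 0 2 (LRL q R i ?j))
        - (lift_tens 0 2 (tmult 2 (LRL q R ?j i) ?R) - fscal.scale ?c (lift_tens 0 2 (LRL q R ?j i)))" (is "?X = ?Y")
    unfolding lift_tens_mult LTL[symmetric] T[symmetric]
    by (simp add: left_diff_distrib right_diff_distrib mult.assoc)
  moreover have "entry ?Y f g \<in> yangian_fps_ideal q R" for f g
  proof (cases "agree_off {0..<2} f g")
    case True
    then have "entry (lift_tens 0 2 A) f g = A (map f [0..<2]) (map g [0..<2])"
      for A :: "('n, ('n, 'k) free_alg fps) tens_mat"
      by (simp only: lift_tens.rep_eq add_0 if_True)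
    then show ?thesis
      using exchange_in_ideal[OF _ _ w, of "map f [0..<2]" "map g [0..<2]" R]
      unfolding c minus_row_finite_matrix.rep_eq fscal.scale.rep_eq by (simp only: length_map length_upt)
  next
    case False
    then have "entry (lift_tens 0 2 A) f g = 0" for A :: "('n, ('n, 'k) free_alg fps) tens_mat"
      by (simp only: lift_tens.rep_eq add_0 if_False)
    then show ?thesis using ring_ideal_yangian_fps_ideal[of q R]
      unfolding minus_row_finite_matrix.rep_eq fscal.scale.rep_eq by (simp add: ring_ideal_def)
  qed
  ultimately show ?thesis by (simp add: ideal_matrices_def)
qed

section \<open>The identity for the generating matrix\<close>

text \<open>
  Ordinary traces over the positions \<open>1, \<dots>, n\<close>. They mediate between iterated \<open>R\<close>-traces and the single sum
  over multi-indices, in which all matrices \<open>C\<close> are collected in front of the operator.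
\<close>
primrec plain_traces :: "nat \<Rightarrow> (nat \<Rightarrow> 'n::finite, 'a::ring_1) row_finite_matrix \<Rightarrow> (nat \<Rightarrow> 'n, 'a) row_finite_matrix" where
  "plain_traces 0 X = X"
| "plain_traces (Suc n) X = plain_traces n (partial_trace (mat 1) (Suc n) X)"

lemma entry_partial_trace_mat_1:
  "entry (partial_trace (mat 1) s X) f g
    = (if f s = g s then \<Sum>i\<in>UNIV. entry X (f(s := i)) (g(s := i)) else 0)"
  by (simp add: partial_trace.rep_eq mat_def if_distrib[of "\<lambda>x. x * _"] cong: if_cong)

lemma partial_trace_pos: "partial_trace C s X = partial_trace (mat 1) s (pos s C * X)"
  by (rule row_finite_eqI, subst entry_partial_trace_mat_1)
     (simp add: entry_pos_mult partial_trace.rep_eq)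

lemma sum_lists_Suc:
  fixes F :: "'n::finite list \<Rightarrow> 'a::comm_monoid_add"
  shows "(\<Sum>a | length a = Suc n. F a) = (\<Sum>a | length a = n. \<Sum>i\<in>UNIV. F (a @ [i]))"
proof -
  have "(\<Sum>a | length a = n. \<Sum>i\<in>UNIV. F (a @ [i])) = (\<Sum>p\<in>{a. length a = n} \<times> UNIV. F (fst p @ [snd p]))"
    by (subst sum.cartesian_product) (simp add: case_prod_beta)
  also have "\<dots> = (\<Sum>a | length a = Suc n. F a)"
    by (rule sum.reindex_bij_witness[of _ "\<lambda>a. (butlast a, last a)" "\<lambda>p. fst p @ [snd p]"])
       (auto simp: append_butlast_last_id length_0_conv[symmetric] simp del: length_0_conv)
  finally show ?thesis ..
qed

lemma override_snoc: "length a = n \<Longrightarrow> override 1 f (a @ [i]) = (override 1 f a)(Suc n := i)"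
  by (auto simp: override_def fun_eq_iff nth_append)

lemma entry_plain_traces:
  fixes f g :: "nat \<Rightarrow> 'n::finite"
  shows "entry (plain_traces n X) f g = (if \<forall>t\<in>{1..n}. f t = g t
     then \<Sum>a | length a = n. entry X (override 1 f a) (override 1 g a) else 0)"
proof (induction n arbitrary: X)
  case 0
  have "override 1 f [] = f" for f :: "nat \<Rightarrow> 'n" by (simp add: override_def fun_eq_iff)
  then show ?case by simp
next
  case (Suc n)
  have Y: "entry (partial_trace (mat 1) (Suc n) X) (override 1 f a) (override 1 g a)
      = (if f (Suc n) = g (Suc n) then \<Sum>i\<in>UNIV. entry X (override 1 f (a @ [i])) (override 1 g (a @ [i])) else 0)"
    if "length a = n" for a
  proof -
    have "override 1 h a (Suc n) = h (Suc n)" for h :: "nat \<Rightarrow> 'n"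
      using that by (simp add: override_def)
    then show ?thesis by (simp only: entry_partial_trace_mat_1 override_snoc[OF that])
  qed
  show ?case
  proof (cases "f (Suc n) = g (Suc n)")
    case True
    then have "(\<forall>t\<in>{1..Suc n}. f t = g t) \<longleftrightarrow> (\<forall>t\<in>{1..n}. f t = g t)"
      by (auto simp: le_Suc_eq)
    then show ?thesis unfolding plain_traces.simps Suc.IH sum_lists_Suc
      using True by (simp add: Y del: One_nat_def)
  next
    case False
    then have "\<not> (\<forall>t\<in>{1..Suc n}. f t = g t)" by auto
    moreover have "(\<Sum>a | length a = n. entry (partial_trace (mat 1) (Suc n) X) (override 1 f a) (override 1 g a)) = 0"
      using False by (intro sum.neutral) (simp add: Y del: One_nat_def)
    ultimately show ?thesis unfolding plain_traces.simps Suc.IH by (simp only: if_False if_cancel)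
  qed
qed

lemma pos_R_trace_from2:
  fixes C :: "'k::field ^ 'n::finite ^ 'n" and X :: "('n, ('n, 'k) free_alg fps) tens_mat"
  shows "pos 0 (R_trace_from2 C (Suc n) X)
    = plain_traces n (prod_list (map (\<lambda>s. pos s (map_matrix fscal C)) [1..<Suc n]) * lift_tens 0 (Suc n) X)"
proof (rule row_finite_eqI)
  fix f g :: "nat \<Rightarrow> 'n"
  let ?fs = "fscal :: 'k \<Rightarrow> ('n, 'k) free_alg fps"
  define A where "A = tprod (Suc n) (map (\<lambda>s. tmap ?fs (at_pos s C)) [2..<Suc (Suc n)] @ [X])"
  have up: "[2..<Suc (Suc n)] = map Suc [1..<Suc n]"
    by (simp add: map_Suc_upt numeral_2_eq_2 del: upt_Suc)
  have "map (lift_tens 0 (Suc n)) (map (\<lambda>s. tmap ?fs (at_pos s C)) [2..<Suc (Suc n)])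
      = map (\<lambda>s. pos s (map_matrix ?fs C)) [1..<Suc n]"
    unfolding up map_map
    by (intro map_cong refl) (auto simp: fscal.tmap_at_pos lift_tens_at_pos)
  then have A: "lift_tens 0 (Suc n) A
      = prod_list (map (\<lambda>s. pos s (map_matrix ?fs C)) [1..<Suc n]) * lift_tens 0 (Suc n) X"
    unfolding A_def lift_tens_tprod by (simp del: upt_Suc)
  have m: "map (override 1 f a) [0..<Suc n] = f 0 # a" if "length a = n" for a and f :: "nat \<Rightarrow> 'n"
    using that by (intro nth_equalityI) (auto simp: override_def nth_Cons split: nat.split simp del: upt_Suc)
  have ag: "agree_off {0..<Suc n} (override 1 f a) (override 1 g a) \<longleftrightarrow> (\<forall>t>n. f t = g t)"
    if "length a = n" for a
    using that by (auto simp: agree_off_def override_def)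
  have ag0: "agree_off {0} f g \<longleftrightarrow> (\<forall>t\<in>{1..n}. f t = g t) \<and> (\<forall>t>n. f t = g t)"
  proof
    assume *: "(\<forall>t\<in>{1..n}. f t = g t) \<and> (\<forall>t>n. f t = g t)"
    show "agree_off {0} f g" unfolding agree_off_def
    proof (intro allI impI)
      fix t :: nat assume "t \<notin> {0}"
      then show "f t = g t" using * by (cases "t \<le> n") auto
    qed
  qed (auto simp: agree_off_def)
  have L: "entry (lift_tens 0 (Suc n) A) (override 1 f a) (override 1 g a)
      = (if \<forall>t>n. f t = g t then A (f 0 # a) (g 0 # a) else 0)" if "length a = n" for a
    unfolding lift_tens.rep_eq add_0 using that by (simp only: ag m)
  have R: "R_trace_from2 C (Suc n) X $ i $ j = (\<Sum>a | length a = n. A (i # a) (j # a))" for i j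
    by (simp add: R_trace_from2_def A_def del: upt_Suc)
  show "entry (pos 0 (R_trace_from2 C (Suc n) X)) f g
      = entry (plain_traces n (prod_list (map (\<lambda>s. pos s (map_matrix ?fs C)) [1..<Suc n]) * lift_tens 0 (Suc n) X)) f g"
    unfolding A[symmetric] entry_plain_traces
    by (cases "\<forall>t>n. f t = g t") (auto simp: pos.rep_eq ag0 R L simp del: One_nat_def upt_Suc intro!: sum.neutral)
qed

definition rescale_fps :: "'k::field \<Rightarrow> ('n, 'k) free_alg fps \<Rightarrow> ('n, 'k) free_alg fps" where
  "rescale_fps c f = Abs_fps (\<lambda>r. scal (inverse c ^ r) * fps_nth f r)"

lemma rescale_nth: "rescale c A $ i $ j = rescale_fps c (A $ i $ j)"
  by (simp add: rescale_def rescale_fps_def)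

lemma rescale_fps_sum: "rescale_fps c (sum f S) = (\<Sum>s\<in>S. rescale_fps c (f s))"
  by (rule fps_ext) (simp add: rescale_fps_def fps_sum_nth sum_distrib_left)

text \<open>
  Substitution \<open>u \<mapsto> c u\<close> is a ring homomorphism because scalars are central.
\<close>
lemma rescale_fps_mult:
  fixes f g :: "('n, 'k::field) free_alg fps"
  shows "rescale_fps c (f * g) = rescale_fps c f * rescale_fps c g"
proof (rule fps_ext)
  fix n
  have "scal (inverse c ^ n) * (x * y) = (scal (inverse c ^ i) * x) * (scal (inverse c ^ (n - i)) * y)"
    if "i \<le> n" for i and x y :: "('n, 'k) free_alg"
  proof -
    have "scal (inverse c ^ n) * (x * y) = scal (inverse c ^ i) * (scal (inverse c ^ (n - i)) * (x * y))"
      using that by (simp flip: mult.assoc scal.hom_mult power_add)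
    also have "\<dots> = (scal (inverse c ^ i) * x) * (scal (inverse c ^ (n - i)) * y)"
      unfolding scal.hom_left_commute[of _ x y] by (rule mult.assoc[symmetric])
    finally show ?thesis .
  qed
  then show "fps_nth (rescale_fps c (f * g)) n = fps_nth (rescale_fps c f * rescale_fps c g) n"
    by (simp add: rescale_fps_def fps_mult_nth sum_distrib_left)
qed

lemma rescale_mult: "rescale c (A ** B) = rescale c A ** rescale c B"
  by (simp add: vec_eq_iff rescale_nth matrix_matrix_mult_def rescale_fps_sum rescale_fps_mult)

lemma rescale_rescale:
  fixes A :: "('n::finite, 'k::field) free_alg fps ^ 'n ^ 'n"
  shows "rescale c (rescale d A) = rescale (c * d) A"
proof -
  have "rescale_fps c (rescale_fps d f) = rescale_fps (c * d) f" for f :: "('n, 'k) free_alg fps"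
    by (rule fps_ext) (simp add: rescale_fps_def power_mult_distrib scal.hom_mult mult.assoc)
  then show ?thesis by (simp add: vec_eq_iff rescale_nth)
qed

lemma rescale_one: "rescale 1 A = A"
  by (simp add: vec_eq_iff rescale_def scal.hom_one fps_eq_iff)

lemma rescale_mat_1: "rescale c (mat 1) = (mat 1 :: ('n::finite, 'k::field) free_alg fps ^ 'n ^ 'n)"
proof -
  have "rescale_fps c 0 = (0 :: ('n, 'k) free_alg fps)" "rescale_fps c 1 = (1 :: ('n, 'k) free_alg fps)"
    by (rule fps_ext, simp add: rescale_fps_def scal.hom_one)+
  then show ?thesis by (simp add: vec_eq_iff rescale_nth mat_def)
qed

lemma pos_mat_1: "pos s (mat 1 :: 'a::ring_1 ^ 'n::finite ^ 'n) = 1"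
proof (rule row_finite_eqI)
  fix f g :: "nat \<Rightarrow> 'n"
  note agree_off_eq_iff(1)[of s f g]
  then show "entry (pos s (mat 1 :: 'a ^ 'n ^ 'n)) f g = entry 1 f g"
    by (auto simp: pos.rep_eq mat_def entry_one)
qed

lemma lift_tens_tmap_scale:
  "lift_tens s m (tmap fscal (\<lambda>a b. c * A a b)) = fscal.scale c (lift_tens s m (tmap fscal A))"
  by (rule row_finite_eqI) (simp add: lift_tens.rep_eq fscal.scale.rep_eq tmap_def fscal.hom_mult)

lemma lift_tens_tmap_diff:
  "lift_tens s m (tmap fscal (\<lambda>a b. A a b - B a b))
    = lift_tens s m (tmap fscal A) - lift_tens s m (tmap fscal B)"
  by (rule row_finite_eqI) (simp add: lift_tens.rep_eq tmap_def fscal.hom_diff)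

theorem proposition11:
  fixes q :: "'k::real_normed_field"
    and R \<Psi> :: "'k ^ ('n::finite \<times> 'n) ^ ('n \<times> 'n)"
    and k :: nat
  assumes "hecke_symmetry q R"
    and "generic q"
    and "is_skew_inverse R \<Psi>"
    and "k \<ge> 1"
  shows "yangian_eq q R
    (\<chi> i j. fscal ((-1) ^ (k + 1) * qnum q k) * L_wedge q R (C_mat \<Psi>) L_gen k $ i $ j)
    (\<chi> i j. \<Sum>p = 1..k. fscal ((- q) ^ (k - p)) *
        rescale (inverse q ^ (2 * (k - p))) (L_pow q L_gen p) $ i $ j *
        e_elem q R (C_mat \<Psi>) L_gen (k - p))"
proof -
  let ?C = "C_mat \<Psi>" and ?C' = "map_matrix fscal (C_mat \<Psi>) :: ('n, 'k) free_alg fps ^ 'n ^ 'n"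
  let ?fs = "fscal :: 'k \<Rightarrow> ('n, 'k) free_alg fps"
  let ?T = "\<lambda>s. pos2 s (map_matrix fscal R) :: (nat \<Rightarrow> 'n, ('n, 'k) free_alg fps) row_finite_matrix"
  interpret braided_trace fscal.scale q ?T "\<lambda>j. pos 0 (L_shifted q j)"
    "ideal_matrices (yangian_fps_ideal q R)" "partial_trace ?C'" trivial_at
    by (rule fscal.braided_trace_pos[OF assms(1-3) ring_ideal_yangian_fps_ideal])
       (rule reflection_L_shifted[OF q_numbers_nonzero_hecke[OF assms(1,2)]])
  have pos_at: "lift_tens 0 m (tmap ?fs (at_pos2 (Suc t) B)) = pos2 t (map_matrix ?fs B)"
    if "Suc t < m" for m t and B :: "'k ^ ('n \<times> 'n) ^ ('n \<times> 'n)"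
    using lift_tens_at_pos2[OF that, of 0] by (simp add: fscal.tmap_at_pos2)
  have T_inv: "T_inv s = pos2 s (map_matrix ?fs (matrix_inv R))" for s
  proof (rule row_finite_eqI)
    fix f g :: "nat \<Rightarrow> 'n"
    note agree_off_eq_iff(2)[of s f g]
    then show "entry (T_inv s) f g = entry (pos2 s (map_matrix ?fs (matrix_inv R))) f g"
      unfolding T_inv_def matrix_inv_hecke[OF assms(1)]
      by (auto simp: pos2.rep_eq fscal.scale.rep_eq entry_one hecke_inverse_def mat_def
          fscal.hom_diff fscal.hom_zero)
  qed
  have lift_skew: "lift_tens 0 m (tmap ?fs (skew_sym m q R (Suc n))) = projector n" if "n < m" for m n
    using that
  proof (induction n)
    case 0
    show ?case by (simp add: fscal.tmap_tid lift_tens_tid)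
  next
    case (Suc n)
    then have IH: "lift_tens 0 m (tmap ?fs (skew_sym m q R (Suc n))) = projector n" by simp
    have U: "lift_tens 0 m (tmap ?fs (\<lambda>a b. q ^ (n + 1) * tid a b - qnum q (n + 1) * at_pos2 (n + 1) R a b))
        = fscal.scale (q ^ (n + 1)) 1 - fscal.scale (qnum q (n + 1)) (?T n)"
      using pos_at[of n m R] Suc.prems
      by (simp add: lift_tens_tmap_diff lift_tens_tmap_scale fscal.tmap_tid lift_tens_tid)
    show ?case
      unfolding skew_sym.simps lift_tens_tmap_scale fscal.tmap_tprod lift_tens_tprod
      by (simp only: list.map prod_list.Cons prod_list.Nil mult.right_neutral IH U
          skew.simps skew_step_def mult.assoc)
  qed
  have lift_bar: "lift_tens 0 m (L_bar m R (L_shifted q j) (Suc n)) = Lbar n j" if "n < m" for m n j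
    using that
  proof (induction n)
    case 0
    then show ?case using lift_tens_at_pos[of 0 m 0 "L_shifted q j"] by simp
  next
    case (Suc n)
    then show ?case
      by (simp add: lift_tens_tprod pos_at T_inv mult.assoc)
  qed
  have lift_prod: "prod_list (map (\<lambda>s. lift_tens 0 m (L_bar m R (rescale (inverse q ^ (2 * (s - 1))) L_gen) s)) [1..<Suc (Suc n)])
      = ascending Lbar n 0" if "n < m" for m n
    using that
  proof (induction n)
    case 0
    then show ?case using lift_bar[of 0 m 0] by (simp add: L_shifted_def)
  next
    case (Suc n)
    have up: "[1..<Suc (Suc (Suc n))] = [1..<Suc (Suc n)] @ [Suc (Suc n)]" by simp
    show ?case
      unfolding up map_append prod_list.append using Suc lift_bar[of "Suc n" m "Suc n"]
      by (simp add: L_shifted_def del: Lbar.simps L_bar.simps upt_Suc)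
  qed
  have traces_plain: "traces 1 n X = plain_traces n (prod_list (map (\<lambda>s. pos s ?C') [1..<Suc n]) * X)" for n X
  proof (induction n arbitrary: X)
    case 0
    show ?case by simp
  next
    case (Suc n)
    let ?P = "prod_list (map (\<lambda>s. pos s ?C') [1..<Suc n])"
    have "?P \<in> trivial_at (Suc n)"
    proof -
      have "prod_list (map (\<lambda>s. pos s ?C') ss) \<in> trivial_at (Suc n)" if "Suc n \<notin> set ss" for ss
        using that by (induction ss) (auto intro: trivial_one trivial_mult trivial_at_pos)
      then show ?thesis by simp
    qed
    moreover have "mat 1 $ i $ j * x = x * mat 1 $ i $ j" for i j :: 'n and x :: "('n, 'k) free_alg fps"
      by (simp add: mat_def)
    ultimately have "?P * partial_trace ?C' (Suc n) X = partial_trace (mat 1) (Suc n) (?P * (pos (Suc n) ?C' * X))"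
      unfolding partial_trace_pos[of ?C'] by (rule partial_trace_mult_left[symmetric])
    then show ?case using Suc.IH[of "partial_trace ?C' (Suc n) X"] by (simp add: mult.assoc)
  qed
  have wedge: "pos 0 (L_wedge q R ?C L_gen (Suc n)) = wedge n" for n
  proof (cases n)
    case 0
    have "L_shifted q 0 = (L_gen :: ('n, 'k) free_alg fps ^ 'n ^ 'n)" by (simp add: L_shifted_def rescale_one)
    then show ?thesis using 0 by (simp add: L_wedge_def wedge_def)
  next
    case (Suc m)
    let ?k = "Suc n"
    have ne: "(?k = 1) = False" using Suc by simp
    have lift: "lift_tens 0 ?k (tprod ?k (tmap ?fs (skew_sym ?k q R ?k) #
         map (\<lambda>s. L_bar ?k R (rescale (inverse q ^ (2 * (s - 1))) L_gen) s) [1..<Suc ?k]))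
        = projector n * ascending Lbar n 0"
      unfolding lift_tens_tprod list.map prod_list.Cons map_map o_def
      using lift_skew[of n ?k] lift_prod[of n ?k] by (simp only: lessI)
    show ?thesis
      unfolding L_wedge_def ne if_False pos_R_trace_from2 wedge_def traces_plain lift ..
  qed
  have elementary: "entry (elementary n) f g = (if f = g then e_elem q R ?C L_gen n else 0)" for n f g
  proof (cases n)
    case 0
    then show ?thesis by (simp add: entry_one e_elem_def)
  next
    case (Suc m)
    have "f = g \<longleftrightarrow> f 0 = g 0 \<and> agree_off {0} f g"
      by (auto simp: agree_off_def fun_eq_iff) (metis neq0_conv)
    moreover have "agree_off {0} (f(0 := i)) (g(0 := j)) \<longleftrightarrow> agree_off {0} f g" for i j
      by (auto simp: agree_off_def)
    ultimately show ?thesis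
      using Suc by (auto simp: wedge[symmetric] partial_trace.rep_eq pos.rep_eq e_elem_def trace_def
          matrix_matrix_mult_def)
  qed
  have chain: "power_chain p j = pos 0 (rescale (inverse q ^ (2 * j)) (L_pow q L_gen p))" for p j
  proof (induction p)
    case 0
    show ?case by (simp add: rescale_mat_1 pos_mat_1)
  next
    case (Suc p)
    have "(L_shifted q (j + p) :: ('n, 'k) free_alg fps ^ 'n ^ 'n) = rescale (inverse q ^ (2 * j)) (rescale (inverse q ^ (2 * p)) L_gen)"
      by (simp add: L_shifted_def rescale_rescale power_add distrib_left)
    then show ?case by (simp add: Suc.IH rescale_mult pos_mult)
  qed
  obtain n where n: "k = Suc n" using assms(4) by (cases k) auto
  show ?thesis
    unfolding yangian_eq_def
  proof (intro allI)
    fix i j r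
    \<comment> \<open>a pair of indices that differs at most in position 0, where it selects the entry \<open>(i, j)\<close>\<close>
    define f g :: "nat \<Rightarrow> 'n" where "f = (\<lambda>_. i)" and "g = (\<lambda>_. i)(0 := j)"
    have pos0: "entry (pos 0 A) f g = A $ i $ j" for A :: "('n, 'k) free_alg fps ^ 'n ^ 'n"
      by (simp add: pos.rep_eq f_def g_def agree_off_def)
    let ?X = "fscal.scale ((- 1) ^ n * qnum q (n + 1)) (wedge n)
      - (\<Sum>p = 1..n + 1. fscal.scale ((- q) ^ (n + 1 - p)) (power_chain p (n + 1 - p) * elementary (n + 1 - p)))"
    have mult_elementary: "entry (X * elementary m) f g = entry X f g * e_elem q R ?C L_gen m" for X m
      by (subst entry_mult_sum[of "{g}"]) (auto simp: elementary)
    have "entry ?X f g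
      = fscal ((-1) ^ (k + 1) * qnum q k) * L_wedge q R ?C L_gen k $ i $ j
        - (\<Sum>p = 1..k. fscal ((- q) ^ (k - p)) *
        rescale (inverse q ^ (2 * (k - p))) (L_pow q L_gen p) $ i $ j *
        e_elem q R ?C L_gen (k - p))"
      unfolding minus_row_finite_matrix.rep_eq entry_sum fscal.scale.rep_eq mult_elementary chain
        wedge[symmetric] pos0 by (simp add: n mult.assoc)
    moreover have "entry ?X f g
      \<in> yangian_fps_ideal q R"
      using wedge_expansion[of n, unfolded cong_def] by (simp only: ideal_matrices_def mem_Collect_eq)
    ultimately show "fps_nth ((\<chi> i j. fscal ((-1) ^ (k + 1) * qnum q k) * L_wedge q R ?C L_gen k $ i $ j) $ i $ j) r
       - fps_nth ((\<chi> i j. \<Sum>p = 1..k. fscal ((- q) ^ (k - p)) *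
        rescale (inverse q ^ (2 * (k - p))) (L_pow q L_gen p) $ i $ j *
        e_elem q R ?C L_gen (k - p)) $ i $ j) r \<in> yangian_ideal q R"
      unfolding yangian_fps_ideal_def by (simp del: sum.cl_ivl_Suc flip: fps_sub_nth)
  qed
qed

end
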